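(* Let $\underline{C}$ be a triangulated category closed with respect to all small products, and let $C'$ be a set of cocompact objects of $\underline{C}$ such that $C'[1]\subset C'$. Put $C_1={}^{\perp}(C'[1])$ and let $C_2$ be the coenvelope of $C'$ in $\underline{C}$. I. There exists a weight structure $w$ on $\underline{C}$ such that $\underline{C}_{w\le 0}=C_1$ and $\underline{C}_{w\ge 0}=C_2$. II. Let $\underline{C}'$ be the full subcategory of $\underline{C}$ whose class of objects is the coenvelope of $\bigcup_{i\le 0}C'[i]$, and let $\underline{C}_\perp$ be the full subcategory of $\underline C$ whose class of objects is ${}^{\perp}\langle C'\rangle$. Then: 1. $\underline{C}'$ and $\underline{C}_\perp$ are triangulated and closed with respect to all small products. 2. $C_1'=C_1\cap \operatorname{Obj}\underline{C}'$ and $C_2\subset \operatorname{Obj}\underline{C}'$ yield a weight structure $w_{\underline{C}'}$ on $\underline{C}'$ (with $\underline{C}'_{w_{\underline{C}'}\le 0}=C_1'$, $\underline{C}'_{w_{\underline{C}'}\ge 0}=C_2$). 3. $w_{\underline{C}'}$ is non-degenerate from below, i.e. $\bigcap_{l\in\mathbb Z}\underline{C}'_{w_{\underline{C}'}\le l}=\{0\}$. 4. $C_1$ is the extension-closure of $C_1'\cup\operatorname{Obj}\underline{C}_\perp$ in $\underline{C}$. 5. $C_1'$ is closed with respect to all small products. 6. The heart of $w_{\underline{C}'}$ is closed with respect to all small products; small products of weight decompositions in $\underline{C}'$ are weight decompositions; small products of weight Postnikov towers (resp. of weight complexes $t(M_i)$ for $M_i\in\operatorname{Obj}\underline{C}'$)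 are weight Postnikov towers (resp. are weight complexes for $\prod M_i$). 7. $\underline{C}$, $\underline{C}'$, $C_1$, $C_1'$ and $C_2$ (the last three viewed as full subcategories) are Karoubian (idempotent complete). III. For each $c\in C'$ fix a weight complex $(c^i)_{i\in\mathbb Z}$ of $c$ with respect to $w_{\underline{C}'}$. Then the heart of $w_{\underline{C}'}$ is equivalent to the Karoubization of the full subcategory of all small products of objects of the form $c^i$, $c\in C'$, $i\in\mathbb Z$.
   Context: Orthogonality: $X\perp Y$ means $\underline C(X,Y)=0$; for a class $D$, ${}^\perp D=\{Y: Y\perp X\ \forall X\in D\}$. $\langle D\rangle$ is the smallest strict full triangulated subcategory containing $D$. An object $X$ is cocompact if $\underline C(\prod Y_i,X)=\bigoplus\underline C(Y_i,X)$ for all small families. A class is extension-closed if it contains $0$ and for each distinguished triangle $A\to B\to C$ with $A,C$ in the class, $B$ is in the class; the extension-closure of a class is the smallest extension-closed class containing it. Countable homotopy limits: for $\phi_i:Y_i\to Y_{i-1}$ ($i\ge 1$), $\varprojlim Y_i$ denotes $\operatorname{Cone}(d)[-1]$, where $d=\prod \mathrm{id}_{Y_i}+\prod(-\phi_i):\prod Y_i\to\prod Y_i$ (defined up to non-canonical isomorphism). Coenvelope of a class $C'$: the smallest class $C\subset\operatorname{Obj}\underline C$ that contains $C'\cup\{0\}$, is closed under small products, and such that for any $\phi_i:Y_i\to Y_{i-1}$ ($i\ge1$) with $Y_0\in C$ and $\operatorname{Cone}(\phi_i)[-1]\in C$ for all $i\ge 1$, all choices of $\varprojlim_{i\ge 0}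 Y_i$ belong to $C$. Weight structure (homological convention) on $\underline C$: a pair of classes $\underline C_{w\le 0},\underline C_{w\ge0}$, each closed under retracts in $\underline{C}$, with $\underline C_{w\le0}\subset\underline C_{w\le0}[1]$, $\underline C_{w\ge0}[1]\subset\underline C_{w\ge0}$, $\underline C_{w\le0}\perp\underline C_{w\ge0}[1]$, and such that each object $M$ has a weight decomposition: a distinguished triangle $B\to M\to A\to B[1]$ with $B\in\underline C_{w\le0}$, $A\in\underline C_{w\ge0}[1]$. Put $\underline C_{w\le i}=\underline C_{w\le 0}[i]$, $\underline C_{w\ge i}=\underline C_{w\ge 0}[i]$, $\underline C_{w=i}=\underline C_{w\le i}\cap\underline C_{w\ge i}$; the heart is the full subcategory on $\underline C_{w=0}$. $w_{\le i}M$ denotes any choice of an object of $\underline C_{w\le i}$ with a morphism to $M$ whose cone lies in $\underline C_{w\ge i+1}$. A weight Postnikov tower of $M$ is a system of $Y_i=w_{\le i}M$ ($i\in\mathbb Z$, any choices) with morphisms $Y_{i-1}\to Y_i$ compatible with the morphisms to $M$, and distinguished triangles $Y_{i-1}\to Y_i\to M_i\to Y_{i-1}[1]$. The corresponding weight complex $t(M)$ has terms $M^p=M_{-p}[p]$ (objects of the heart) and differentials the composites $M_{-p}[p]\to Y_{-p-1}[p+1]\to M_{-p-1}[p+1]$. *)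

theory Defs
  imports "HOL-Algebra.Free_Abelian_Groups" "HOL-Library.Equipollence"
begin

text \<open>
  Smallness is relative to a collection \<open>U\<close> of index sets, namely those sets of a type
  \<open>'i\<close> that count as small.  A set of any other type is small if it is equipollent to a
  member of \<open>U\<close>.  The sets of cardinality below an inaccessible cardinal (the sets of a
  Grothendieck universe) are an instance; closure under power sets is not required.
\<close>

locale smallness =
  fixes U :: "'i set set"
  assumes infinite_small: "\<exists>I\<in>U. infinite I"
    and lepoll_small: "\<lbrakk>I \<in> U; J \<lesssim> I\<rbrakk> \<Longrightarrow> J \<in> U"
    and UN_small: "\<lbrakk>I \<in> U; \<And>i. i \<in> I \<Longrightarrow> F i \<in> U\<rbrakk> \<Longrightarrow> (\<Union>i\<in>I. F (i::'i)) \<in> U"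

definition is_small :: "'i set set \<Rightarrow> 'a set \<Rightarrow> bool" where
  "is_small U A \<longleftrightarrow> (\<exists>I\<in>U. A \<approx> I)"


section \<open>Categories\<close>

text \<open>The sets \<open>Hom X Y\<close> need not be disjoint; elements of the types outside \<open>Ob\<close> and
  \<open>Hom\<close> are irrelevant.\<close>

record ('o, 'm) cat =
  Ob :: "'o set"
  Hom :: "'o \<Rightarrow> 'o \<Rightarrow> 'm set"
  Idm :: "'o \<Rightarrow> 'm"
  Cmp :: "'m \<Rightarrow> 'm \<Rightarrow> 'm"  (infixl "\<cdot>\<index>" 70)

locale category =
  fixes T (structure)
  assumes Idm_in: "X \<in> Ob T \<Longrightarrow> Idm T X \<in> Hom T X X"
    and Cmp_in: "\<lbrakk>X \<in> Ob T; Y \<in> Ob T; Z \<in> Ob T; f \<in> Hom T X Y; g \<in> Hom T Y Z\<rbrakk>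
      \<Longrightarrow> g \<cdot> f \<in> Hom T X Z"
    and Idm_left: "\<lbrakk>X \<in> Ob T; Y \<in> Ob T; f \<in> Hom T X Y\<rbrakk> \<Longrightarrow> Idm T Y \<cdot> f = f"
    and Idm_right: "\<lbrakk>X \<in> Ob T; Y \<in> Ob T; f \<in> Hom T X Y\<rbrakk> \<Longrightarrow> f \<cdot> Idm T X = f"
    and Cmp_assoc: "\<lbrakk>W \<in> Ob T; X \<in> Ob T; Y \<in> Ob T; Z \<in> Ob T;
        f \<in> Hom T W X; g \<in> Hom T X Y; h \<in> Hom T Y Z\<rbrakk> \<Longrightarrow> (h \<cdot> g) \<cdot> f = h \<cdot> (g \<cdot> f)"

definition is_iso :: "('o, 'm, 'z) cat_scheme \<Rightarrow> 'o \<Rightarrow> 'o \<Rightarrow> 'm \<Rightarrow> bool" where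
  "is_iso T X Y f \<longleftrightarrow> f \<in> Hom T X Y \<and>
     (\<exists>g\<in>Hom T Y X. g \<cdot>\<^bsub>T\<^esub> f = Idm T X \<and> f \<cdot>\<^bsub>T\<^esub> g = Idm T Y)"

definition is_zero :: "('o, 'm, 'z) cat_scheme \<Rightarrow> 'o \<Rightarrow> bool" where
  "is_zero T Z \<longleftrightarrow> Z \<in> Ob T \<and>
     (\<forall>X\<in>Ob T. (\<exists>!f. f \<in> Hom T X Z) \<and> (\<exists>!f. f \<in> Hom T Z X))"

definition is_retract :: "('o, 'm, 'z) cat_scheme \<Rightarrow> 'o \<Rightarrow> 'o \<Rightarrow> bool" where
  "is_retract T X Y \<longleftrightarrow> (\<exists>s\<in>Hom T X Y. \<exists>r\<in>Hom T Y X. r \<cdot>\<^bsub>T\<^esub> s = Idm T X)"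

definition retract_closed :: "('o, 'm, 'z) cat_scheme \<Rightarrow> 'o set \<Rightarrow> bool" where
  "retract_closed T D \<longleftrightarrow> (\<forall>Y\<in>D. \<forall>X\<in>Ob T. is_retract T X Y \<longrightarrow> X \<in> D)"

definition strict :: "('o, 'm, 'z) cat_scheme \<Rightarrow> 'o set \<Rightarrow> bool" where
  "strict T D \<longleftrightarrow> (\<forall>Y\<in>D. \<forall>X\<in>Ob T. (\<exists>f. is_iso T X Y f) \<longrightarrow> X \<in> D)"

definition karoubian :: "('o, 'm, 'z) cat_scheme \<Rightarrow> bool" where
  "karoubian T \<longleftrightarrow> (\<forall>X\<in>Ob T. \<forall>e\<in>Hom T X X. e \<cdot>\<^bsub>T\<^esub> e = e \<longrightarrow>
     (\<exists>Y\<in>Ob T. \<exists>s\<in>Hom T Y X. \<exists>r\<in>Hom T X Y. r \<cdot>\<^bsub>T\<^esub> s = Idm T Y \<and> s \<cdot>\<^bsub>T\<^esub> r = e))"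

definition karoubization :: "('o, 'm, 'z) cat_scheme \<Rightarrow> ('o \<times> 'm, 'm) cat" where
  "karoubization T = \<lparr>
     Ob = {(X, e). X \<in> Ob T \<and> e \<in> Hom T X X \<and> e \<cdot>\<^bsub>T\<^esub> e = e},
     Hom = (\<lambda>(X, e) (Y, e'). {f \<in> Hom T X Y. e' \<cdot>\<^bsub>T\<^esub> f \<cdot>\<^bsub>T\<^esub> e = f}),
     Idm = (\<lambda>(X, e). e),
     Cmp = Cmp T\<rparr>"

definition is_product ::
    "('o, 'm, 'z) cat_scheme \<Rightarrow> 'j set \<Rightarrow> ('j \<Rightarrow> 'o) \<Rightarrow> 'o \<Rightarrow> ('j \<Rightarrow> 'm) \<Rightarrow> bool" where
  "is_product T I X P p \<longleftrightarrow> P \<in> Ob T \<and> (\<forall>i\<in>I. X i \<in> Ob T \<and> p i \<in> Hom T P (X i)) \<and>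
     (\<forall>S\<in>Ob T. \<forall>f. (\<forall>i\<in>I. f i \<in> Hom T S (X i)) \<longrightarrow>
        (\<exists>!u. u \<in> Hom T S P \<and> (\<forall>i\<in>I. p i \<cdot>\<^bsub>T\<^esub> u = f i)))"

definition has_products :: "'i set set \<Rightarrow> ('o, 'm, 'z) cat_scheme \<Rightarrow> bool" where
  "has_products U T \<longleftrightarrow>
     (\<forall>I\<in>U. \<forall>X. X ` I \<subseteq> Ob T \<longrightarrow> (\<exists>P p. is_product T I X P p))"

definition closed_under_products ::
    "'i set set \<Rightarrow> ('o, 'm, 'z) cat_scheme \<Rightarrow> 'o set \<Rightarrow> bool" where
  "closed_under_products U T D \<longleftrightarrow>
     (\<forall>I\<in>U. \<forall>X P p. X ` I \<subseteq> D \<and> is_product T I X P p \<longrightarrow> P \<in> D)"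

text \<open>\<open>u : P \<rightarrow> Q\<close> is the product of the morphisms \<open>f i : X i \<rightarrow> Y i\<close>, where \<open>p\<close> and \<open>q\<close> are the
  projections of the products \<open>P = \<Prod> X i\<close> and \<open>Q = \<Prod> Y i\<close>.\<close>

definition is_product_map :: "('o, 'm, 'z) cat_scheme \<Rightarrow> 'j set \<Rightarrow> ('j \<Rightarrow> 'm)
    \<Rightarrow> 'o \<Rightarrow> ('j \<Rightarrow> 'm) \<Rightarrow> 'o \<Rightarrow> ('j \<Rightarrow> 'm) \<Rightarrow> 'm \<Rightarrow> bool" where
  "is_product_map T I f P p Q q u \<longleftrightarrow>
     u \<in> Hom T P Q \<and> (\<forall>i\<in>I. q i \<cdot>\<^bsub>T\<^esub> u = f i \<cdot>\<^bsub>T\<^esub> p i)"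

definition is_functor :: "('o, 'm, 'z) cat_scheme \<Rightarrow> ('p, 'n, 'y) cat_scheme
    \<Rightarrow> ('o \<Rightarrow> 'p) \<Rightarrow> ('o \<Rightarrow> 'o \<Rightarrow> 'm \<Rightarrow> 'n) \<Rightarrow> bool" where
  "is_functor A B FO FM \<longleftrightarrow>
     (\<forall>X\<in>Ob A. FO X \<in> Ob B \<and> FM X X (Idm A X) = Idm B (FO X)) \<and>
     (\<forall>X\<in>Ob A. \<forall>Y\<in>Ob A. \<forall>f\<in>Hom A X Y. FM X Y f \<in> Hom B (FO X) (FO Y)) \<and>
     (\<forall>X\<in>Ob A. \<forall>Y\<in>Ob A. \<forall>Z\<in>Ob A. \<forall>f\<in>Hom A X Y. \<forall>g\<in>Hom A Y Z.
        FM X Z (g \<cdot>\<^bsub>A\<^esub> f) = FM Y Z g \<cdot>\<^bsub>B\<^esub> FM X Y f)"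

definition is_nat_iso :: "('o, 'm, 'z) cat_scheme \<Rightarrow> ('p, 'n, 'y) cat_scheme
    \<Rightarrow> ('o \<Rightarrow> 'p) \<Rightarrow> ('o \<Rightarrow> 'o \<Rightarrow> 'm \<Rightarrow> 'n) \<Rightarrow> ('o \<Rightarrow> 'p) \<Rightarrow> ('o \<Rightarrow> 'o \<Rightarrow> 'm \<Rightarrow> 'n)
    \<Rightarrow> ('o \<Rightarrow> 'n) \<Rightarrow> bool" where
  "is_nat_iso A B FO FM GO GM \<eta> \<longleftrightarrow>
     (\<forall>X\<in>Ob A. is_iso B (FO X) (GO X) (\<eta> X)) \<and>
     (\<forall>X\<in>Ob A. \<forall>Y\<in>Ob A. \<forall>f\<in>Hom A X Y. GM X Y f \<cdot>\<^bsub>B\<^esub> \<eta> X = \<eta> Y \<cdot>\<^bsub>B\<^esub> FM X Y f)"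

definition equivalent_categories ::
    "('o, 'm, 'z) cat_scheme \<Rightarrow> ('p, 'n, 'y) cat_scheme \<Rightarrow> bool" where
  "equivalent_categories A B \<longleftrightarrow>
     (\<exists>FO FM GO GM \<eta> \<epsilon>. is_functor A B FO FM \<and> is_functor B A GO GM \<and>
        is_nat_iso A A (\<lambda>X. GO (FO X)) (\<lambda>X Y f. GM (FO X) (FO Y) (FM X Y f))
          (\<lambda>X. X) (\<lambda>X Y f. f) \<eta> \<and>
        is_nat_iso B B (\<lambda>X. FO (GO X)) (\<lambda>X Y f. FM (GO X) (GO Y) (GM X Y f))
          (\<lambda>X. X) (\<lambda>X Y f. f) \<epsilon>)"


section \<open>Triangulated categories\<close>

text \<open>The shift is an automorphism of the category, given through its iterates:
  \<open>ShO T i X = X[i]\<close> and \<open>ShM T i f = f[i]\<close> for every integer \<open>i\<close>.  A member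
  \<open>(X, Y, Z, f, g, h)\<close> of \<open>Dist\<close> is a triangle \<open>X \<rightarrow> Y \<rightarrow> Z \<rightarrow> X[1]\<close>.\<close>

record ('o, 'm) tcat = "('o, 'm) cat" +
  Add :: "'m \<Rightarrow> 'm \<Rightarrow> 'm"
  Zero :: "'o \<Rightarrow> 'o \<Rightarrow> 'm"
  ShO :: "int \<Rightarrow> 'o \<Rightarrow> 'o"
  ShM :: "int \<Rightarrow> 'm \<Rightarrow> 'm"
  Dist :: "('o \<times> 'o \<times> 'o \<times> 'm \<times> 'm \<times> 'm) set"

text \<open>The abelian group \<open>Hom X Y\<close>, as a commutative group in the (multiplicative) library sense.\<close>

definition hom_group :: "('o, 'm, 'z) tcat_scheme \<Rightarrow> 'o \<Rightarrow> 'o \<Rightarrow> 'm monoid" where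
  "hom_group T X Y = \<lparr>carrier = Hom T X Y, mult = Add T, one = Zero T X Y\<rparr>"

definition neg :: "('o, 'm, 'z) tcat_scheme \<Rightarrow> 'o \<Rightarrow> 'o \<Rightarrow> 'm \<Rightarrow> 'm" where
  "neg T X Y f = inv\<^bsub>hom_group T X Y\<^esub> f"

locale additive_category = category +
  assumes hom_group: "\<lbrakk>X \<in> Ob T; Y \<in> Ob T\<rbrakk> \<Longrightarrow> comm_group (hom_group T X Y)"
    and Cmp_Add_left: "\<lbrakk>X \<in> Ob T; Y \<in> Ob T; Z \<in> Ob T; f \<in> Hom T X Y; f' \<in> Hom T X Y;
        g \<in> Hom T Y Z\<rbrakk> \<Longrightarrow> g \<cdot> Add T f f' = Add T (g \<cdot> f) (g \<cdot> f')"
    and Cmp_Add_right: "\<lbrakk>X \<in> Ob T; Y \<in> Ob T; Z \<in> Ob T; f \<in> Hom T X Y; g \<in> Hom T Y Z;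
        g' \<in> Hom T Y Z\<rbrakk> \<Longrightarrow> Add T g g' \<cdot> f = Add T (g \<cdot> f) (g' \<cdot> f)"
    and ex_zero: "\<exists>Z. is_zero T Z"
    and ex_binary_product: "\<lbrakk>X \<in> Ob T; Y \<in> Ob T\<rbrakk>
      \<Longrightarrow> \<exists>P p. is_product T (UNIV :: bool set) (\<lambda>b. if b then X else Y) P p"

locale triangulated_category = additive_category +
  assumes ShO_in: "X \<in> Ob T \<Longrightarrow> ShO T i X \<in> Ob T"
    and ShO_0: "X \<in> Ob T \<Longrightarrow> ShO T 0 X = X"
    and ShO_add: "X \<in> Ob T \<Longrightarrow> ShO T i (ShO T j X) = ShO T (i + j) X"
    and ShM_in: "\<lbrakk>X \<in> Ob T; Y \<in> Ob T; f \<in> Hom T X Y\<rbrakk>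
      \<Longrightarrow> ShM T i f \<in> Hom T (ShO T i X) (ShO T i Y)"
    and ShM_0: "\<lbrakk>X \<in> Ob T; Y \<in> Ob T; f \<in> Hom T X Y\<rbrakk> \<Longrightarrow> ShM T 0 f = f"
    and ShM_add: "\<lbrakk>X \<in> Ob T; Y \<in> Ob T; f \<in> Hom T X Y\<rbrakk>
      \<Longrightarrow> ShM T i (ShM T j f) = ShM T (i + j) f"
    and ShM_Idm: "X \<in> Ob T \<Longrightarrow> ShM T i (Idm T X) = Idm T (ShO T i X)"
    and ShM_Cmp: "\<lbrakk>X \<in> Ob T; Y \<in> Ob T; Z \<in> Ob T; f \<in> Hom T X Y; g \<in> Hom T Y Z\<rbrakk>
      \<Longrightarrow> ShM T i (g \<cdot> f) = ShM T i g \<cdot> ShM T i f"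
    and ShM_Add: "\<lbrakk>X \<in> Ob T; Y \<in> Ob T; f \<in> Hom T X Y; f' \<in> Hom T X Y\<rbrakk>
      \<Longrightarrow> ShM T i (Add T f f') = Add T (ShM T i f) (ShM T i f')"
    and Dist_in: "(X, Y, Z, f, g, h) \<in> Dist T \<Longrightarrow> X \<in> Ob T \<and> Y \<in> Ob T \<and> Z \<in> Ob T \<and>
        f \<in> Hom T X Y \<and> g \<in> Hom T Y Z \<and> h \<in> Hom T Z (ShO T 1 X)"
    and Dist_iso: "\<lbrakk>(X, Y, Z, f, g, h) \<in> Dist T; X' \<in> Ob T; Y' \<in> Ob T; Z' \<in> Ob T;
        f' \<in> Hom T X' Y'; g' \<in> Hom T Y' Z'; h' \<in> Hom T Z' (ShO T 1 X');
        is_iso T X X' a; is_iso T Y Y' b; is_iso T Z Z' c;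
        b \<cdot> f = f' \<cdot> a; c \<cdot> g = g' \<cdot> b; ShM T 1 a \<cdot> h = h' \<cdot> c\<rbrakk>
      \<Longrightarrow> (X', Y', Z', f', g', h') \<in> Dist T"
    and Dist_Idm: "\<lbrakk>X \<in> Ob T; is_zero T Z\<rbrakk>
      \<Longrightarrow> (X, X, Z, Idm T X, Zero T X Z, Zero T Z (ShO T 1 X)) \<in> Dist T"
    and ex_cone: "\<lbrakk>X \<in> Ob T; Y \<in> Ob T; f \<in> Hom T X Y\<rbrakk>
      \<Longrightarrow> \<exists>Z g h. (X, Y, Z, f, g, h) \<in> Dist T"
    and rotate: "\<lbrakk>X \<in> Ob T; Y \<in> Ob T; Z \<in> Ob T;
        f \<in> Hom T X Y; g \<in> Hom T Y Z; h \<in> Hom T Z (ShO T 1 X)\<rbrakk>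
      \<Longrightarrow> (X, Y, Z, f, g, h) \<in> Dist T \<longleftrightarrow>
        (Y, Z, ShO T 1 X, g, h, neg T (ShO T 1 X) (ShO T 1 Y) (ShM T 1 f)) \<in> Dist T"
    and complete_map: "\<lbrakk>(X, Y, Z, f, g, h) \<in> Dist T; (X', Y', Z', f', g', h') \<in> Dist T;
        a \<in> Hom T X X'; b \<in> Hom T Y Y'; b \<cdot> f = f' \<cdot> a\<rbrakk>
      \<Longrightarrow> \<exists>c\<in>Hom T Z Z'. c \<cdot> g = g' \<cdot> b \<and> ShM T 1 a \<cdot> h = h' \<cdot> c"
    and octahedral: "\<lbrakk>(X, Y, A, f, u, du) \<in> Dist T; (Y, Z, B, g, v, dv) \<in> Dist T;
        (X, Z, C, g \<cdot> f, w, dw) \<in> Dist T\<rbrakk>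
      \<Longrightarrow> \<exists>a b. (A, C, B, a, b, ShM T 1 u \<cdot> dv) \<in> Dist T \<and>
        a \<cdot> u = w \<cdot> g \<and> dw \<cdot> a = du \<and> b \<cdot> w = v \<and> dv \<cdot> b = ShM T 1 f \<cdot> dw"

text \<open>The full subcategory on a class of objects, with the triangles of \<open>T\<close> that lie in it.\<close>

definition full_sub :: "('o, 'm, 'z) tcat_scheme \<Rightarrow> 'o set \<Rightarrow> ('o, 'm, 'z) tcat_scheme" where
  "full_sub T D = T\<lparr>Ob := D,
     Dist := {(X, Y, Z, f, g, h) \<in> Dist T. X \<in> D \<and> Y \<in> D \<and> Z \<in> D}\<rparr>"

definition triangulated_subcategory :: "('o, 'm, 'z) tcat_scheme \<Rightarrow> 'o set \<Rightarrow> bool" where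
  "triangulated_subcategory T D \<longleftrightarrow>
     D \<subseteq> Ob T \<and> strict T D \<and> triangulated_category (full_sub T D)"

definition triangulated_closure :: "('o, 'm, 'z) tcat_scheme \<Rightarrow> 'o set \<Rightarrow> 'o set" where
  "triangulated_closure T D = \<Inter>{E. triangulated_subcategory T E \<and> D \<subseteq> E}"

definition orthogonal :: "('o, 'm, 'z) tcat_scheme \<Rightarrow> 'o set \<Rightarrow> 'o set \<Rightarrow> bool" where
  "orthogonal T D E \<longleftrightarrow> (\<forall>X\<in>D. \<forall>Y\<in>E. Hom T X Y = {Zero T X Y})"

definition left_orthogonal :: "('o, 'm, 'z) tcat_scheme \<Rightarrow> 'o set \<Rightarrow> 'o set" where
  "left_orthogonal T D = {Y \<in> Ob T. orthogonal T {Y} D}"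

definition is_cone :: "('o, 'm, 'z) tcat_scheme \<Rightarrow> 'o \<Rightarrow> 'o \<Rightarrow> 'm \<Rightarrow> 'o \<Rightarrow> bool" where
  "is_cone T X Y f Z \<longleftrightarrow> (\<exists>g h. (X, Y, Z, f, g, h) \<in> Dist T)"

definition extension_closed :: "('o, 'm, 'z) tcat_scheme \<Rightarrow> 'o set \<Rightarrow> bool" where
  "extension_closed T D \<longleftrightarrow> {Z. is_zero T Z} \<subseteq> D \<and>
     (\<forall>A B C f g h. (A, B, C, f, g, h) \<in> Dist T \<and> A \<in> D \<and> C \<in> D \<longrightarrow> B \<in> D)"

definition extension_closure :: "('o, 'm, 'z) tcat_scheme \<Rightarrow> 'o set \<Rightarrow> 'o set" where
  "extension_closure T D = \<Inter>{E. E \<subseteq> Ob T \<and> extension_closed T E \<and> D \<subseteq> E}"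

text \<open>The map \<open>\<Oplus> Hom (Y i) X \<rightarrow> Hom (\<Prod> Y i) X\<close>, \<open>(f i) \<mapsto> \<Sum> f i \<cdot> p i\<close>, is bijective;
  \<open>sum_group\<close> is the direct sum and \<open>gfinprod\<close> the sum over the finite support.\<close>

definition cocompact :: "'i set set \<Rightarrow> ('o, 'm, 'z) tcat_scheme \<Rightarrow> 'o \<Rightarrow> bool" where
  "cocompact U T X \<longleftrightarrow> X \<in> Ob T \<and>
     (\<forall>I\<in>U. \<forall>Y P p. is_product T I Y P p \<longrightarrow>
        (\<lambda>f. gfinprod (hom_group T P X) (\<lambda>i. f i \<cdot>\<^bsub>T\<^esub> p i) I)
          \<in> iso (sum_group I (\<lambda>i. hom_group T (Y i) X)) (hom_group T P X))"

text \<open>\<open>L\<close> is a choice of the homotopy limit of \<open>\<phi> i : Y i \<rightarrow> Y (i - 1)\<close>, \<open>i \<ge> 1\<close>: the object \<open>L[1]\<close>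
  is a cone of the endomorphism \<open>d\<close> of \<open>\<Prod> Y i\<close> with components \<open>p i - \<phi> (i + 1) \<cdot> p (i + 1)\<close>.\<close>

definition is_holim ::
    "('o, 'm, 'z) tcat_scheme \<Rightarrow> (nat \<Rightarrow> 'o) \<Rightarrow> (nat \<Rightarrow> 'm) \<Rightarrow> 'o \<Rightarrow> bool" where
  "is_holim T Y \<phi> L \<longleftrightarrow> L \<in> Ob T \<and>
     (\<exists>P p d. is_product T UNIV Y P p \<and> d \<in> Hom T P P \<and>
        (\<forall>i. p i \<cdot>\<^bsub>T\<^esub> d = Add T (p i) (neg T P (Y i) (\<phi> (Suc i) \<cdot>\<^bsub>T\<^esub> p (Suc i)))) \<and>
        is_cone T P P d (ShO T 1 L))"

text \<open>As cones are defined up to isomorphism, \<open>Cone(\<phi> i)[-1] \<in> E\<close> reads: some \<open>F \<in> E\<close> is such that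
  \<open>F[1]\<close> is a cone of \<open>\<phi> i\<close>.\<close>

definition coenvelope_closed :: "'i set set \<Rightarrow> ('o, 'm, 'z) tcat_scheme \<Rightarrow> 'o set \<Rightarrow> bool" where
  "coenvelope_closed U T E \<longleftrightarrow> {Z. is_zero T Z} \<subseteq> E \<and> closed_under_products U T E \<and>
     (\<forall>Y \<phi> L. (\<forall>i. Y i \<in> Ob T \<and> \<phi> (Suc i) \<in> Hom T (Y (Suc i)) (Y i)) \<and> Y 0 \<in> E \<and>
        (\<forall>i. \<exists>F\<in>E. is_cone T (Y (Suc i)) (Y i) (\<phi> (Suc i)) (ShO T 1 F)) \<and>
        is_holim T Y \<phi> L \<longrightarrow> L \<in> E)"

definition coenvelope :: "'i set set \<Rightarrow> ('o, 'm, 'z) tcat_scheme \<Rightarrow> 'o set \<Rightarrow> 'o set" where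
  "coenvelope U T D = \<Inter>{E. E \<subseteq> Ob T \<and> coenvelope_closed U T E \<and> D \<subseteq> E}"


section \<open>Weight structures\<close>

text \<open>A weight structure \<open>w\<close> on \<open>T\<close> is given by the classes \<open>L\<close> of objects of weights \<open>\<le> 0\<close> and
  \<open>G\<close> of objects of weights \<open>\<ge> 0\<close>; then \<open>ShO T i ` L\<close> and \<open>ShO T i ` G\<close> are the classes of
  objects of weights \<open>\<le> i\<close> and \<open>\<ge> i\<close>.\<close>

definition weight_decomposition :: "('o, 'm, 'z) tcat_scheme \<Rightarrow> 'o set \<Rightarrow> 'o set
    \<Rightarrow> 'o \<Rightarrow> 'o \<Rightarrow> 'o \<Rightarrow> 'm \<Rightarrow> 'm \<Rightarrow> 'm \<Rightarrow> bool" where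
  "weight_decomposition T L G B M A b a d \<longleftrightarrow>
     B \<in> L \<and> A \<in> ShO T 1 ` G \<and> (B, M, A, b, a, d) \<in> Dist T"

definition weight_structure ::
    "('o, 'm, 'z) tcat_scheme \<Rightarrow> 'o set \<Rightarrow> 'o set \<Rightarrow> bool" where
  "weight_structure T L G \<longleftrightarrow>
     L \<subseteq> Ob T \<and> G \<subseteq> Ob T \<and> retract_closed T L \<and> retract_closed T G \<and>
     L \<subseteq> ShO T 1 ` L \<and> ShO T 1 ` G \<subseteq> G \<and> orthogonal T L (ShO T 1 ` G) \<and>
     (\<forall>M\<in>Ob T. \<exists>B A b a d. weight_decomposition T L G B M A b a d)"

definition nondegenerate_below :: "('o, 'm, 'z) tcat_scheme \<Rightarrow> 'o set \<Rightarrow> bool" where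
  "nondegenerate_below T L \<longleftrightarrow> (\<Inter>l::int. ShO T l ` L) = {Z. is_zero T Z}"

text \<open>The data of a weight Postnikov tower of \<open>M\<close>: objects \<open>Y i = lev t i\<close> with morphisms
  \<open>aug t i : Y i \<rightarrow> M\<close> and \<open>lnk t i : Y (i - 1) \<rightarrow> Y i\<close>, objects \<open>M i = gr t i\<close>, and
  \<open>prj t i : Y i \<rightarrow> M i\<close>, \<open>bnd t i : M i \<rightarrow> Y (i - 1)[1]\<close>.\<close>

record ('o, 'm) tower =
  lev :: "int \<Rightarrow> 'o"
  aug :: "int \<Rightarrow> 'm"
  lnk :: "int \<Rightarrow> 'm"
  gr :: "int \<Rightarrow> 'o"
  prj :: "int \<Rightarrow> 'm"
  bnd :: "int \<Rightarrow> 'm"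

definition weight_Postnikov_tower :: "('o, 'm, 'z) tcat_scheme \<Rightarrow> 'o set \<Rightarrow> 'o set
    \<Rightarrow> 'o \<Rightarrow> ('o, 'm) tower \<Rightarrow> bool" where
  "weight_Postnikov_tower T L G M t \<longleftrightarrow> (\<forall>i.
     lev t i \<in> ShO T i ` L \<and>
     (\<exists>A \<in> ShO T (i + 1) ` G. is_cone T (lev t i) M (aug t i) A) \<and>
     aug t i \<cdot>\<^bsub>T\<^esub> lnk t i = aug t (i - 1) \<and>
     (lev t (i - 1), lev t i, gr t i, lnk t i, prj t i, bnd t i) \<in> Dist T)"

definition is_weight_complex :: "('o, 'm, 'z) tcat_scheme \<Rightarrow> 'o set \<Rightarrow> 'o set
    \<Rightarrow> 'o \<Rightarrow> (int \<Rightarrow> 'o) \<Rightarrow> (int \<Rightarrow> 'm) \<Rightarrow> bool" where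
  "is_weight_complex T L G M X d \<longleftrightarrow> (\<exists>t. weight_Postnikov_tower T L G M t \<and>
     (\<forall>p. X p = ShO T p (gr t (- p)) \<and>
          d p = ShM T (p + 1) (prj t (- p - 1)) \<cdot>\<^bsub>T\<^esub> ShM T p (bnd t (- p))))"

text \<open>In the next two definitions the target of a connecting morphism is a shifted product, regarded
  as the product of the shifted objects with the shifted projections.\<close>

definition products_of_weight_decompositions ::
    "'i set set \<Rightarrow> ('o, 'm, 'z) tcat_scheme \<Rightarrow> 'o set \<Rightarrow> 'o set \<Rightarrow> bool" where
  "products_of_weight_decompositions U T L G \<longleftrightarrow>
     (\<forall>I\<in>U. \<forall>B M A b a d PB pB PM pM PA pA u v w.
        (\<forall>i\<in>I. weight_decomposition T L G (B i) (M i) (A i) (b i) (a i) (d i)) \<and>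
        is_product T I B PB pB \<and> is_product T I M PM pM \<and> is_product T I A PA pA \<and>
        is_product_map T I b PB pB PM pM u \<and>
        is_product_map T I a PM pM PA pA v \<and>
        is_product_map T I d PA pA (ShO T 1 PB) (\<lambda>i. ShM T 1 (pB i)) w \<longrightarrow>
        weight_decomposition T L G PB PM PA u v w)"

definition is_product_tower :: "('o, 'm, 'z) tcat_scheme \<Rightarrow> 'i set \<Rightarrow> ('i \<Rightarrow> ('o, 'm) tower)
    \<Rightarrow> 'o \<Rightarrow> ('i \<Rightarrow> 'm) \<Rightarrow> ('o, 'm) tower \<Rightarrow> bool" where
  "is_product_tower T I t PM pM s \<longleftrightarrow> (\<exists>q r. \<forall>n.
     is_product T I (\<lambda>i. lev (t i) n) (lev s n) (q n) \<and>
     is_product T I (\<lambda>i. gr (t i) n) (gr s n) (r n) \<and>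
     is_product_map T I (\<lambda>i. aug (t i) n) (lev s n) (q n) PM pM (aug s n) \<and>
     is_product_map T I (\<lambda>i. lnk (t i) n) (lev s (n - 1)) (q (n - 1)) (lev s n) (q n) (lnk s n) \<and>
     is_product_map T I (\<lambda>i. prj (t i) n) (lev s n) (q n) (gr s n) (r n) (prj s n) \<and>
     is_product_map T I (\<lambda>i. bnd (t i) n) (gr s n) (r n)
       (ShO T 1 (lev s (n - 1))) (\<lambda>i. ShM T 1 (q (n - 1) i)) (bnd s n))"

definition products_of_weight_Postnikov_towers ::
    "'i set set \<Rightarrow> ('o, 'm, 'z) tcat_scheme \<Rightarrow> 'o set \<Rightarrow> 'o set \<Rightarrow> bool" where
  "products_of_weight_Postnikov_towers U T L G \<longleftrightarrow>
     (\<forall>I\<in>U. \<forall>M t PM pM s.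
        (\<forall>i\<in>I. weight_Postnikov_tower T L G (M i) (t i)) \<and>
        is_product T I M PM pM \<and> is_product_tower T I t PM pM s \<longrightarrow>
        weight_Postnikov_tower T L G PM s)"

definition is_product_complex :: "('o, 'm, 'z) cat_scheme \<Rightarrow> 'i set
    \<Rightarrow> ('i \<Rightarrow> int \<Rightarrow> 'o) \<Rightarrow> ('i \<Rightarrow> int \<Rightarrow> 'm) \<Rightarrow> (int \<Rightarrow> 'o) \<Rightarrow> (int \<Rightarrow> 'm) \<Rightarrow> bool" where
  "is_product_complex T I X d Q e \<longleftrightarrow> (\<exists>q. \<forall>n.
     is_product T I (\<lambda>i. X i n) (Q n) (q n) \<and>
     is_product_map T I (\<lambda>i. d i n) (Q n) (q n) (Q (n + 1)) (q (n + 1)) (e n))"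

definition products_of_weight_complexes ::
    "'i set set \<Rightarrow> ('o, 'm, 'z) tcat_scheme \<Rightarrow> 'o set \<Rightarrow> 'o set \<Rightarrow> bool" where
  "products_of_weight_complexes U T L G \<longleftrightarrow>
     (\<forall>I\<in>U. \<forall>M X d PM pM Q e.
        (\<forall>i\<in>I. is_weight_complex T L G (M i) (X i) (d i)) \<and>
        is_product T I M PM pM \<and> is_product_complex T I X d Q e \<longrightarrow>
        is_weight_complex T L G PM Q e)"

definition products_of_objects ::
    "'i set set \<Rightarrow> ('o, 'm, 'z) cat_scheme \<Rightarrow> 'o set \<Rightarrow> 'o set" where
  "products_of_objects U T D = {P. \<exists>I\<in>U. \<exists>X p. X ` I \<subseteq> D \<and> is_product T I X P p}"

end

theory Submission
  imports Defs
begin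

text \<open>
  The weight decompositions of (I) are constructed by the dual of the small object argument: one kills the
  morphisms from \<open>M\<close> to the objects of \<open>C'[1]\<close> step by step and passes to a countable homotopy limit, whose
  morphisms to a cocompact object factor through a finite stage.  The orthogonality of \<open>C\<^sub>1\<close> and \<open>C\<^sub>2[1]\<close> is a
  Mittag-Leffler argument.  Applying (I) also to the shift-stable class of all \<open>C'[i]\<close> yields the decomposition of
  \<open>T\<close> into \<open>Dperp\<close> and \<open>D\<close>, from which (II) follows.  For (III), take \<open>M\<close> in the heart, let \<open>Q\<close> be the product of
  the \<open>c\<^sup>0\<close> over all \<open>M \<rightarrow> c\<close>, each of which factors through \<open>c\<^sup>0\<close>; the fibre of \<open>M \<rightarrow> Q\<close> has no morphisms
  to \<open>C'\<close>, hence is of weight at most \<open>-1\<close>, and so \<open>M \<rightarrow> Q\<close> is a split monomorphism.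
\<close>


section \<open>Small sets\<close>

text \<open>Cones and homotopy limits have only weak universal properties, and this shapes the
  proof: a comparison morphism is shown to be an isomorphism by testing it on Hom(S, -) for all S,
  and the derived-limit term, which lives on S[1], is solved by an explicit recursion. The
  Mittag-Leffler condition holds because a fibre F of Y_{i+1} -> Y_i with Hom(M, F[1]) = 0 makes
  Hom(M, Y_{i+1}) -> Hom(M, Y_i) onto. The coenvelope is not defined to be closed under extensions
  or retracts: the former comes from an eventually constant tower, the latter from a swindle
  combined with closure under [1]. For a shift-stable generating class both halves of the weight
  structure are stable under all shifts, so weight decompositions become a semi-orthogonal
  decomposition; non-degeneracy and the description of \<open>C1\<close> rest on it. In (III) the
  factorisation through c^0 uses that c has weight at least 0: then w_{<=0} c also has weight at
  least 0, the map w_{<=-1} c -> w_{<=0} c vanishes, and w_{<=0} c is a retract of c^0.\<close>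

context smallness
begin

lemma is_small_lepoll:
  assumes "is_small U A" "B \<lesssim> A"
  shows "is_small U B"
proof -
  obtain I where I: "I \<in> U" "A \<approx> I" using assms by (auto simp: is_small_def)
  have "B \<lesssim> I" using assms(2) I(2) lepoll_trans2 by blast
  then obtain J where "J \<subseteq> I" "B \<approx> J" by (metis inj_on_image_eqpoll_self lepoll_def eqpoll_sym)
  then show ?thesis using I(1) lepoll_small subset_imp_lepoll by (metis is_small_def)
qed

lemma is_small_surj: "is_small U A \<Longrightarrow> B \<subseteq> f ` A \<Longrightarrow> is_small U B"
  using is_small_lepoll subset_image_lepoll by blast

lemma small_set: "I \<in> U \<Longrightarrow> is_small U I"
  using is_small_def by auto

lemma is_small_countable: "countable A \<Longrightarrow> is_small U A"
proof -
  assume A: "countable A"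
  obtain I where I: "I \<in> U" "infinite I" using infinite_small by blast
  have "A \<lesssim> (UNIV :: nat set)" using A by (auto simp: countable_def lepoll_def)
  moreover have "(UNIV :: nat set) \<lesssim> I" using I(2) infinite_le_lepoll by blast
  ultimately show ?thesis by (rule is_small_lepoll[OF small_set[OF I(1)] lepoll_trans])
qed

text \<open>The base and all fibres embed into one infinite small set \<open>K\<close>, the union of
  \<open>I\<close>, of the representatives of the fibres and of an infinite member of
  \<open>U\<close>; cardinal arithmetic then bounds \<open>Sigma A F\<close> by \<open>K\<close>.
  Small unions are the only means that the locale offers for building larger small sets.\<close>

lemma is_small_Sigma:
  assumes A: "is_small U A" and F: "\<And>a. a \<in> A \<Longrightarrow> is_small U (F a)"
  shows "is_small U (Sigma A F)"
proof -
  obtain I0 where I0: "I0 \<in> U" "infinite I0" using infinite_small by blast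
  obtain I where I: "I \<in> U" "A \<approx> I" using A by (auto simp: is_small_def)
  have "\<forall>a\<in>A. \<exists>J\<in>U. F a \<approx> J" using F by (auto simp: is_small_def)
  then obtain J where J: "\<And>a. a \<in> A \<Longrightarrow> J a \<in> U" "\<And>a. a \<in> A \<Longrightarrow> F a \<approx> J a" by metis
  obtain h where h: "bij_betw h I A" using I(2) eqpoll_def eqpoll_sym by metis
  have hA: "i \<in> I \<Longrightarrow> h i \<in> A" for i using h by (auto simp: bij_betw_def)
  define K1 where "K1 = (\<Union>i\<in>I. J (h i))"
  have K1: "K1 \<in> U" unfolding K1_def using I(1) J(1) hA by (intro UN_small) auto
  have un: "B \<union> C \<in> U" if "B \<in> U" "C \<in> U" for B C
  proof -
    \<comment> \<open>Two points of the infinite set form a two-element index set, so that a binary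
      union is a small union.\<close>
    obtain x y where xy: "x \<in> I0" "y \<in> I0" "x \<noteq> y"
      using I0(2) by (metis finite.simps insertCI insert_absorb2 finite_subset subsetI singleton_iff)
    have "{x, y} \<in> U"
      by (rule lepoll_small[OF I0(1)]) (use xy in \<open>auto intro: subset_imp_lepoll\<close>)
    then have "(\<Union>i\<in>{x,y}. if i = x then B else C) \<in> U" using that by (intro UN_small) auto
    then show ?thesis using xy by (auto simp: Un_commute)
  qed
  define K where "K = K1 \<union> I \<union> I0"
  have K: "K \<in> U" unfolding K_def using un K1 I(1) I0(1) by auto
  have inf: "\<not> finite K" using I0 K_def by auto
  have lp: "B \<lesssim> K \<Longrightarrow> ordLeq3 (card_of B) (card_of K)" for B :: "'x set"
    by (simp add: lepoll_def card_of_ordLeq)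
  have "A \<lesssim> K"
    using I(2) K_def by (metis le_supI1 lepoll_trans1 subset_imp_lepoll sup_ge2)
  moreover have "F a \<lesssim> K" if "a \<in> A" for a
  proof -
    obtain i where "i \<in> I" "h i = a" using h \<open>a \<in> A\<close> by (auto simp: bij_betw_def)
    then have "J a \<subseteq> K" by (auto simp: K_def K1_def)
    then show ?thesis using J(2)[OF that] lepoll_trans1 subset_imp_lepoll by blast
  qed
  ultimately have "ordLeq3 (card_of (Sigma A F)) (card_of K)"
    by (intro card_of_Sigma_ordLeq_infinite inf ballI)
      (simp_all add: lepoll_def card_of_ordLeq)
  then have "Sigma A F \<lesssim> K" by (simp add: lepoll_def card_of_ordLeq)
  then show ?thesis using K small_set is_small_lepoll by blast
qed

lemma is_small_UN:
  assumes "is_small U A" "\<And>a. a \<in> A \<Longrightarrow> is_small U (F a)"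
  shows "is_small U (\<Union>a\<in>A. F a)"
  by (rule is_small_surj[OF is_small_Sigma[OF assms], where f = snd]) force+

end


section \<open>Typed morphisms\<close>

text \<open>Since the Hom sets may overlap, a morphism is packed with its domain and codomain; then
  composability is an equation, which the simplifier can decide.\<close>

datatype ('o, 'm) arrow = Arrow (src: 'o) (mor: 'm) (tgt: 'o)

context category
begin

definition arr :: "('a, 'b) arrow \<Rightarrow> bool" where
  "arr f \<longleftrightarrow> src f \<in> Ob T \<and> tgt f \<in> Ob T \<and> mor f \<in> Hom T (src f) (tgt f)"

definition Ar :: "'a \<Rightarrow> 'a \<Rightarrow> ('a, 'b) arrow set" where
  "Ar X Y = {f. arr f \<and> src f = X \<and> tgt f = Y}"

definition comp :: "('a, 'b) arrow \<Rightarrow> ('a, 'b) arrow \<Rightarrow> ('a, 'b) arrow" (infixr "\<bullet>" 70) where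
  "g \<bullet> f = Arrow (src f) (mor g \<cdot> mor f) (tgt g)"

definition ide :: "'a \<Rightarrow> ('a, 'b) arrow" where
  "ide X = Arrow X (Idm T X) X"

lemma in_Ar [simp]: "f \<in> Ar X Y \<longleftrightarrow> arr f \<and> src f = X \<and> tgt f = Y"
  by (auto simp: Ar_def)

lemma Ar_ob: "f \<in> Ar X Y \<Longrightarrow> X \<in> Ob T \<and> Y \<in> Ob T"
  by (auto simp: arr_def)

lemma arr_ob [simp]: "arr f \<Longrightarrow> src f \<in> Ob T" "arr f \<Longrightarrow> tgt f \<in> Ob T"
  by (auto simp: arr_def)

lemma arr_hom: "arr f \<Longrightarrow> mor f \<in> Hom T (src f) (tgt f)"
  by (simp add: arr_def del: arr_ob)

lemma arr_Arrow [simp]: "arr (Arrow X f Y) \<longleftrightarrow> X \<in> Ob T \<and> Y \<in> Ob T \<and> f \<in> Hom T X Y"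
  by (simp add: arr_def del: arr_ob)

lemma comp_simps [simp]: "src (g \<bullet> f) = src f" "tgt (g \<bullet> f) = tgt g" "mor (g \<bullet> f) = mor g \<cdot> mor f"
  by (simp_all add: comp_def)

lemma ide_simps [simp]: "src (ide X) = X" "tgt (ide X) = X" "mor (ide X) = Idm T X"
  "X \<in> Ob T \<Longrightarrow> arr (ide X)"
  by (simp_all add: ide_def Idm_in)

lemma arr_comp [simp]: "arr f \<Longrightarrow> arr g \<Longrightarrow> src g = tgt f \<Longrightarrow> arr (g \<bullet> f)"
  using Cmp_in[of "src f" "tgt f" "tgt g" "mor f" "mor g"] by (simp add: arr_def comp_def del: arr_ob)

lemma arrow_eqI: "src f = src g \<Longrightarrow> tgt f = tgt g \<Longrightarrow> mor f = mor g \<Longrightarrow> f = g"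
  by (simp add: arrow.expand)

lemma comp_ide [simp]: "arr f \<Longrightarrow> tgt f = Y \<Longrightarrow> ide Y \<bullet> f = f" "arr f \<Longrightarrow> src f = X \<Longrightarrow> f \<bullet> ide X = f"
  by (auto simp: arr_def comp_def ide_def Idm_left Idm_right simp del: arr_ob intro!: arrow_eqI)

lemma comp_assoc [simp]: "arr f \<Longrightarrow> arr g \<Longrightarrow> arr h \<Longrightarrow> src g = tgt f \<Longrightarrow> src h = tgt g
    \<Longrightarrow> (h \<bullet> g) \<bullet> f = h \<bullet> (g \<bullet> f)"
  unfolding arr_def comp_def
  using Cmp_assoc[of "src f" "tgt f" "tgt g" "tgt h" "mor f" "mor g" "mor h"] by simp

text \<open>Simplification nests composites to the right, which hides \<open>g \<bullet> f\<close>
  inside \<open>g \<bullet> (f \<bullet> u)\<close>. This lemma and the next apply an equation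
  between composites at such a place.\<close>

lemma comp_reduce: "g \<bullet> f = k \<Longrightarrow> arr f \<Longrightarrow> arr g \<Longrightarrow> arr u \<Longrightarrow> src f = tgt u \<Longrightarrow> src g = tgt f
    \<Longrightarrow> g \<bullet> (f \<bullet> u) = k \<bullet> u"
  using comp_assoc by metis

lemma comp_swap: "g \<bullet> f = k \<bullet> l \<Longrightarrow> arr f \<Longrightarrow> arr g \<Longrightarrow> arr u \<Longrightarrow> src f = tgt u \<Longrightarrow> src g = tgt f
    \<Longrightarrow> arr k \<Longrightarrow> arr l \<Longrightarrow> src k = tgt l \<Longrightarrow> g \<bullet> (f \<bullet> u) = k \<bullet> (l \<bullet> u)"
  using comp_assoc by (metis comp_simps(1))

definition iso_arr :: "('a, 'b) arrow \<Rightarrow> bool" where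
  "iso_arr f \<longleftrightarrow> arr f \<and> (\<exists>g\<in>Ar (tgt f) (src f). g \<bullet> f = ide (src f) \<and> f \<bullet> g = ide (tgt f))"

lemma is_iso_iff: "X \<in> Ob T \<Longrightarrow> Y \<in> Ob T \<Longrightarrow> is_iso T X Y f \<longleftrightarrow> iso_arr (Arrow X f Y)"
proof
  assume "X \<in> Ob T" "Y \<in> Ob T" "is_iso T X Y f"
  then obtain g where "f \<in> Hom T X Y" "g \<in> Hom T Y X" "g \<cdot> f = Idm T X" "f \<cdot> g = Idm T Y"
    by (auto simp: is_iso_def)
  then show "iso_arr (Arrow X f Y)" using \<open>X \<in> Ob T\<close> \<open>Y \<in> Ob T\<close>
    by (auto simp: iso_arr_def comp_def ide_def intro!: bexI[of _ "Arrow Y g X"])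
next
  assume "X \<in> Ob T" "Y \<in> Ob T" "iso_arr (Arrow X f Y)"
  then obtain g where g: "f \<in> Hom T X Y" "arr g" "src g = Y" "tgt g = X"
    "g \<bullet> Arrow X f Y = ide X" "Arrow X f Y \<bullet> g = ide Y"
    by (auto simp: iso_arr_def)
  then have "mor g \<in> Hom T Y X" "mor g \<cdot> f = Idm T X" "f \<cdot> mor g = Idm T Y"
    by (auto simp: comp_def ide_def arr_def simp del: arr_ob)
  then show "is_iso T X Y f" using g(1) by (auto simp: is_iso_def)
qed

lemma iso_arr_ide: "X \<in> Ob T \<Longrightarrow> iso_arr (ide X)"
  by (auto simp: iso_arr_def intro!: bexI[of _ "ide X"])

lemma iso_arr_inverse:
  assumes "iso_arr f"
  obtains g where "g \<in> Ar (tgt f) (src f)" "g \<bullet> f = ide (src f)" "f \<bullet> g = ide (tgt f)" "iso_arr g"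
proof -
  obtain g where "g \<in> Ar (tgt f) (src f)" "g \<bullet> f = ide (src f)" "f \<bullet> g = ide (tgt f)"
    using assms iso_arr_def by blast
  moreover from this have "iso_arr g" using assms by (auto simp: iso_arr_def)
  ultimately show ?thesis using that by blast
qed

lemma is_retract_iff: "X \<in> Ob T \<Longrightarrow> Y \<in> Ob T \<Longrightarrow>
  is_retract T X Y \<longleftrightarrow> (\<exists>s\<in>Ar X Y. \<exists>r\<in>Ar Y X. r \<bullet> s = ide X)"
proof
  assume "X \<in> Ob T" "Y \<in> Ob T" "is_retract T X Y"
  then obtain s r where "s \<in> Hom T X Y" "r \<in> Hom T Y X" "r \<cdot> s = Idm T X"
    by (auto simp: is_retract_def)
  then show "\<exists>s\<in>Ar X Y. \<exists>r\<in>Ar Y X. r \<bullet> s = ide X" using \<open>X \<in> Ob T\<close> \<open>Y \<in> Ob T\<close>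
    by (intro bexI[of _ "Arrow X s Y"] bexI[of _ "Arrow Y r X"]) (auto simp: comp_def ide_def)
next
  assume "\<exists>s\<in>Ar X Y. \<exists>r\<in>Ar Y X. r \<bullet> s = ide X"
  then obtain s r where sr: "s \<in> Ar X Y" "r \<in> Ar Y X" "r \<bullet> s = ide X" by blast
  then have "mor s \<in> Hom T X Y" "mor r \<in> Hom T Y X" by (auto simp: arr_def simp del: arr_ob)
  moreover have "mor r \<cdot> mor s = Idm T X" using sr(3) by (metis comp_simps(3) ide_simps(3))
  ultimately show "is_retract T X Y" by (auto simp: is_retract_def)
qed

lemma retract_closed_iff: "D \<subseteq> Ob T \<Longrightarrow> retract_closed T D \<longleftrightarrow>
  (\<forall>X s r. s \<in> Ar X (tgt s) \<longrightarrow> r \<in> Ar (tgt s) X \<longrightarrow> r \<bullet> s = ide X \<longrightarrow> tgt s \<in> D \<longrightarrow> X \<in> D)"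
  unfolding retract_closed_def
  apply (intro iffI allI impI ballI)
  subgoal by (metis Ar_ob is_retract_iff)
  subgoal for Y X by (subst (asm) is_retract_iff) auto
  done

lemma strictD:
  assumes "strict T D" "D \<subseteq> Ob T" "iso_arr f" shows "src f \<in> D \<longleftrightarrow> tgt f \<in> D"
proof -
  have *: "tgt f \<in> D \<Longrightarrow> src f \<in> D" if "iso_arr f" for f
  proof -
    have "is_iso T (src f) (tgt f) (mor f)" "src f \<in> Ob T"
      using that is_iso_iff[of "src f" "tgt f" "mor f"] by (auto simp: iso_arr_def)
    then show "tgt f \<in> D \<Longrightarrow> src f \<in> D" using assms(1) by (metis strict_def)
  qed
  obtain g where "iso_arr g" "src g = tgt f" "tgt g = src f"
    by (rule iso_arr_inverse[OF assms(3)]) auto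
  then show ?thesis using *[of f] *[of g] assms(3) by auto
qed


section \<open>Products\<close>

definition prod_cone :: "'j set \<Rightarrow> ('j \<Rightarrow> 'a) \<Rightarrow> 'a \<Rightarrow> ('j \<Rightarrow> ('a, 'b) arrow) \<Rightarrow> bool" where
  "prod_cone I X P p \<longleftrightarrow> P \<in> Ob T \<and> (\<forall>i\<in>I. p i \<in> Ar P (X i)) \<and>
     (\<forall>S\<in>Ob T. \<forall>f. (\<forall>i\<in>I. f i \<in> Ar S (X i)) \<longrightarrow> (\<exists>!u. u \<in> Ar S P \<and> (\<forall>i\<in>I. p i \<bullet> u = f i)))"

lemma is_product_imp:
  assumes "is_product T I X P p"
  shows "prod_cone I X P (\<lambda>i. Arrow P (p i) (X i))"
  unfolding prod_cone_def
proof (intro conjI ballI allI impI)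
  show "P \<in> Ob T" using assms by (simp add: is_product_def)
  show "Arrow P (p i) (X i) \<in> Ar P (X i)" if "i \<in> I" for i
    using assms that by (simp add: is_product_def)
  fix S f assume S: "S \<in> Ob T" and f: "\<forall>i\<in>I. f i \<in> Ar S (X i)"
  have "\<forall>i\<in>I. mor (f i) \<in> Hom T S (X i)" using f by (auto simp: arr_def simp del: arr_ob)
  moreover have "\<forall>S\<in>Ob T. \<forall>f. (\<forall>i\<in>I. f i \<in> Hom T S (X i)) \<longrightarrow>
      (\<exists>!u. u \<in> Hom T S P \<and> (\<forall>i\<in>I. p i \<cdot> u = f i))"
    using assms unfolding is_product_def by (elim conjE)
  ultimately have "\<exists>!u. u \<in> Hom T S P \<and> (\<forall>i\<in>I. p i \<cdot> u = mor (f i))"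
    using S by (elim ballE[of _ _ S] allE[of _ "\<lambda>i. mor (f i)"]) auto
  then obtain u where u: "u \<in> Hom T S P" "\<forall>i\<in>I. p i \<cdot> u = mor (f i)"
     and uniq: "\<And>v. v \<in> Hom T S P \<Longrightarrow> \<forall>i\<in>I. p i \<cdot> v = mor (f i) \<Longrightarrow> v = u"
    unfolding Ex1_def by blast
  show "\<exists>!u. u \<in> Ar S P \<and> (\<forall>i\<in>I. Arrow P (p i) (X i) \<bullet> u = f i)"
  proof (rule ex1I[of _ "Arrow S u P"])
    show "Arrow S u P \<in> Ar S P \<and> (\<forall>i\<in>I. Arrow P (p i) (X i) \<bullet> Arrow S u P = f i)"
    proof (intro conjI ballI)
      show "Arrow S u P \<in> Ar S P" using u S \<open>P \<in> Ob T\<close> by simp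
      show "Arrow P (p i) (X i) \<bullet> Arrow S u P = f i" if "i \<in> I" for i
        using u f that by (intro arrow_eqI) simp_all
    qed
    fix v assume v: "v \<in> Ar S P \<and> (\<forall>i\<in>I. Arrow P (p i) (X i) \<bullet> v = f i)"
    have "mor v = u"
    proof (rule uniq)
      show "mor v \<in> Hom T S P" using v arr_hom by auto
      show "\<forall>i\<in>I. p i \<cdot> mor v = mor (f i)" using v comp_simps(3) by (metis arrow.sel(2))
    qed
    then show "v = Arrow S u P" using v by (intro arrow_eqI) simp_all
  qed
qed

lemma prod_ex1:
  assumes "prod_cone I X P p" "S \<in> Ob T" "\<forall>i\<in>I. f i \<in> Ar S (X i)"
  shows "\<exists>!u. u \<in> Ar S P \<and> (\<forall>i\<in>I. p i \<bullet> u = f i)"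
proof -
  have "\<forall>S\<in>Ob T. \<forall>f. (\<forall>i\<in>I. f i \<in> Ar S (X i)) \<longrightarrow> (\<exists>!u. u \<in> Ar S P \<and> (\<forall>i\<in>I. p i \<bullet> u = f i))"
    using assms(1) unfolding prod_cone_def by (elim conjE)
  then show ?thesis using assms(2,3) by (elim ballE[of _ _ S] allE[of _ f]) auto
qed

lemma is_product_of_prod_cone:
  assumes "prod_cone I X P p"
  shows "is_product T I X P (\<lambda>i. mor (p i))"
  unfolding is_product_def
proof (intro conjI ballI allI impI)
  show "P \<in> Ob T" using assms by (simp add: prod_cone_def)
  have p: "p i \<in> Ar P (X i)" if "i \<in> I" for i using assms that by (simp add: prod_cone_def)
  then show "X i \<in> Ob T" "mor (p i) \<in> Hom T P (X i)" if "i \<in> I" for i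
    using p[OF that] Ar_ob[OF p[OF that]] arr_hom[of "p i"] by simp_all
  fix S f assume S: "S \<in> Ob T" and f: "\<forall>i\<in>I. f i \<in> Hom T S (X i)"
  have "\<forall>i\<in>I. Arrow S (f i) (X i) \<in> Ar S (X i)" using f p S Ar_ob[OF p] by auto
  then have "\<exists>!u. u \<in> Ar S P \<and> (\<forall>i\<in>I. p i \<bullet> u = Arrow S (f i) (X i))"
    by (rule prod_ex1[OF assms S])
  then obtain u where u: "u \<in> Ar S P" "\<forall>i\<in>I. p i \<bullet> u = Arrow S (f i) (X i)"
     and uniq: "\<And>v. v \<in> Ar S P \<Longrightarrow> \<forall>i\<in>I. p i \<bullet> v = Arrow S (f i) (X i) \<Longrightarrow> v = u"
    unfolding Ex1_def by blast
  show "\<exists>!u. u \<in> Hom T S P \<and> (\<forall>i\<in>I. mor (p i) \<cdot> u = f i)"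
  proof (rule ex1I[of _ "mor u"])
    show "mor u \<in> Hom T S P \<and> (\<forall>i\<in>I. mor (p i) \<cdot> mor u = f i)"
    proof (intro conjI ballI)
      show "mor u \<in> Hom T S P" using u arr_hom by auto
      show "mor (p i) \<cdot> mor u = f i" if "i \<in> I" for i
        using u(2) that comp_simps(3) by (metis arrow.sel(2))
    qed
    fix v assume v: "v \<in> Hom T S P \<and> (\<forall>i\<in>I. mor (p i) \<cdot> v = f i)"
    have "Arrow S v P = u"
    proof (rule uniq)
      show "Arrow S v P \<in> Ar S P" using v S \<open>P \<in> Ob T\<close> by simp
      show "\<forall>i\<in>I. p i \<bullet> Arrow S v P = Arrow S (f i) (X i)"
        using v p by (auto simp: comp_def)
    qed
    then show "v = mor u" by auto
  qed
qed

lemma prod_ob: "prod_cone I X P p \<Longrightarrow> P \<in> Ob T" "prod_cone I X P p \<Longrightarrow> i \<in> I \<Longrightarrow> X i \<in> Ob T"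
  by (auto simp: prod_cone_def arr_def simp del: arr_ob)

lemma prod_proj: "prod_cone I X P p \<Longrightarrow> i \<in> I \<Longrightarrow> arr (p i)" "prod_cone I X P p \<Longrightarrow> i \<in> I \<Longrightarrow> src (p i) = P"
  "prod_cone I X P p \<Longrightarrow> i \<in> I \<Longrightarrow> tgt (p i) = X i"
  by (auto simp: prod_cone_def)

lemma prod_ex:
  assumes "prod_cone I X P p" "S \<in> Ob T" "\<And>i. i \<in> I \<Longrightarrow> f i \<in> Ar S (X i)"
  obtains u where "u \<in> Ar S P" "\<forall>i\<in>I. p i \<bullet> u = f i"
proof -
  have "\<forall>i\<in>I. f i \<in> Ar S (X i)" using assms(3) by blast
  from prod_ex1[OF assms(1,2) this] show ?thesis using that by blast
qed

lemma prod_eq: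
  assumes "prod_cone I X P p" "u \<in> Ar S P" "v \<in> Ar S P" "\<And>i. i \<in> I \<Longrightarrow> p i \<bullet> u = p i \<bullet> v"
  shows "u = v"
proof -
  have "S \<in> Ob T" "\<forall>i\<in>I. p i \<bullet> v \<in> Ar S (X i)" using assms by (auto simp: prod_cone_def)
  then have "\<exists>!w. w \<in> Ar S P \<and> (\<forall>i\<in>I. p i \<bullet> w = p i \<bullet> v)"
    by (rule prod_ex1[OF assms(1)])
  then show ?thesis using assms(2-4) by blast
qed

lemma prod_coneI:
  assumes "P \<in> Ob T" "\<And>i. i \<in> I \<Longrightarrow> p i \<in> Ar P (X i)"
    and "\<And>S f. S \<in> Ob T \<Longrightarrow> (\<And>i. i \<in> I \<Longrightarrow> f i \<in> Ar S (X i)) \<Longrightarrow> \<exists>u\<in>Ar S P. \<forall>i\<in>I. p i \<bullet> u = f i"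
    and "\<And>S u v. u \<in> Ar S P \<Longrightarrow> v \<in> Ar S P \<Longrightarrow> (\<And>i. i \<in> I \<Longrightarrow> p i \<bullet> u = p i \<bullet> v) \<Longrightarrow> u = v"
  shows "prod_cone I X P p"
  unfolding prod_cone_def
proof (intro conjI ballI allI impI)
  fix S f assume S: "S \<in> Ob T" and f: "\<forall>i\<in>I. f i \<in> Ar S (X i)"
  then obtain u where "u \<in> Ar S P" "\<forall>i\<in>I. p i \<bullet> u = f i" using assms(3)[of S f] by blast
  then show "\<exists>!u. u \<in> Ar S P \<and> (\<forall>i\<in>I. p i \<bullet> u = f i)"
  proof (intro ex1I[of _ u] conjI)
    show "v = u" if "v \<in> Ar S P \<and> (\<forall>i\<in>I. p i \<bullet> v = f i)" for v
      by (rule assms(4)[of _ S]) (use that \<open>u \<in> Ar S P\<close> \<open>\<forall>i\<in>I. p i \<bullet> u = f i\<close> in auto)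
  qed
qed (rule assms(1), rule assms(2))

lemma prod_reindex:
  assumes h: "bij_betw h J I" and P: "prod_cone I X P p"
  shows "prod_cone J (\<lambda>j. X (h j)) P (\<lambda>j. p (h j))"
proof (rule prod_coneI)
  have hI: "j \<in> J \<Longrightarrow> h j \<in> I" for j using h by (auto simp: bij_betw_def)
  show "P \<in> Ob T" using P prod_ob by blast
  show "j \<in> J \<Longrightarrow> p (h j) \<in> Ar P (X (h j))" for j using prod_proj[OF P hI] by simp
  define k where "k = inv_into J h"
  have k: "i \<in> I \<Longrightarrow> k i \<in> J \<and> h (k i) = i" "j \<in> J \<Longrightarrow> k (h j) = j" for i j
    using h by (auto simp: k_def bij_betw_def inv_into_into f_inv_into_f)
  show "\<exists>u\<in>Ar S P. \<forall>j\<in>J. p (h j) \<bullet> u = f j"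
    if "S \<in> Ob T" and f: "\<And>j. j \<in> J \<Longrightarrow> f j \<in> Ar S (X (h j))" for S f
  proof -
    have "f (k i) \<in> Ar S (X i)" if "i \<in> I" for i using f[of "k i"] k(1)[OF that] by simp
    then obtain u where "u \<in> Ar S P" "\<forall>i\<in>I. p i \<bullet> u = f (k i)"
      by (rule prod_ex[OF P \<open>S \<in> Ob T\<close>])
    then show ?thesis using hI k(2) by (intro bexI[of _ u]) auto
  qed
  show "u = v" if "u \<in> Ar S P" "v \<in> Ar S P" "\<And>j. j \<in> J \<Longrightarrow> p (h j) \<bullet> u = p (h j) \<bullet> v" for S u v
    using prod_eq[OF P that(1,2)] that(3) k(1) by metis
qed

lemma prod_cong:
  assumes "prod_cone I X P p" "\<And>i. i \<in> I \<Longrightarrow> X i = Y i" "\<And>i. i \<in> I \<Longrightarrow> p i = q i"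
  shows "prod_cone I Y P q"
  using assms by (fastforce simp: prod_cone_def)

lemma prod_iso:
  assumes P: "prod_cone I X P p" and f: "iso_arr f" "tgt f = P"
  shows "prod_cone I X (src f) (\<lambda>i. p i \<bullet> f)"
proof (rule prod_coneI)
  obtain g where g: "g \<in> Ar (tgt f) (src f)" "g \<bullet> f = ide (src f)" "f \<bullet> g = ide (tgt f)"
    by (rule iso_arr_inverse[OF f(1)])
  have fA: "arr f" using f by (simp add: iso_arr_def)
  note pp = prod_proj[OF P]
  show "src f \<in> Ob T" using fA by simp
  show "i \<in> I \<Longrightarrow> p i \<bullet> f \<in> Ar (src f) (X i)" for i using pp fA f by simp
  show "\<exists>u\<in>Ar S (src f). \<forall>i\<in>I. (p i \<bullet> f) \<bullet> u = k i"
    if "S \<in> Ob T" and k: "\<And>i. i \<in> I \<Longrightarrow> k i \<in> Ar S (X i)" for S k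
  proof -
    obtain u where u: "u \<in> Ar S P" "\<forall>i\<in>I. p i \<bullet> u = k i"
      by (rule prod_ex[OF P \<open>S \<in> Ob T\<close> k])
    have "f \<bullet> (g \<bullet> u) = u" using comp_reduce[OF g(3)] g(1) u f fA by simp
    then show ?thesis using u g fA f pp by (intro bexI[of _ "g \<bullet> u"]) auto
  qed
  show "u = v" if u: "u \<in> Ar S (src f)" "v \<in> Ar S (src f)"
    and e: "\<And>i. i \<in> I \<Longrightarrow> (p i \<bullet> f) \<bullet> u = (p i \<bullet> f) \<bullet> v" for S u v
  proof -
    have "f \<bullet> u = f \<bullet> v"
    proof (rule prod_eq[OF P])
      show "f \<bullet> u \<in> Ar S P" "f \<bullet> v \<in> Ar S P" using u fA f by simp_all
      show "p i \<bullet> (f \<bullet> u) = p i \<bullet> (f \<bullet> v)" if "i \<in> I" for i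
        using e[OF that] pp[OF that] u fA f by simp
    qed
    then have "g \<bullet> (f \<bullet> u) = g \<bullet> (f \<bullet> v)" by simp
    then show ?thesis using comp_reduce[OF g(2)] g(1) u fA by simp
  qed
qed

lemma prod_unique:
  assumes P: "prod_cone I X P p" and Q: "prod_cone I X Q q"
  obtains f where "iso_arr f" "src f = P" "tgt f = Q" "\<And>i. i \<in> I \<Longrightarrow> q i \<bullet> f = p i"
proof -
  note Po = prod_ob(1)[OF P] and Qo = prod_ob(1)[OF Q]
  have pp: "p i \<in> Ar P (X i)" and qq: "q i \<in> Ar Q (X i)" if "i \<in> I" for i
    using prod_proj[OF P that] prod_proj[OF Q that] by simp_all
  obtain f where f: "f \<in> Ar P Q" "\<forall>i\<in>I. q i \<bullet> f = p i" by (rule prod_ex[OF Q Po pp])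
  obtain g where g: "g \<in> Ar Q P" "\<forall>i\<in>I. p i \<bullet> g = q i" by (rule prod_ex[OF P Qo qq])
  have "g \<bullet> f = ide P"
  proof (rule prod_eq[OF P])
    show "p i \<bullet> (g \<bullet> f) = p i \<bullet> ide P" if "i \<in> I" for i
      using comp_reduce[of "p i" g "q i" f] f g pp[OF that] that by simp
  qed (use f g Po in auto)
  moreover have "f \<bullet> g = ide Q"
  proof (rule prod_eq[OF Q])
    show "q i \<bullet> (f \<bullet> g) = q i \<bullet> ide Q" if "i \<in> I" for i
      using comp_reduce[of "q i" f "p i" g] f g qq[OF that] that by simp
  qed (use f g Qo in auto)
  ultimately have "iso_arr f" using f g by (auto simp: iso_arr_def)
  then show ?thesis using that f by auto
qed

lemma prod_singleton: "iso_arr f \<Longrightarrow> prod_cone {i} (\<lambda>_. tgt f) (src f) (\<lambda>_. f)"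
proof -
  assume f: "iso_arr f"
  have "prod_cone {i} (\<lambda>_. tgt f) (tgt f) (\<lambda>_. ide (tgt f))"
    by (rule prod_coneI) (use f in \<open>auto simp: iso_arr_def\<close>)
  from prod_iso[OF this f] f show ?thesis by (simp add: iso_arr_def)
qed

end

locale category_small = category T + smallness U
  for T :: "('o, 'm, 'z) cat_scheme" (structure) and U :: "'i set set"
begin

text \<open>\<open>has_products\<close> speaks of members of \<open>U\<close> only; products over
  sets of other types, such as \<open>nat\<close> or a set of pairs, are transported along a
  bijection onto a member.\<close>

lemma ex_prod:
  assumes "has_products U T" "is_small U J" "\<And>j. j \<in> J \<Longrightarrow> X j \<in> Ob T"
  obtains P p where "prod_cone J X P p"
proof -
  obtain I where "I \<in> U" "J \<approx> I" using assms(2) by (auto simp: is_small_def)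
  then obtain h where h: "bij_betw h J I" using eqpoll_def by blast
  define k where "k = inv_into J h"
  have k: "bij_betw k I J" using h bij_betw_inv_into k_def by blast
  have "(\<lambda>i. X (k i)) ` I \<subseteq> Ob T" using assms(3) k by (auto simp: bij_betw_def)
  then obtain P p where "is_product T I (\<lambda>i. X (k i)) P p"
    using assms(1) \<open>I \<in> U\<close> unfolding has_products_def by blast
  from prod_reindex[OF h is_product_imp[OF this]]
  have "prod_cone J (\<lambda>j. X (k (h j))) P (\<lambda>j. Arrow P (p (h j)) (X (k (h j))))" .
  moreover have "k (h j) = j" if "j \<in> J" for j using that h by (simp add: k_def bij_betw_def)
  ultimately have "prod_cone J X P (\<lambda>j. Arrow P (p (h j)) (X (k (h j))))"
    by (elim prod_cong) auto
  then show ?thesis using that by blast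
qed

lemma closed_prod:
  assumes "closed_under_products U T D" "is_small U J" "\<And>j. j \<in> J \<Longrightarrow> X j \<in> D" "prod_cone J X P p"
  shows "P \<in> D"
proof -
  obtain I where I: "I \<in> U" "J \<approx> I" using assms(2) by (auto simp: is_small_def)
  then obtain k where k: "bij_betw k I J" using eqpoll_def eqpoll_sym by blast
  have "is_product T I (\<lambda>i. X (k i)) P (\<lambda>i. mor (p (k i)))"
    using is_product_of_prod_cone[OF prod_reindex[OF k assms(4)]] .
  moreover have "(\<lambda>i. X (k i)) ` I \<subseteq> D" using assms(3) k by (auto simp: bij_betw_def)
  ultimately show ?thesis using assms(1) I(1) unfolding closed_under_products_def by blast
qed

lemma closed_under_productsI:
  assumes "\<And>I X P p. I \<in> U \<Longrightarrow> (\<And>i. i \<in> I \<Longrightarrow> X i \<in> D) \<Longrightarrow> prod_cone I X P p \<Longrightarrow> P \<in> D"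
  shows "closed_under_products U T D"
  unfolding closed_under_products_def
proof (intro ballI allI impI, elim conjE)
  fix I X P p assume *: "I \<in> U" "X ` I \<subseteq> D" "is_product T I X P p"
  then have "i \<in> I \<Longrightarrow> X i \<in> D" for i by blast
  then show "P \<in> D" by (rule assms[OF *(1) _ is_product_imp[OF *(3)]])
qed

lemma closed_under_products_Int:
  assumes "closed_under_products U T D" "closed_under_products U T E"
  shows "closed_under_products U T (D \<inter> E)"
proof (rule closed_under_productsI)
  fix I X P p assume *: "I \<in> U" "\<And>i. i \<in> I \<Longrightarrow> X i \<in> D \<inter> E" "prod_cone I X P p"
  show "P \<in> D \<inter> E"
    using closed_prod[OF assms(1) small_set[OF *(1)] _ *(3)] closed_prod[OF assms(2) small_set[OF *(1)] _ *(3)] *(2)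
    by simp
qed

text \<open>An isomorphism \<open>X \<rightarrow> Y\<close> exhibits \<open>X\<close> as a product
  of the one-element family \<open>Y\<close>, and closure under products covers every choice of a
  product.\<close>

lemma closed_under_products_strict:
  assumes "closed_under_products U T D" "D \<subseteq> Ob T" shows "strict T D"
  unfolding strict_def
proof (intro ballI impI)
  fix X Y assume "Y \<in> D" "X \<in> Ob T" "\<exists>f. is_iso T X Y f"
  then obtain f where "iso_arr (Arrow X f Y)" using is_iso_iff assms by blast
  from prod_singleton[OF this]
  have "prod_cone {undefined} (\<lambda>_. Y) X (\<lambda>_. Arrow X f Y)" by simp
  then show "X \<in> D" using closed_prod[OF assms(1) is_small_countable] \<open>Y \<in> D\<close>
    by (metis countable_finite finite.emptyI finite_insert)
qed

end


section \<open>Sums of morphisms\<close>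

context additive_category
begin

definition add :: "('a, 'b) arrow \<Rightarrow> ('a, 'b) arrow \<Rightarrow> ('a, 'b) arrow" (infixl "\<boxplus>" 65) where
  "f \<boxplus> g = Arrow (src f) (Add T (mor f) (mor g)) (tgt f)"

definition nul :: "'a \<Rightarrow> 'a \<Rightarrow> ('a, 'b) arrow" where
  "nul X Y = Arrow X (Zero T X Y) Y"

definition opp :: "('a, 'b) arrow \<Rightarrow> ('a, 'b) arrow" where
  "opp f = Arrow (src f) (neg T (src f) (tgt f) (mor f)) (tgt f)"

abbreviation sub :: "('a, 'b) arrow \<Rightarrow> ('a, 'b) arrow \<Rightarrow> ('a, 'b) arrow" (infixl "\<boxminus>" 65) where
  "f \<boxminus> g \<equiv> f \<boxplus> opp g"

lemma add_simps [simp]: "src (f \<boxplus> g) = src f" "tgt (f \<boxplus> g) = tgt f"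
    "mor (f \<boxplus> g) = Add T (mor f) (mor g)"
  and nul_simps [simp]: "src (nul X Y) = X" "tgt (nul X Y) = Y" "mor (nul X Y) = Zero T X Y"
  and opp_simps [simp]: "src (opp f) = src f" "tgt (opp f) = tgt f"
    "mor (opp f) = neg T (src f) (tgt f) (mor f)"
  by (simp_all add: add_def nul_def opp_def)

lemma hom_group_simps: "carrier (Defs.hom_group T X Y) = Hom T X Y"
  "mult (Defs.hom_group T X Y) = Add T" "one (Defs.hom_group T X Y) = Zero T X Y"
  by (simp_all add: hom_group_def)

lemma Hom_group_laws:
  assumes "X \<in> Ob T" "Y \<in> Ob T"
  shows "Zero T X Y \<in> Hom T X Y"
    and "f \<in> Hom T X Y \<Longrightarrow> g \<in> Hom T X Y \<Longrightarrow> Add T f g \<in> Hom T X Y"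
    and "f \<in> Hom T X Y \<Longrightarrow> neg T X Y f \<in> Hom T X Y"
    and "f \<in> Hom T X Y \<Longrightarrow> g \<in> Hom T X Y \<Longrightarrow> h \<in> Hom T X Y \<Longrightarrow> Add T (Add T f g) h = Add T f (Add T g h)"
    and "f \<in> Hom T X Y \<Longrightarrow> g \<in> Hom T X Y \<Longrightarrow> Add T f g = Add T g f"
    and "f \<in> Hom T X Y \<Longrightarrow> Add T (Zero T X Y) f = f"
    and "f \<in> Hom T X Y \<Longrightarrow> Add T f (neg T X Y f) = Zero T X Y"
proof -
  interpret G: comm_group "Defs.hom_group T X Y" using assms by (rule hom_group)
  note s = hom_group_simps[of X Y]
  show "Zero T X Y \<in> Hom T X Y" using G.one_closed unfolding s .
  show "f \<in> Hom T X Y \<Longrightarrow> g \<in> Hom T X Y \<Longrightarrow> Add T f g \<in> Hom T X Y" using G.m_closed unfolding s .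
  show "f \<in> Hom T X Y \<Longrightarrow> neg T X Y f \<in> Hom T X Y" using G.inv_closed unfolding s neg_def .
  show "f \<in> Hom T X Y \<Longrightarrow> g \<in> Hom T X Y \<Longrightarrow> h \<in> Hom T X Y \<Longrightarrow> Add T (Add T f g) h = Add T f (Add T g h)"
    using G.m_assoc unfolding s .
  show "f \<in> Hom T X Y \<Longrightarrow> g \<in> Hom T X Y \<Longrightarrow> Add T f g = Add T g f" using G.m_comm unfolding s .
  show "f \<in> Hom T X Y \<Longrightarrow> Add T (Zero T X Y) f = f" using G.l_one unfolding s .
  show "f \<in> Hom T X Y \<Longrightarrow> Add T f (neg T X Y f) = Zero T X Y" using G.r_inv unfolding s neg_def .
qed

lemma arr_add [simp]: "arr f \<Longrightarrow> arr g \<Longrightarrow> src f = src g \<Longrightarrow> tgt f = tgt g \<Longrightarrow> arr (f \<boxplus> g)"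
  using Hom_group_laws(2)[of "src g" "tgt g" "mor f" "mor g"]
  by (simp add: arr_def add_def del: arr_ob)

lemma arr_nul [simp]: "X \<in> Ob T \<Longrightarrow> Y \<in> Ob T \<Longrightarrow> arr (nul X Y)"
  by (simp add: nul_def Hom_group_laws(1))

lemma arr_opp [simp]: "arr f \<Longrightarrow> arr (opp f)"
  using Hom_group_laws(3)[of "src f" "tgt f" "mor f"] by (simp add: arr_def opp_def del: arr_ob)

lemma add_assoc [simp]: "arr f \<Longrightarrow> arr g \<Longrightarrow> arr h \<Longrightarrow> src f = src g \<Longrightarrow> tgt f = tgt g \<Longrightarrow> src g = src h
    \<Longrightarrow> tgt g = tgt h \<Longrightarrow> f \<boxplus> g \<boxplus> h = f \<boxplus> (g \<boxplus> h)"
  using Hom_group_laws(4)[of "src h" "tgt h" "mor f" "mor g" "mor h"] arr_hom[of f] arr_hom[of g] arr_hom[of h]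
  by (simp add: add_def)

lemma add_commute: "arr f \<Longrightarrow> arr g \<Longrightarrow> src f = src g \<Longrightarrow> tgt f = tgt g \<Longrightarrow> f \<boxplus> g = g \<boxplus> f"
  using Hom_group_laws(5)[of "src g" "tgt g" "mor f" "mor g"] arr_hom[of f] arr_hom[of g]
  by (simp add: add_def)

lemma add_left_commute: "arr f \<Longrightarrow> arr g \<Longrightarrow> arr h \<Longrightarrow> src f = src g \<Longrightarrow> tgt f = tgt g \<Longrightarrow> src g = src h
    \<Longrightarrow> tgt g = tgt h \<Longrightarrow> f \<boxplus> (g \<boxplus> h) = g \<boxplus> (f \<boxplus> h)"
  using add_assoc[of f g h] add_assoc[of g f h] add_commute[of f g] by simp

lemma nul_add [simp]: "arr f \<Longrightarrow> src f = X \<Longrightarrow> tgt f = Y \<Longrightarrow> nul X Y \<boxplus> f = f"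
  using Hom_group_laws(6)[of X Y "mor f"] arr_hom[of f] arr_ob[of f]
  by (intro arrow_eqI) simp_all

lemma add_nul [simp]: "arr f \<Longrightarrow> src f = X \<Longrightarrow> tgt f = Y \<Longrightarrow> f \<boxplus> nul X Y = f"
  using add_commute[of f "nul X Y"] arr_ob[of f] by simp

lemma add_opp [simp]: "arr f \<Longrightarrow> f \<boxplus> opp f = nul (src f) (tgt f)"
  using Hom_group_laws(7)[of "src f" "tgt f" "mor f"] arr_hom[of f]
  by (intro arrow_eqI) simp_all

lemma opp_add [simp]: "arr f \<Longrightarrow> opp f \<boxplus> f = nul (src f) (tgt f)"
  using add_commute[of f "opp f"] by simp

lemma add_opp_cancel [simp]: "arr f \<Longrightarrow> arr g \<Longrightarrow> src f = src g \<Longrightarrow> tgt f = tgt g \<Longrightarrow> f \<boxplus> (opp f \<boxplus> g) = g"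
  "arr f \<Longrightarrow> arr g \<Longrightarrow> src f = src g \<Longrightarrow> tgt f = tgt g \<Longrightarrow> opp f \<boxplus> (f \<boxplus> g) = g"
  using add_assoc[of f "opp f" g] add_assoc[of "opp f" f g] by simp_all

lemma opp_unique: "arr f \<Longrightarrow> arr g \<Longrightarrow> src f = src g \<Longrightarrow> tgt f = tgt g
    \<Longrightarrow> f \<boxplus> g = nul (src g) (tgt g) \<Longrightarrow> g = opp f"
  using add_opp_cancel(2)[of f g] by simp

lemma opp_opp [simp]: "arr f \<Longrightarrow> opp (opp f) = f"
  using opp_unique[of "opp f" f] by simp

lemma opp_inj: "opp f = opp g \<Longrightarrow> arr f \<Longrightarrow> arr g \<Longrightarrow> f = g"
  using opp_opp by metis

lemma opp_nul [simp]: "X \<in> Ob T \<Longrightarrow> Y \<in> Ob T \<Longrightarrow> opp (nul X Y) = nul X Y"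
  using opp_unique[of "nul X Y" "nul X Y"] by simp

lemma opp_add_distrib [simp]: "arr f \<Longrightarrow> arr g \<Longrightarrow> src f = src g \<Longrightarrow> tgt f = tgt g
    \<Longrightarrow> opp (f \<boxplus> g) = opp f \<boxplus> opp g"
  using opp_unique[of "f \<boxplus> g" "opp f \<boxplus> opp g"] add_left_commute[of g "opp f" "opp g"] by simp

lemma add_eq_iff: "arr f \<Longrightarrow> arr g \<Longrightarrow> src f = src g \<Longrightarrow> tgt f = tgt g \<Longrightarrow> f \<boxminus> g = nul (src g) (tgt g) \<longleftrightarrow> f = g"
  using opp_unique[of f "opp g"] opp_opp[of f] opp_opp[of g] by (metis add_opp arr_opp opp_simps(1,2))

lemma comp_add [simp]: "arr f \<Longrightarrow> arr g \<Longrightarrow> arr h \<Longrightarrow> src f = src g \<Longrightarrow> tgt f = tgt g \<Longrightarrow> src h = tgt g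
    \<Longrightarrow> h \<bullet> (f \<boxplus> g) = h \<bullet> f \<boxplus> h \<bullet> g"
  using Cmp_Add_left[of "src g" "tgt g" "tgt h" "mor f" "mor g" "mor h"] arr_hom[of f] arr_hom[of g] arr_hom[of h]
  by (intro arrow_eqI) simp_all

lemma add_comp [simp]: "arr f \<Longrightarrow> arr g \<Longrightarrow> arr h \<Longrightarrow> src f = src g \<Longrightarrow> tgt f = tgt g \<Longrightarrow> src g = tgt h
    \<Longrightarrow> (f \<boxplus> g) \<bullet> h = f \<bullet> h \<boxplus> g \<bullet> h"
  using Cmp_Add_right[of "src h" "tgt h" "tgt g" "mor h" "mor f" "mor g"] arr_hom[of f] arr_hom[of g] arr_hom[of h]
  by (intro arrow_eqI) simp_all

lemma add_self_nul: "arr f \<Longrightarrow> f \<boxplus> f = f \<Longrightarrow> f = nul (src f) (tgt f)"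
  using add_opp_cancel(2)[of f f] by simp

lemma comp_nul [simp]: "arr g \<Longrightarrow> src g = Y \<Longrightarrow> X \<in> Ob T \<Longrightarrow> g \<bullet> nul X Y = nul X (tgt g)"
  using comp_add[of "nul X Y" "nul X Y" g] add_self_nul[of "g \<bullet> nul X Y"] arr_ob[of g] by simp

lemma nul_comp [simp]: "arr g \<Longrightarrow> tgt g = X \<Longrightarrow> Y \<in> Ob T \<Longrightarrow> nul X Y \<bullet> g = nul (src g) Y"
  using add_comp[of "nul X Y" "nul X Y" g] add_self_nul[of "nul X Y \<bullet> g"] arr_ob[of g] by simp

lemma comp_opp [simp]: "arr f \<Longrightarrow> arr g \<Longrightarrow> src g = tgt f \<Longrightarrow> g \<bullet> opp f = opp (g \<bullet> f)"
  using comp_add[of f "opp f" g] opp_unique[of "g \<bullet> f" "g \<bullet> opp f"] by simp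

lemma opp_comp [simp]: "arr f \<Longrightarrow> arr g \<Longrightarrow> src g = tgt f \<Longrightarrow> opp g \<bullet> f = opp (g \<bullet> f)"
  using add_comp[of g "opp g" f] opp_unique[of "g \<bullet> f" "opp g \<bullet> f"] by simp

subsection \<open>Zero objects and vanishing of Hom\<close>

definition noarr :: "'a \<Rightarrow> 'a \<Rightarrow> bool" where
  "noarr X Y \<longleftrightarrow> (\<forall>f\<in>Ar X Y. f = nul X Y)"

lemma noarrD: "noarr X Y \<Longrightarrow> arr f \<Longrightarrow> src f = X \<Longrightarrow> tgt f = Y \<Longrightarrow> f = nul X Y"
  by (simp add: noarr_def)

lemma noarr_iff:
  assumes "X \<in> Ob T" "Y \<in> Ob T" shows "Hom T X Y = {Zero T X Y} \<longleftrightarrow> noarr X Y"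
proof
  assume *: "Hom T X Y = {Zero T X Y}"
  show "noarr X Y" unfolding noarr_def
  proof
    fix f assume "f \<in> Ar X Y"
    then have "mor f \<in> Hom T X Y" using arr_hom[of f] by simp
    with * \<open>f \<in> Ar X Y\<close> show "f = nul X Y" by (intro arrow_eqI) simp_all
  qed
next
  assume *: "noarr X Y"
  have "f = Zero T X Y" if "f \<in> Hom T X Y" for f
    using noarrD[OF *, of "Arrow X f Y"] that assms by (simp add: nul_def)
  then show "Hom T X Y = {Zero T X Y}" using Hom_group_laws(1)[OF assms] by blast
qed

lemma orthogonal_iff: "D \<subseteq> Ob T \<Longrightarrow> E \<subseteq> Ob T \<Longrightarrow> orthogonal T D E \<longleftrightarrow> (\<forall>X\<in>D. \<forall>Y\<in>E. noarr X Y)"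
  unfolding orthogonal_def using noarr_iff by (meson subsetD)

lemma left_orthogonal_iff:
  "E \<subseteq> Ob T \<Longrightarrow> X \<in> left_orthogonal T E \<longleftrightarrow> X \<in> Ob T \<and> (\<forall>Y\<in>E. noarr X Y)"
  using orthogonal_iff[of "{X}" E] by (auto simp: left_orthogonal_def)

lemma left_orthogonal_sub: "left_orthogonal T E \<subseteq> Ob T"
  by (auto simp: left_orthogonal_def)

lemma is_zero_ob: "is_zero T Z \<Longrightarrow> Z \<in> Ob T"
  by (simp add: is_zero_def)

lemma is_zero_noarr: assumes "is_zero T Z" "X \<in> Ob T" shows "noarr X Z" "noarr Z X"
proof -
  have Z: "Z \<in> Ob T" and 1: "\<exists>!f. f \<in> Hom T X Z" and 2: "\<exists>!f. f \<in> Hom T Z X"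
    using assms by (auto simp: is_zero_def)
  have "Hom T X Z = {Zero T X Z}" using 1 Hom_group_laws(1)[OF assms(2) Z] by blast
  then show "noarr X Z" using noarr_iff assms Z by blast
  have "Hom T Z X = {Zero T Z X}" using 2 Hom_group_laws(1)[OF Z assms(2)] by blast
  then show "noarr Z X" using noarr_iff assms Z by blast
qed

text \<open>The identity of \<open>Z\<close> is the zero morphism, and every morphism into or out of
  \<open>Z\<close> is a composite with it.\<close>

lemma noarr_self_zero: assumes "Z \<in> Ob T" "noarr Z Z" shows "is_zero T Z"
  unfolding is_zero_def
proof (intro conjI ballI)
  have e: "ide Z = nul Z Z" using assms noarrD[of Z Z "ide Z"] by simp
  fix X assume X: "X \<in> Ob T"
  have "f = nul X Z" if "f \<in> Ar X Z" for f
    using that comp_ide(1)[of f Z] e nul_comp[of f Z Z] assms(1) by simp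
  then have "Hom T X Z = {Zero T X Z}" using noarr_iff[OF X assms(1)] noarr_def by blast
  then show "\<exists>!f. f \<in> Hom T X Z" by simp
  have "f = nul Z X" if "f \<in> Ar Z X" for f
    using that comp_ide(2)[of f Z] e comp_nul[of f Z Z] assms(1) by simp
  then have "Hom T Z X = {Zero T Z X}" using noarr_iff[OF assms(1) X] noarr_def by blast
  then show "\<exists>!f. f \<in> Hom T Z X" by simp
qed (rule assms)

lemma is_zero_iff: "is_zero T Z \<longleftrightarrow> Z \<in> Ob T \<and> noarr Z Z"
  using is_zero_ob is_zero_noarr noarr_self_zero by blast

text \<open>Yoneda in additive form: if \<open>f\<close> is onto with trivial kernel on all Hom(S,
  -), lift the identity to a right inverse \<open>g\<close>; then \<open>f\<close> kills
  \<open>g \<bullet> f \<boxminus> ide (src f)\<close>. This is the form in which comparisons of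
  cones and homotopy limits can be checked, since these objects come without uniqueness of
  lifts.\<close>

lemma iso_arrI:
  assumes f: "arr f"
    and surj: "\<And>u. arr u \<Longrightarrow> tgt u = tgt f \<Longrightarrow> \<exists>v\<in>Ar (src u) (src f). f \<bullet> v = u"
    and inj: "\<And>v. arr v \<Longrightarrow> tgt v = src f \<Longrightarrow> f \<bullet> v = nul (src v) (tgt f) \<Longrightarrow> v = nul (src v) (src f)"
  shows "iso_arr f"
proof -
  obtain g where g: "g \<in> Ar (tgt f) (src f)" "f \<bullet> g = ide (tgt f)"
    using surj[of "ide (tgt f)"] f by auto
  have "f \<bullet> (g \<bullet> f \<boxminus> ide (src f)) = nul (src f) (tgt f)"
    using g f comp_reduce[OF g(2)] by simp
  then have "g \<bullet> f \<boxminus> ide (src f) = nul (src f) (src f)" using inj[of "g \<bullet> f \<boxminus> ide (src f)"] g f by simp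
  then have "g \<bullet> f = ide (src f)" using add_eq_iff[of "g \<bullet> f" "ide (src f)"] g f by simp
  then show ?thesis using f g by (auto simp: iso_arr_def)
qed

lemma prod_eq_nul:
  assumes "prod_cone I X P p" "u \<in> Ar S P" "\<And>i. i \<in> I \<Longrightarrow> p i \<bullet> u = nul S (X i)"
  shows "u = nul S P"
proof (rule prod_eq[OF assms(1,2)])
  show "nul S P \<in> Ar S P" using Ar_ob[OF assms(2)] by simp
  show "p i \<bullet> u = p i \<bullet> nul S P" if "i \<in> I" for i
    using assms(3)[OF that] prod_proj[OF assms(1) that] Ar_ob[OF assms(2)] by simp
qed

end


section \<open>Shifts and triangles\<close>

context triangulated_category
begin

definition sh :: "int \<Rightarrow> ('a, 'b) arrow \<Rightarrow> ('a, 'b) arrow" where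
  "sh n f = Arrow (ShO T n (src f)) (ShM T n (mor f)) (ShO T n (tgt f))"

lemma sh_simps [simp]: "src (sh n f) = ShO T n (src f)" "tgt (sh n f) = ShO T n (tgt f)"
  "mor (sh n f) = ShM T n (mor f)"
  by (simp_all add: sh_def)

lemmas ShO_simps [simp] = ShO_in ShO_0 ShO_add

lemma arr_sh [simp]: "arr f \<Longrightarrow> arr (sh n f)"
  using ShM_in[of "src f" "tgt f" "mor f" n] arr_hom[of f] by (simp add: sh_def)

lemma sh_0 [simp]: "arr f \<Longrightarrow> sh 0 f = f"
  using ShM_0[of "src f" "tgt f" "mor f"] arr_hom[of f] by (intro arrow_eqI) simp_all

lemma sh_sh [simp]: "arr f \<Longrightarrow> sh i (sh j f) = sh (i + j) f"
  using ShM_add[of "src f" "tgt f" "mor f" i j] arr_hom[of f] by (intro arrow_eqI) simp_all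

lemma sh_ide [simp]: "X \<in> Ob T \<Longrightarrow> sh n (ide X) = ide (ShO T n X)"
  using ShM_Idm[of X n] by (intro arrow_eqI) simp_all

lemma sh_comp [simp]: "arr f \<Longrightarrow> arr g \<Longrightarrow> src g = tgt f \<Longrightarrow> sh n (g \<bullet> f) = sh n g \<bullet> sh n f"
  using ShM_Cmp[of "src f" "tgt f" "tgt g" "mor f" "mor g" n] arr_hom[of f] arr_hom[of g]
  by (intro arrow_eqI) simp_all

lemma sh_add [simp]: "arr f \<Longrightarrow> arr g \<Longrightarrow> src f = src g \<Longrightarrow> tgt f = tgt g \<Longrightarrow> sh n (f \<boxplus> g) = sh n f \<boxplus> sh n g"
  using ShM_Add[of "src g" "tgt g" "mor f" "mor g" n] arr_hom[of f] arr_hom[of g]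
  by (intro arrow_eqI) simp_all

lemma sh_nul [simp]: "X \<in> Ob T \<Longrightarrow> Y \<in> Ob T \<Longrightarrow> sh n (nul X Y) = nul (ShO T n X) (ShO T n Y)"
  using sh_add[of "nul X Y" "nul X Y" n] add_self_nul[of "sh n (nul X Y)"] by simp

lemma sh_opp [simp]: "arr f \<Longrightarrow> sh n (opp f) = opp (sh n f)"
  using sh_add[of f "opp f" n] opp_unique[of "sh n f" "sh n (opp f)"] by simp

lemma sh_inj: "arr f \<Longrightarrow> arr g \<Longrightarrow> sh n f = sh n g \<Longrightarrow> f = g"
  by (metis sh_sh sh_0 add.left_inverse)

lemma sh_eq_nul: "arr f \<Longrightarrow> sh n f = nul (ShO T n (src f)) (ShO T n (tgt f)) \<Longrightarrow> f = nul (src f) (tgt f)"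
  using sh_inj[of f "nul (src f) (tgt f)" n] by simp

lemma noarr_sh [simp]:
  assumes "X \<in> Ob T" "Y \<in> Ob T" shows "noarr (ShO T n X) (ShO T n Y) \<longleftrightarrow> noarr X Y"
proof -
  have *: "noarr X Y" if "noarr (ShO T n X) (ShO T n Y)" "X \<in> Ob T" "Y \<in> Ob T" for X Y n
    unfolding noarr_def
  proof
    fix f assume f: "f \<in> Ar X Y"
    then have "sh n f = nul (ShO T n X) (ShO T n Y)" using noarrD[OF that(1), of "sh n f"] by simp
    then show "f = nul X Y" using sh_eq_nul[of f n] f by simp
  qed
  from *[of n X Y] *[of "-n" "ShO T n X" "ShO T n Y"] assms show ?thesis by auto
qed

lemma noarr_sh': "X \<in> Ob T \<Longrightarrow> Y \<in> Ob T \<Longrightarrow> noarr (ShO T n X) Y \<longleftrightarrow> noarr X (ShO T (- n) Y)"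
  using noarr_sh[of X "ShO T (-n) Y" n] by simp

lemma is_zero_ShO: "is_zero T Z \<Longrightarrow> is_zero T (ShO T n Z)"
  by (simp add: is_zero_iff)

lemma iso_arr_opp: "iso_arr f \<Longrightarrow> iso_arr (opp f)"
proof -
  assume f: "iso_arr f"
  then obtain g where g: "g \<in> Ar (tgt f) (src f)" "g \<bullet> f = ide (src f)" "f \<bullet> g = ide (tgt f)"
    by (auto simp: iso_arr_def)
  then show ?thesis using f by (auto simp: iso_arr_def intro!: bexI[of _ "opp g"])
qed

lemma prod_sh:
  assumes P: "prod_cone I X P p"
  shows "prod_cone I (\<lambda>i. ShO T n (X i)) (ShO T n P) (\<lambda>i. sh n (p i))"
proof (rule prod_coneI)
  note pp = prod_proj[OF P]
  show "ShO T n P \<in> Ob T" using prod_ob(1)[OF P] by simp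
  show "i \<in> I \<Longrightarrow> sh n (p i) \<in> Ar (ShO T n P) (ShO T n (X i))" for i using pp by simp
  show "\<exists>u\<in>Ar S (ShO T n P). \<forall>i\<in>I. sh n (p i) \<bullet> u = f i"
    if S: "S \<in> Ob T" and f: "\<And>i. i \<in> I \<Longrightarrow> f i \<in> Ar S (ShO T n (X i))" for S f
  proof -
    have "sh (-n) (f i) \<in> Ar (ShO T (-n) S) (X i)" if "i \<in> I" for i
      using f[OF that] prod_ob(2)[OF P that] by simp
    then obtain u where u: "u \<in> Ar (ShO T (-n) S) P" "\<forall>i\<in>I. p i \<bullet> u = sh (-n) (f i)"
      by (rule prod_ex[OF P ShO_in[OF S]])
    have "sh n (p i) \<bullet> sh n u = f i" if "i \<in> I" for i
      using u that f[OF that] pp[OF that] sh_comp[of u "p i" n] by simp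
    then show ?thesis using u S by (intro bexI[of _ "sh n u"]) simp_all
  qed
  show "u = v" if u: "u \<in> Ar S (ShO T n P)" "v \<in> Ar S (ShO T n P)"
    and e: "\<And>i. i \<in> I \<Longrightarrow> sh n (p i) \<bullet> u = sh n (p i) \<bullet> v" for S u v
  proof -
    have "sh (-n) u = sh (-n) v"
    proof (rule prod_eq[OF P])
      show "sh (-n) u \<in> Ar (ShO T (-n) S) P" "sh (-n) v \<in> Ar (ShO T (-n) S) P"
        using u prod_ob(1)[OF P] by simp_all
      show "p i \<bullet> sh (-n) u = p i \<bullet> sh (-n) v" if "i \<in> I" for i
        using arg_cong[OF e[OF that], of "sh (-n)"] pp[OF that] u by simp
    qed
    then show ?thesis using sh_inj u by simp
  qed
qed

definition tri :: "('a, 'b) arrow \<Rightarrow> ('a, 'b) arrow \<Rightarrow> ('a, 'b) arrow \<Rightarrow> bool" where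
  "tri f g h \<longleftrightarrow> arr f \<and> arr g \<and> arr h \<and> src g = tgt f \<and> src h = tgt g \<and> tgt h = ShO T 1 (src f) \<and>
     (src f, tgt f, tgt g, mor f, mor g, mor h) \<in> Dist T"

lemma Dist_iff: "(X, Y, Z, f, g, h) \<in> Dist T
    \<longleftrightarrow> tri (Arrow X f Y) (Arrow Y g Z) (Arrow Z h (ShO T 1 X))"
  using Dist_in[of X Y Z f g h] by (auto simp: tri_def)

lemma triD:
  assumes "tri f g h"
  shows "arr f" "arr g" "arr h" "src g = tgt f" "src h = tgt g" "tgt h = ShO T 1 (src f)"
  using assms by (auto simp: tri_def)

lemma tri_rotate:
  assumes "arr f" "arr g" "arr h" "src g = tgt f" "src h = tgt g" "tgt h = ShO T 1 (src f)"
  shows "tri f g h \<longleftrightarrow> tri g h (opp (sh 1 f))"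
  using assms rotate[of "src f" "tgt f" "tgt g" "mor f" "mor g" "mor h"]
    arr_hom[of f] arr_hom[of g] arr_hom[of h]
  by (simp add: tri_def)

lemma tri_rot: "tri f g h \<Longrightarrow> tri g h (opp (sh 1 f))"
  using tri_rotate[of f g h] triD[of f g h] by simp

lemma tri_unrot: assumes "tri f g h" shows "tri (opp (sh (-1) h)) f g"
  by (subst tri_rotate) (use assms triD[OF assms] in simp_all)

lemma ex_tri:
  assumes "arr f" obtains g h where "tri f g h"
proof -
  obtain Z g h where "(src f, tgt f, Z, mor f, g, h) \<in> Dist T"
    using ex_cone[of "src f" "tgt f" "mor f"] assms arr_hom[of f] by auto
  then show ?thesis using that Dist_iff[of "src f" "tgt f" Z "mor f" g h] by (metis arrow.collapse)
qed

lemma ex_tri_fibre: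
  assumes "arr f" obtains k h where "tri k f h"
proof -
  obtain g h where "tri f g h" using ex_tri[OF assms] .
  from tri_unrot[OF this] show ?thesis using that by blast
qed

lemma is_cone_iff: "arr f \<Longrightarrow> is_cone T (src f) (tgt f) (mor f) Z \<longleftrightarrow> (\<exists>g h. tri f g h \<and> tgt g = Z)"
proof
  assume "arr f" "is_cone T (src f) (tgt f) (mor f) Z"
  then obtain g h where "(src f, tgt f, Z, mor f, g, h) \<in> Dist T" by (auto simp: is_cone_def)
  then show "\<exists>g h. tri f g h \<and> tgt g = Z"
    using Dist_iff[of "src f" "tgt f" Z "mor f" g h] by (metis arrow.collapse arrow.sel(3))
next
  assume "\<exists>g h. tri f g h \<and> tgt g = Z"
  then show "is_cone T (src f) (tgt f) (mor f) Z" by (auto simp: is_cone_def tri_def)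
qed

text \<open>Reads Cone(f)[-1] = F as a triangle F -> X -> Y, so that later arguments keep the fibre
  in front and carry no desuspension.\<close>

lemma is_cone_fibre_iff:
  assumes f: "arr f" and F: "F \<in> Ob T"
  shows "is_cone T (src f) (tgt f) (mor f) (ShO T 1 F) \<longleftrightarrow> (\<exists>k h. tri k f h \<and> src k = F)"
proof
  assume "is_cone T (src f) (tgt f) (mor f) (ShO T 1 F)"
  then obtain g h where "tri f g h" "tgt g = ShO T 1 F" using is_cone_iff[OF f] by blast
  then show "\<exists>k h. tri k f h \<and> src k = F"
    using tri_unrot[of f g h] triD[of f g h] F by (intro exI[of _ "opp (sh (-1) h)"] exI[of _ g]) simp
next
  assume "\<exists>k h. tri k f h \<and> src k = F"
  then obtain k h where "tri k f h" "src k = F" by blast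
  then show "is_cone T (src f) (tgt f) (mor f) (ShO T 1 F)"
    using tri_rot[of k f h] triD[of k f h] is_cone_iff[OF f] by auto
qed

lemma tri_map:
  assumes "tri f g h" "tri f' g' h'" "a \<in> Ar (src f) (src f')" "b \<in> Ar (tgt f) (tgt f')" "b \<bullet> f = f' \<bullet> a"
  obtains c where "c \<in> Ar (tgt g) (tgt g')" "c \<bullet> g = g' \<bullet> b" "sh 1 a \<bullet> h = h' \<bullet> c"
proof -
  note t = triD[OF assms(1)] triD[OF assms(2)]
  have "mor b \<cdot> mor f = mor f' \<cdot> mor a" using assms(5) by (metis comp_simps(3))
  moreover have "mor a \<in> Hom T (src f) (src f')" "mor b \<in> Hom T (tgt f) (tgt f')"
    using assms(3,4) arr_hom[of a] arr_hom[of b] by auto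
  ultimately obtain c where c: "c \<in> Hom T (tgt g) (tgt g')" "c \<cdot> mor g = mor g' \<cdot> mor b"
      "ShM T 1 (mor a) \<cdot> mor h = mor h' \<cdot> c"
    using complete_map[of "src f" "tgt f" "tgt g" "mor f" "mor g" "mor h"
        "src f'" "tgt f'" "tgt g'" "mor f'" "mor g'" "mor h'"] assms(1,2) unfolding tri_def by blast
  show ?thesis
    by (rule that[of "Arrow (tgt g) c (tgt g')"]) (use c t assms(3,4) in \<open>auto intro!: arrow_eqI\<close>)
qed

lemma iso_arr_is_iso: "iso_arr f \<Longrightarrow> f \<in> Ar X Y \<Longrightarrow> is_iso T X Y (mor f)"
  using is_iso_iff[of "src f" "tgt f" "mor f"] arr_ob[of f] arrow.collapse[of f] by auto

lemma tri_iso: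
  assumes "tri f g h" "arr f'" "arr g'" "arr h'" "src g' = tgt f'" "src h' = tgt g'" "tgt h' = ShO T 1 (src f')"
    "iso_arr a" "a \<in> Ar (src f) (src f')" "iso_arr b" "b \<in> Ar (tgt f) (tgt f')" "iso_arr c" "c \<in> Ar (tgt g) (tgt g')"
    "b \<bullet> f = f' \<bullet> a" "c \<bullet> g = g' \<bullet> b" "sh 1 a \<bullet> h = h' \<bullet> c"
  shows "tri f' g' h'"
proof -
  have i: "is_iso T (src f) (src f') (mor a)" "is_iso T (tgt f) (tgt f') (mor b)" "is_iso T (tgt g) (tgt g') (mor c)"
    using assms(8-13) iso_arr_is_iso by metis+
  have e: "mor b \<cdot> mor f = mor f' \<cdot> mor a" "mor c \<cdot> mor g = mor g' \<cdot> mor b" "ShM T 1 (mor a) \<cdot> mor h = mor h' \<cdot> mor c"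
    using assms(14-16) by (metis comp_simps(3) sh_simps(3))+
  have h: "mor f' \<in> Hom T (src f') (tgt f')" "mor g' \<in> Hom T (tgt f') (tgt g')" "mor h' \<in> Hom T (tgt g') (ShO T 1 (src f'))"
    using assms(2-7) arr_hom by metis+
  have "(src f, tgt f, tgt g, mor f, mor g, mor h) \<in> Dist T" using assms(1) by (simp add: tri_def)
  from Dist_iso[OF this _ _ _ h i e] show ?thesis using assms(2-7) by (simp add: tri_def)
qed

lemma tri_ide: "X \<in> Ob T \<Longrightarrow> is_zero T Z \<Longrightarrow> tri (ide X) (nul X Z) (nul Z (ShO T 1 X))"
  using Dist_Idm[of X Z] is_zero_ob[of Z] by (simp add: tri_def)

text \<open>The trivial triangle on \<open>src f\<close> maps to the given one by the identity and
  \<open>f\<close>, so \<open>g \<bullet> f\<close> factors through a zero object; the other two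
  vanishings follow by rotation.\<close>

lemma tri_comp0:
  assumes "tri f g h" shows "g \<bullet> f = nul (src f) (tgt g)" "h \<bullet> g = nul (tgt f) (ShO T 1 (src f))"
    "sh 1 f \<bullet> h = nul (tgt g) (ShO T 1 (tgt f))"
proof -
  obtain Z where Z: "is_zero T Z" using ex_zero by blast
  have *: "g \<bullet> f = nul (src f) (tgt g)" if t: "tri f g h" for f g h
  proof -
    note D = triD[OF t]
    obtain c where "c \<in> Ar Z (tgt g)" "c \<bullet> nul (src f) Z = g \<bullet> f"
      by (rule tri_map[OF tri_ide[OF _ Z] t, of "src f" "ide (src f)" f]) (use D in simp_all)
    then show ?thesis using comp_nul[of c Z "src f"] D by simp
  qed
  note D = triD[OF assms]
  show "g \<bullet> f = nul (src f) (tgt g)" "h \<bullet> g = nul (tgt f) (ShO T 1 (src f))"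
    using *[OF assms] *[OF tri_rot[OF assms]] D by simp_all
  have "opp (sh 1 f) \<bullet> h = nul (tgt g) (ShO T 1 (tgt f))" using *[OF tri_rot[OF tri_rot[OF assms]]] D by simp
  then show "sh 1 f \<bullet> h = nul (tgt g) (ShO T 1 (tgt f))"
    using D opp_opp[of "sh 1 f \<bullet> h"] by simp
qed

text \<open>\<open>f\<close> is a weak kernel of \<open>g\<close>: complete a map from the rotated
  trivial triangle S -> 0 -> S[1] to the rotated given one. Both rotations carry a sign, and the two
  signs cancel.\<close>

lemma tri_lift:
  assumes t: "tri f g h" and u: "arr u" "tgt u = tgt f" and 0: "g \<bullet> u = nul (src u) (tgt g)"
  obtains v where "v \<in> Ar (src u) (src f)" "f \<bullet> v = u"
proof -
  note D = triD[OF t]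
  obtain Z where Z: "is_zero T Z" using ex_zero by blast
  let ?S = "src u"
  have Zo: "Z \<in> Ob T" using Z by (rule is_zero_ob)
  have S: "tri (nul ?S Z) (nul Z (ShO T 1 ?S)) (opp (ide (ShO T 1 ?S)))"
    using tri_rot[OF tri_ide[OF _ Z, of ?S]] u by simp
  obtain c where c: "c \<in> Ar (ShO T 1 ?S) (ShO T 1 (src f))"
      "sh 1 u \<bullet> opp (ide (ShO T 1 ?S)) = opp (sh 1 f) \<bullet> c"
    by (rule tri_map[OF S tri_rot[OF t], of u "nul Z (tgt g)"]) (use D u 0 Zo in simp_all)
  have "opp (sh 1 f \<bullet> c) = opp (sh 1 u)" using c u D by simp
  then have "sh 1 f \<bullet> c = sh 1 u" using opp_inj[of "sh 1 f \<bullet> c" "sh 1 u"] c(1) D u by simp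
  then have "f \<bullet> sh (-1) c = u" using sh_inj[of "f \<bullet> sh (-1) c" u 1] c(1) D u by simp
  then show ?thesis using that[of "sh (-1) c"] c D u by simp
qed

text \<open>The dual weak cokernel property, by a map into the trivial triangle with zero first
  term.\<close>

lemma tri_extend:
  assumes t: "tri f g h" and u: "arr u" "src u = tgt f" and 0: "u \<bullet> f = nul (src f) (tgt u)"
  obtains v where "v \<in> Ar (tgt g) (tgt u)" "v \<bullet> g = u"
proof -
  note D = triD[OF t]
  obtain Z where Z: "is_zero T Z" using ex_zero by blast
  have Zo: "Z \<in> Ob T" using Z by (rule is_zero_ob)
  have S: "tri (nul (ShO T (-1) Z) (tgt u)) (ide (tgt u)) (nul (tgt u) Z)"
    using tri_unrot[OF tri_ide[OF _ Z, of "tgt u"]] u Zo by simp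
  obtain c where "c \<in> Ar (tgt g) (tgt u)" "c \<bullet> g = ide (tgt u) \<bullet> u"
    by (rule tri_map[OF t S, of "nul (src f) (ShO T (-1) Z)" u]) (use D u 0 Zo in simp_all)
  then show ?thesis using that u by simp
qed

lemma tri_lift2:
  assumes "tri f g h" "arr u" "tgt u = tgt g" "h \<bullet> u = nul (src u) (tgt h)"
  obtains v where "v \<in> Ar (src u) (tgt f)" "g \<bullet> v = u"
  using tri_lift[OF tri_rot[OF assms(1)], of u] triD[OF assms(1)] assms that by auto

lemma tri_lift3:
  assumes t: "tri f g h" and u: "arr u" "tgt u = tgt h" "sh 1 f \<bullet> u = nul (src u) (ShO T 1 (tgt f))"
  obtains v where "v \<in> Ar (src u) (tgt g)" "h \<bullet> v = u"
  using tri_lift2[OF tri_rot[OF t], of u] triD[OF t] u that by auto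

lemma tri_extend2:
  assumes "tri f g h" "arr u" "src u = tgt g" "u \<bullet> g = nul (tgt f) (tgt u)"
  obtains v where "v \<in> Ar (ShO T 1 (src f)) (tgt u)" "v \<bullet> h = u"
  using tri_extend[OF tri_rot[OF assms(1)], of u] triD[OF assms(1)] assms that by auto

lemma tri_extend3:
  assumes t: "tri f g h" and u: "arr u" "src u = tgt h" "u \<bullet> h = nul (tgt g) (tgt u)"
  obtains v where "v \<in> Ar (ShO T 1 (tgt f)) (tgt u)" "v \<bullet> sh 1 f = u"
proof -
  obtain v where "v \<in> Ar (ShO T 1 (tgt f)) (tgt u)" "v \<bullet> opp (sh 1 f) = u"
    using tri_extend2[OF tri_rot[OF t], of u] triD[OF t] u by auto
  then show ?thesis using that[of "opp v"] triD[OF t] by simp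
qed

text \<open>One step of the long exact sequence: \<open>u[1]\<close> lifts through \<open>h\<close>
  to some \<open>y\<close>, and if \<open>y = g \<bullet> x\<close> then
  \<open>u[1] = h \<bullet> g \<bullet> x = 0\<close>. Surjectivity of \<open>g\<close> on Hom(S[1],
  -) thus gives injectivity of \<open>f\<close> on Hom(S, -).\<close>

lemma tri_mono:
  assumes t: "tri f g h" and u: "arr u" "tgt u = src f" "f \<bullet> u = nul (src u) (tgt f)"
    and ex: "\<And>y. y \<in> Ar (ShO T 1 (src u)) (tgt g) \<Longrightarrow> \<exists>x\<in>Ar (ShO T 1 (src u)) (tgt f). g \<bullet> x = y"
  shows "u = nul (src u) (src f)"
proof -
  note D = triD[OF t]
  have "sh 1 f \<bullet> sh 1 u = nul (ShO T 1 (src u)) (ShO T 1 (tgt f))"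
    using D u by (simp flip: sh_comp)
  then obtain y where y: "y \<in> Ar (ShO T 1 (src u)) (tgt g)" "h \<bullet> y = sh 1 u"
    using tri_lift3[OF t, of "sh 1 u"] u D by auto
  then obtain x where x: "x \<in> Ar (ShO T 1 (src u)) (tgt f)" "g \<bullet> x = y" using ex by blast
  have "sh 1 u = nul (ShO T 1 (src u)) (ShO T 1 (src f))"
    using comp_reduce[OF tri_comp0(2)[OF t], of x] x y D u by auto
  then show ?thesis using sh_eq_nul[of u 1] u by simp
qed

lemma tri_opp: "tri f g h \<Longrightarrow> tri (opp f) (opp g) h"
  by (rule tri_iso[of f g h _ _ _ "ide (src f)" "opp (ide (tgt f))" "ide (tgt g)"])
    (use triD[of f g h] in \<open>simp_all add: iso_arr_ide iso_arr_opp\<close>)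

text \<open>Three rotations shift the whole triangle and put a sign on all three morphisms;
  \<open>tri_opp\<close> removes two of them.\<close>

lemma tri_sh1:
  assumes "arr f" "arr g" "arr h" "src g = tgt f" "src h = tgt g" "tgt h = ShO T 1 (src f)"
  shows "tri f g h \<longleftrightarrow> tri (sh 1 f) (sh 1 g) (opp (sh 1 h))"
proof -
  have "tri f g h \<longleftrightarrow> tri (opp (sh 1 f)) (opp (sh 1 g)) (opp (sh 1 h))"
    using assms tri_rotate[of f g h] tri_rotate[of g h "opp (sh 1 f)"] tri_rotate[of h "opp (sh 1 f)" "opp (sh 1 g)"]
    by simp
  also have "\<dots> \<longleftrightarrow> tri (sh 1 f) (sh 1 g) (opp (sh 1 h))"
    using assms tri_opp[of "opp (sh 1 f)" "opp (sh 1 g)" "opp (sh 1 h)"] tri_opp[of "sh 1 f" "sh 1 g" "opp (sh 1 h)"] by auto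
  finally show ?thesis .
qed

text \<open>The connecting morphism is left unspecified because each shift by one changes its
  sign.\<close>

lemma tri_sh:
  assumes "tri f g h"
  obtains h' where "tri (sh n f) (sh n g) h'"
proof -
  have up: "\<exists>h'. tri (sh 1 f) (sh 1 g) h'" if "tri f g h" for f g h
    using that tri_sh1[of f g h] triD[OF that] by auto
  have down: "\<exists>h'. tri (sh (-1) f) (sh (-1) g) h'" if "tri f g h" for f g h
    using that tri_sh1[of "sh (-1) f" "sh (-1) g" "opp (sh (-1) h)"] triD[OF that] by auto
  have "\<exists>h'. tri (sh n f) (sh n g) h'"
  proof (induction n rule: int_induct[of _ 0])
    case base show ?case using assms triD[OF assms] by auto
  next
    case (step1 i)
    then obtain h' where "tri (sh i f) (sh i g) h'" by blast
    from up[OF this] show ?case using triD[OF assms] by (simp add: add.commute)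
  next
    case (step2 i)
    then obtain h' where "tri (sh i f) (sh i g) h'" by blast
    from down[OF this] show ?case using triD[OF assms] by (simp add: add.commute)
  qed
  then show ?thesis using that by blast
qed

lemma tri_octahedral:
  assumes "tri f u du" "tri g v dv" "tri (g \<bullet> f) w dw" "src g = tgt f"
  obtains a b where "tri a b (sh 1 u \<bullet> dv)" "src a = tgt u" "tgt a = tgt w" "tgt b = tgt v"
    "a \<bullet> u = w \<bullet> g" "dw \<bullet> a = du" "b \<bullet> w = v" "dv \<bullet> b = sh 1 f \<bullet> dw"
proof -
  note D = triD[OF assms(1)] triD[OF assms(2)] triD[OF assms(3)]
  have "(src f, tgt f, tgt u, mor f, mor u, mor du) \<in> Dist T" "(tgt f, tgt g, tgt v, mor g, mor v, mor dv) \<in> Dist T"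
    "(src f, tgt g, tgt w, mor g \<cdot> mor f, mor w, mor dw) \<in> Dist T"
    using assms by (auto simp: tri_def)
  from octahedral[OF this] obtain a b where ab: "(tgt u, tgt w, tgt v, a, b, ShM T 1 (mor u) \<cdot> mor dv) \<in> Dist T"
    "a \<cdot> mor u = mor w \<cdot> mor g" "mor dw \<cdot> a = mor du" "b \<cdot> mor w = mor v" "mor dv \<cdot> b = ShM T 1 (mor f) \<cdot> mor dw"
    by blast
  let ?a = "Arrow (tgt u) a (tgt w)" and ?b = "Arrow (tgt w) b (tgt v)"
  have "sh 1 u \<bullet> dv = Arrow (tgt v) (ShM T 1 (mor u) \<cdot> mor dv) (ShO T 1 (tgt u))"
    using D assms(4) by (intro arrow_eqI) simp_all
  then have "tri ?a ?b (sh 1 u \<bullet> dv)" using ab(1) Dist_iff by simp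
  moreover have "?a \<bullet> u = w \<bullet> g" "dw \<bullet> ?a = du" "?b \<bullet> w = v" "dv \<bullet> ?b = sh 1 f \<bullet> dw"
    using ab(2-5) D assms(4) by (auto intro!: arrow_eqI)
  ultimately show ?thesis using that[of ?a ?b] by simp
qed

end


section \<open>Products of triangles\<close>

context triangulated_category
begin

text \<open>Exactness at the middle term is checked in each component; the chosen lifts assemble by
  the universal property of \<open>X\<close>, and projections separate morphisms into
  \<open>Y\<close>.\<close>

lemma prod_exact:
  assumes t: "\<And>i. i \<in> I \<Longrightarrow> tri (f i) (g i) (h i)"
    and X: "prod_cone I (\<lambda>i. src (f i)) X p" and Y: "prod_cone I (\<lambda>i. tgt (f i)) Y q"
    and Z: "prod_cone I (\<lambda>i. tgt (g i)) Z r"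
    and u: "u \<in> Ar X Y" "\<And>i. i \<in> I \<Longrightarrow> q i \<bullet> u = f i \<bullet> p i"
    and v: "v \<in> Ar Y Z" "\<And>i. i \<in> I \<Longrightarrow> r i \<bullet> v = g i \<bullet> q i"
    and y: "arr y" "tgt y = Y" "v \<bullet> y = nul (src y) Z"
  obtains z where "z \<in> Ar (src y) X" "u \<bullet> z = y"
proof -
  have "\<exists>z. z \<in> Ar (src y) (src (f i)) \<and> f i \<bullet> z = q i \<bullet> y" if i: "i \<in> I" for i
  proof -
    note D = triD[OF t[OF i]] prod_proj[OF Y i] prod_proj[OF Z i]
    have "g i \<bullet> (q i \<bullet> y) = r i \<bullet> (v \<bullet> y)"
      using comp_swap[OF v(2)[OF i], of y] y v(1) D by simp
    then have "g i \<bullet> (q i \<bullet> y) = nul (src y) (tgt (g i))" using y D by simp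
    then obtain z where "z \<in> Ar (src (q i \<bullet> y)) (src (f i))" "f i \<bullet> z = q i \<bullet> y"
      using tri_lift[OF t[OF i], of "q i \<bullet> y"] y D by auto
    then show ?thesis by auto
  qed
  then obtain z where z: "\<And>i. i \<in> I \<Longrightarrow> z i \<in> Ar (src y) (src (f i))" "\<And>i. i \<in> I \<Longrightarrow> f i \<bullet> z i = q i \<bullet> y"
    by metis
  have "src y \<in> Ob T" using y by simp
  then obtain x where x: "x \<in> Ar (src y) X" "\<forall>i\<in>I. p i \<bullet> x = z i" by (rule prod_ex[OF X _ z(1)])
  have "u \<bullet> x = y"
  proof (rule prod_eq[OF Y])
    show "u \<bullet> x \<in> Ar (src y) Y" "y \<in> Ar (src y) Y" using u x y by simp_all
    fix i assume i: "i \<in> I"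
    note D = triD[OF t[OF i]] prod_proj[OF Y i] prod_proj[OF X i]
    show "q i \<bullet> (u \<bullet> x) = q i \<bullet> y"
      using comp_swap[OF u(2)[OF i], of x] x u(1) D i z[OF i] by simp
  qed
  then show ?thesis using that x by blast
qed

text \<open>Take any cone of \<open>u\<close> and map it to \<open>Z\<close> by a morphism
  \<open>c\<close> whose components complete maps of triangles. Both the cone sequence and the
  product sequence are exact after Hom(S, -), so a five-lemma chase makes \<open>c\<close> an
  isomorphism of triangles.\<close>

lemma tri_product:
  assumes t: "\<And>i. i \<in> I \<Longrightarrow> tri (f i) (g i) (h i)"
    and X: "prod_cone I (\<lambda>i. src (f i)) X p" and Y: "prod_cone I (\<lambda>i. tgt (f i)) Y q"
    and Z: "prod_cone I (\<lambda>i. tgt (g i)) Z r"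
    and u: "u \<in> Ar X Y" "\<And>i. i \<in> I \<Longrightarrow> q i \<bullet> u = f i \<bullet> p i"
    and v: "v \<in> Ar Y Z" "\<And>i. i \<in> I \<Longrightarrow> r i \<bullet> v = g i \<bullet> q i"
    and w: "w \<in> Ar Z (ShO T 1 X)" "\<And>i. i \<in> I \<Longrightarrow> sh 1 (p i) \<bullet> w = h i \<bullet> r i"
  shows "tri u v w"
proof -
  note Xs = prod_sh[OF X, of 1] and Ys = prod_sh[OF Y, of 1]
  obtain g' h' where t': "tri u g' h'" using ex_tri u by auto
  note D' = triD[OF t']
  let ?C = "tgt g'"
  have "\<exists>c. c \<in> Ar ?C (tgt (g i)) \<and> c \<bullet> g' = g i \<bullet> q i \<and> sh 1 (p i) \<bullet> h' = h i \<bullet> c" if i: "i \<in> I" for i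
  proof -
    obtain c where "c \<in> Ar ?C (tgt (g i))" "c \<bullet> g' = g i \<bullet> q i" "sh 1 (p i) \<bullet> h' = h i \<bullet> c"
      by (rule tri_map[OF t' t[OF i], of "p i" "q i"]) (use u(1) u(2)[OF i] prod_proj[OF X i] prod_proj[OF Y i] in simp_all)
    then show ?thesis by blast
  qed
  then obtain cc where cc: "\<And>i. i \<in> I \<Longrightarrow> cc i \<in> Ar ?C (tgt (g i))" "\<And>i. i \<in> I \<Longrightarrow> cc i \<bullet> g' = g i \<bullet> q i"
    "\<And>i. i \<in> I \<Longrightarrow> sh 1 (p i) \<bullet> h' = h i \<bullet> cc i" by metis
  have "?C \<in> Ob T" using D' by simp
  then obtain c where c: "c \<in> Ar ?C Z" "\<forall>i\<in>I. r i \<bullet> c = cc i" by (rule prod_ex[OF Z _ cc(1)])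
  have cg: "c \<bullet> g' = v"
  proof (rule prod_eq[OF Z])
    show "c \<bullet> g' \<in> Ar Y Z" "v \<in> Ar Y Z" using c D' u v by simp_all
    show "r i \<bullet> (c \<bullet> g') = r i \<bullet> v" if i: "i \<in> I" for i
      using comp_reduce[of "r i" c "cc i" g'] c i cc(2)[OF i] v(2)[OF i] D' prod_proj[OF Z i] by simp
  qed
  have wc: "w \<bullet> c = h'"
  proof (rule prod_eq[OF Xs])
    show "w \<bullet> c \<in> Ar ?C (ShO T 1 X)" "h' \<in> Ar ?C (ShO T 1 X)" using c D' u w by simp_all
    fix i assume i: "i \<in> I"
    note D = triD[OF t[OF i]] prod_proj[OF Z i] prod_proj[OF X i]
    show "sh 1 (p i) \<bullet> (w \<bullet> c) = sh 1 (p i) \<bullet> h'"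
      using comp_swap[OF w(2)[OF i], of c] c i cc(3)[OF i] w(1) D by simp
  qed
  have ex1: "\<exists>z\<in>Ar (src y) X. u \<bullet> z = y" if "arr y" "tgt y = Y" "v \<bullet> y = nul (src y) Z" for y
    using prod_exact[OF t X Y Z u v that] by blast
  \<comment> \<open>Exactness at \<open>Z\<close> is exactness at the middle term of the rotated
    triangles.\<close>
  have ex2: "\<exists>z\<in>Ar (src y) Y. v \<bullet> z = y" if y: "arr y" "tgt y = Z" "w \<bullet> y = nul (src y) (ShO T 1 X)" for y
  proof -
    have rot: "i \<in> I \<Longrightarrow> tri (g i) (h i) (opp (sh 1 (f i)))" for i using tri_rot[OF t] .
    have Y': "prod_cone I (\<lambda>i. src (g i)) Y q"
      by (rule prod_cong[OF Y]) (use triD(4)[OF t] in simp_all)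
    have X': "prod_cone I (\<lambda>i. tgt (h i)) (ShO T 1 X) (\<lambda>i. sh 1 (p i))"
      by (rule prod_cong[OF Xs]) (use triD(6)[OF t] in simp_all)
    show ?thesis using prod_exact[OF rot Y' Z X' v w y] by blast
  qed
  have "iso_arr c"
  proof (rule iso_arrI)
    show "arr c" using c by simp
    fix y assume y: "arr y" "tgt y = tgt c"
    \<comment> \<open>Each component contains \<open>sh 1 (f i) \<bullet> h i = 0\<close>; hence
      \<open>w \<bullet> y\<close> lifts through the connecting morphism \<open>h'\<close> of the
      chosen cone.\<close>
    have wy: "sh 1 u \<bullet> (w \<bullet> y) = nul (src y) (ShO T 1 Y)"
    proof (rule prod_eq_nul[OF Ys])
      show "sh 1 u \<bullet> (w \<bullet> y) \<in> Ar (src y) (ShO T 1 Y)" using u w y c by simp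
      fix i assume i: "i \<in> I"
      note D = triD[OF t[OF i]] prod_proj[OF Z i] prod_proj[OF X i] prod_proj[OF Y i]
      have "sh 1 (q i) \<bullet> sh 1 u = sh 1 (f i) \<bullet> sh 1 (p i)" using u(1) u(2)[OF i] D by (simp flip: sh_comp)
      then have "sh 1 (q i) \<bullet> (sh 1 u \<bullet> (w \<bullet> y)) = sh 1 (f i) \<bullet> (sh 1 (p i) \<bullet> (w \<bullet> y))"
        using comp_swap[of "sh 1 (q i)" "sh 1 u" "sh 1 (f i)" "sh 1 (p i)" "w \<bullet> y"] D u(1) w(1) y c by simp
      also have "\<dots> = sh 1 (f i) \<bullet> (h i \<bullet> (r i \<bullet> y))"
        using comp_swap[OF w(2)[OF i], of y] D w(1) y c by simp
      also have "\<dots> = nul (src y) (ShO T 1 (tgt (f i)))"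
        using comp_reduce[OF tri_comp0(3)[OF t[OF i]], of "r i \<bullet> y"] D y c by simp
      finally show "sh 1 (q i) \<bullet> (sh 1 u \<bullet> (w \<bullet> y)) = nul (src y) (ShO T 1 (tgt (f i)))" .
    qed
    obtain x where x: "x \<in> Ar (src (w \<bullet> y)) ?C" "h' \<bullet> x = w \<bullet> y"
      using tri_lift3[OF t', of "w \<bullet> y"] wy D' u w y c by auto
    \<comment> \<open>The defect of the first lift \<open>x\<close> is killed by \<open>w\<close>,
      so it comes from \<open>Y\<close> and can be corrected by a morphism through
      \<open>g'\<close>.\<close>
    have "w \<bullet> (y \<boxminus> c \<bullet> x) = nul (src y) (ShO T 1 X)"
      using comp_reduce[OF wc, of x] x D' w y c by simp
    then obtain z where z: "z \<in> Ar (src y) Y" "v \<bullet> z = y \<boxminus> c \<bullet> x"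
      using ex2[of "y \<boxminus> c \<bullet> x"] x y c by auto
    have "c \<bullet> (x \<boxplus> g' \<bullet> z) = c \<bullet> x \<boxplus> v \<bullet> z"
      using comp_reduce[OF cg, of z] x z c D' u by simp
    also have "\<dots> = y" using z x y c add_commute[of y "opp (c \<bullet> x)"] by simp
    finally have "c \<bullet> (x \<boxplus> g' \<bullet> z) = y" .
    moreover have "x \<boxplus> g' \<bullet> z \<in> Ar (src y) (src c)" using x z c D' u by simp
    ultimately show "\<exists>x\<in>Ar (src y) (src c). c \<bullet> x = y" by blast
  next
    fix x assume x: "arr x" "tgt x = src c" "c \<bullet> x = nul (src x) (tgt c)"
    have "h' \<bullet> x = nul (src x) (tgt h')"
      using comp_reduce[OF wc, of x] x c w u(1) D' by simp
    then obtain y where y: "y \<in> Ar (src x) (tgt u)" "g' \<bullet> y = x"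
      using tri_lift2[OF t', of x] x c by auto
    have vy: "v \<bullet> y = nul (src y) Z" using comp_reduce[OF cg, of y] x y c D' u by simp
    have "arr y" "tgt y = Y" using y u by simp_all
    from ex1[OF this vy] obtain z where z: "z \<in> Ar (src y) X" "u \<bullet> z = y" by blast
    show "x = nul (src x) (src c)"
      using comp_reduce[OF tri_comp0(1)[OF t'], of z] y z u c D' by auto
  qed
  then show ?thesis
    by (intro tri_iso[OF t', of u v w "ide X" "ide Y" c])
      (use u v w c cg wc D' prod_ob(1)[OF X] prod_ob(1)[OF Y] in \<open>simp_all add: iso_arr_ide\<close>)
qed


section \<open>Homotopy limits\<close>

text \<open>Here \<open>\<psi> i\<close> goes from stage \<open>i + 1\<close> to stage
  \<open>i\<close>, so \<open>\<psi> i\<close> is what \<open>is_holim\<close> calls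
  \<open>\<phi> (Suc i)\<close>. The triangle is turned so that the limit is
  \<open>src \<iota>\<close>, with \<iota> its map to the product, and no shift occurs.\<close>

definition holim :: "(nat \<Rightarrow> ('a, 'b) arrow) \<Rightarrow> (nat \<Rightarrow> ('a, 'b) arrow) \<Rightarrow> ('a, 'b) arrow
    \<Rightarrow> ('a, 'b) arrow \<Rightarrow> ('a, 'b) arrow \<Rightarrow> bool" where
  "holim \<psi> p d \<iota> h \<longleftrightarrow> (\<forall>i. arr (\<psi> i) \<and> src (\<psi> i) = tgt (\<psi> (Suc i))) \<and>
     prod_cone UNIV (\<lambda>i. tgt (\<psi> i)) (tgt \<iota>) p \<and> tri \<iota> d h \<and> tgt d = tgt \<iota> \<and>
     (\<forall>i. p i \<bullet> d = p i \<boxminus> \<psi> i \<bullet> p (Suc i))"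

lemma holimD:
  assumes "holim \<psi> p d \<iota> h"
  shows "arr (\<psi> i)" "src (\<psi> i) = tgt (\<psi> (Suc i))" "prod_cone UNIV (\<lambda>i. tgt (\<psi> i)) (tgt \<iota>) p"
    "tri \<iota> d h" "tgt d = tgt \<iota>" "p i \<bullet> d = p i \<boxminus> \<psi> i \<bullet> p (Suc i)"
    "arr (p i)" "src (p i) = tgt \<iota>" "tgt (p i) = tgt (\<psi> i)"
    "arr \<iota>" "arr d" "arr h" "src d = tgt \<iota>" "src h = tgt \<iota>" "tgt h = ShO T 1 (src \<iota>)"
  using assms prod_proj[of UNIV "\<lambda>i. tgt (\<psi> i)" "tgt \<iota>" p i] triD[of \<iota> d h] by (auto simp: holim_def)

lemma holim_compat: "holim \<psi> p d \<iota> h \<Longrightarrow> p i \<bullet> \<iota> = \<psi> i \<bullet> (p (Suc i) \<bullet> \<iota>)"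
proof -
  assume hl: "holim \<psi> p d \<iota> h"
  note D = holimD[OF hl]
  have "p i \<bullet> (d \<bullet> \<iota>) = p i \<bullet> \<iota> \<boxminus> \<psi> i \<bullet> (p (Suc i) \<bullet> \<iota>)"
    using comp_reduce[OF D(6)[of i], of \<iota>] D by simp
  moreover have "p i \<bullet> (d \<bullet> \<iota>) = nul (src \<iota>) (tgt (\<psi> i))" using tri_comp0(1)[OF D(4)] D by simp
  ultimately show ?thesis
    using add_eq_iff[of "p i \<bullet> \<iota>" "\<psi> i \<bullet> (p (Suc i) \<bullet> \<iota>)"] D by simp
qed

lemma holim_compat_le:
  assumes hl: "holim \<psi> p d \<iota> h" and "k \<le> m"
  shows "\<exists>g\<in>Ar (tgt (\<psi> m)) (tgt (\<psi> k)). p k \<bullet> \<iota> = g \<bullet> (p m \<bullet> \<iota>)"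
  using \<open>k \<le> m\<close>
proof (induction m rule: dec_induct)
  case base
  show ?case using holimD[OF hl] by (intro bexI[of _ "ide (tgt (\<psi> k))"]) simp_all
next
  case (step m)
  note D = holimD[OF hl]
  obtain g where g: "g \<in> Ar (tgt (\<psi> m)) (tgt (\<psi> k))" "p k \<bullet> \<iota> = g \<bullet> (p m \<bullet> \<iota>)" using step by blast
  show ?case using g holim_compat[OF hl, of m] D by (intro bexI[of _ "g \<bullet> \<psi> m"]) simp_all
qed

text \<open>Hom(S, holim) maps onto the limit of the groups Hom(S, Y_i): a compatible family is a
  morphism to the product that \<open>d\<close> kills. The lift need not be unique.\<close>

lemma holim_lift:
  assumes hl: "holim \<psi> p d \<iota> h" and S: "S \<in> Ob T" and x: "\<And>i. x i \<in> Ar S (tgt (\<psi> i))"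
    and xc: "\<And>i. x i = \<psi> i \<bullet> x (Suc i)"
  obtains y where "y \<in> Ar S (src \<iota>)" "\<And>i. p i \<bullet> (\<iota> \<bullet> y) = x i"
proof -
  note D = holimD[OF hl]
  obtain y where y: "y \<in> Ar S (tgt \<iota>)" "\<forall>i\<in>UNIV. p i \<bullet> y = x i" by (rule prod_ex[OF D(3) S x])
  have "d \<bullet> y = nul S (tgt \<iota>)"
  proof (rule prod_eq_nul[OF D(3)])
    show "d \<bullet> y \<in> Ar S (tgt \<iota>)" using D y by simp
    show "p i \<bullet> (d \<bullet> y) = nul S (tgt (\<psi> i))" for i
      using comp_reduce[OF D(6)[of i], of y] y D x[of i] x[of "Suc i"] xc[of i] by simp
  qed
  then obtain z where z: "z \<in> Ar S (src \<iota>)" "\<iota> \<bullet> z = y" using tri_lift[OF D(4), of y] y D by auto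
  show ?thesis using that[OF z(1)] z(2) y(2) by simp
qed

text \<open>The injective half of the Milnor sequence. The last hypothesis says that the derived
  limit of the groups Hom(S[1], Y_i) vanishes, that is, \<open>d\<close> is onto on Hom(S[1], -);
  \<open>tri_mono\<close> then applies to \<iota>.\<close>

lemma holim_eq_nul:
  assumes hl: "holim \<psi> p d \<iota> h" and v: "arr v" "tgt v = src \<iota>"
    and 0: "\<And>i. p i \<bullet> (\<iota> \<bullet> v) = nul (src v) (tgt (\<psi> i))"
    and ex: "\<And>y. (\<And>i. y i \<in> Ar (ShO T 1 (src v)) (tgt (\<psi> i))) \<Longrightarrow>
      \<exists>x. \<forall>i. x i \<in> Ar (ShO T 1 (src v)) (tgt (\<psi> i)) \<and> x i \<boxminus> \<psi> i \<bullet> x (Suc i) = y i"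
  shows "v = nul (src v) (src \<iota>)"
proof (rule tri_mono)
  note D = holimD[OF hl]
  show "tri \<iota> d h" "arr v" "tgt v = src \<iota>" using D v by simp_all
  show "\<iota> \<bullet> v = nul (src v) (tgt \<iota>)"
    by (rule prod_eq_nul[OF D(3)]) (use D v 0 in simp_all)
  show "\<exists>x\<in>Ar (ShO T 1 (src v)) (tgt \<iota>). d \<bullet> x = y" if y: "y \<in> Ar (ShO T 1 (src v)) (tgt d)" for y
  proof -
    have "p i \<bullet> y \<in> Ar (ShO T 1 (src v)) (tgt (\<psi> i))" for i using y D by simp
    then obtain x where x: "\<And>i. x i \<in> Ar (ShO T 1 (src v)) (tgt (\<psi> i))"
       and xy: "\<And>i. x i \<boxminus> \<psi> i \<bullet> x (Suc i) = p i \<bullet> y"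
      using ex[of "\<lambda>i. p i \<bullet> y"] by blast
    have S: "ShO T 1 (src v) \<in> Ob T" using v by simp
    obtain z where z: "z \<in> Ar (ShO T 1 (src v)) (tgt \<iota>)" "\<forall>i\<in>UNIV. p i \<bullet> z = x i"
      by (rule prod_ex[OF D(3) S x])
    have "d \<bullet> z = y"
    proof (rule prod_eq[OF D(3)])
      show "d \<bullet> z \<in> Ar (ShO T 1 (src v)) (tgt \<iota>)" "y \<in> Ar (ShO T 1 (src v)) (tgt \<iota>)" using D z y by simp_all
      show "p i \<bullet> (d \<bullet> z) = p i \<bullet> y" for i
        using comp_reduce[OF D(6)[of i], of z] z D xy[of i] by simp
    qed
    then show ?thesis using z by blast
  qed
qed

lemma holim_sh:
  assumes "holim \<psi> p d \<iota> h"
  obtains h' where "holim (\<lambda>i. sh n (\<psi> i)) (\<lambda>i. sh n (p i)) (sh n d) (sh n \<iota>) h'"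
proof -
  note D = holimD[OF assms]
  obtain h' where h': "tri (sh n \<iota>) (sh n d) h'" using tri_sh[OF D(4)] .
  have "sh n (p i) \<bullet> sh n d = sh n (p i) \<boxminus> sh n (\<psi> i) \<bullet> sh n (p (Suc i))" for i
    using D by (simp flip: sh_comp)
  then have "holim (\<lambda>i. sh n (\<psi> i)) (\<lambda>i. sh n (p i)) (sh n d) (sh n \<iota>) h'"
    unfolding holim_def using D prod_sh[OF D(3), of n] h' by simp
  then show ?thesis using that by blast
qed

end

locale triangulated_small = triangulated_category T + smallness U
  for T :: "('o, 'm, 'z) tcat_scheme" (structure) and U :: "'i set set"

sublocale triangulated_small \<subseteq> category_small T U ..

context triangulated_small
begin

lemma ex_holim:
  assumes "has_products U T" "\<And>i. arr (\<psi> i)" "\<And>i. src (\<psi> i) = tgt (\<psi> (Suc i))"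
  obtains p d \<iota> h where "holim \<psi> p d \<iota> h"
proof -
  have "is_small U (UNIV :: nat set)" by (simp add: is_small_countable)
  then obtain P p where P: "prod_cone UNIV (\<lambda>i. tgt (\<psi> i)) P p"
    by (rule ex_prod[OF assms(1)]) (rule arr_ob(2)[OF assms(2)])
  have pp: "arr (p i)" "src (p i) = P" "tgt (p i) = tgt (\<psi> i)" for i using prod_proj[OF P, of i] by simp_all
  have *: "p i \<boxminus> \<psi> i \<bullet> p (Suc i) \<in> Ar P (tgt (\<psi> i))" for i using pp assms by simp
  obtain d where d: "d \<in> Ar P P" "\<forall>i\<in>UNIV. p i \<bullet> d = p i \<boxminus> \<psi> i \<bullet> p (Suc i)"
    by (rule prod_ex[OF P prod_ob(1)[OF P] *])
  obtain \<iota> h where t: "tri \<iota> d h" using ex_tri_fibre[of d] d by auto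
  have "holim \<psi> p d \<iota> h" unfolding holim_def using assms P d t triD[OF t] by simp
  then show ?thesis using that by blast
qed

section \<open>Closure properties of coenvelope-closed classes\<close>

lemma coenvelope_closedD:
  assumes E: "coenvelope_closed U T E" "E \<subseteq> Ob T" and hl: "holim \<psi> p d \<iota> h" and 0: "tgt (\<psi> 0) \<in> E"
    and fib: "\<And>i. \<exists>k l. tri k (\<psi> i) l \<and> src k \<in> E"
  shows "src \<iota> \<in> E"
proof -
  note D = holimD[OF hl]
  define Y where "Y i = tgt (\<psi> i)" for i
  \<comment> \<open>Only \<open>\<phi> (Suc i) = \<psi> i\<close> enters; truncated subtraction
    gives \<open>\<phi> 0\<close> a default value.\<close>
  define \<phi> where "\<phi> i = mor (\<psi> (i - 1))" for i
  have Y: "Y i \<in> Ob T" "\<phi> (Suc i) \<in> Hom T (Y (Suc i)) (Y i)" for i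
    using D(1)[of i] D(2)[of i] arr_hom[of "\<psi> i"] by (simp_all add: Y_def \<phi>_def)
  have "is_holim T Y \<phi> (src \<iota>)"
    unfolding is_holim_def
  proof (intro conjI exI[of _ "tgt \<iota>"] exI[of _ "\<lambda>i. mor (p i)"] exI[of _ "mor d"] allI)
    show "src \<iota> \<in> Ob T" using D by simp
    show "is_product T UNIV Y (tgt \<iota>) (\<lambda>i. mor (p i))"
      unfolding Y_def by (rule is_product_of_prod_cone[OF D(3)])
    show "mor d \<in> Hom T (tgt \<iota>) (tgt \<iota>)" using D(5,11,13) arr_hom[of d] by simp
    show "mor (p i) \<cdot> mor d = Add T (mor (p i)) (neg T (tgt \<iota>) (Y i) (\<phi> (Suc i) \<cdot> mor (p (Suc i))))" for i
      using arg_cong[OF D(6)[of i], of mor] D(8)[of "Suc i"] by (simp add: Y_def \<phi>_def)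
    show "is_cone T (tgt \<iota>) (tgt \<iota>) (mor d) (ShO T 1 (src \<iota>))"
      using is_cone_fibre_iff[of d "src \<iota>"] D(4,5,10,11,13) by auto
  qed
  moreover have "\<exists>F\<in>E. is_cone T (Y (Suc i)) (Y i) (\<phi> (Suc i)) (ShO T 1 F)" for i
  proof -
    obtain k l where "tri k (\<psi> i) l" "src k \<in> E" using fib by blast
    then show ?thesis using is_cone_fibre_iff[of "\<psi> i" "src k"] D(1)[of i] D(2)[of i] triD(1)[of k "\<psi> i" l]
      by (intro bexI[of _ "src k"]) (auto simp: Y_def \<phi>_def)
  qed
  moreover have "Y 0 \<in> E" using 0 by (simp add: Y_def)
  ultimately show ?thesis using E(1) Y unfolding coenvelope_closed_def by blast
qed

lemma coenvelope_closedI: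
  assumes E: "E \<subseteq> Ob T" and Z: "\<And>Z. is_zero T Z \<Longrightarrow> Z \<in> E" and P: "closed_under_products U T E"
    and hl: "\<And>\<psi> p d \<iota> h. holim \<psi> p d \<iota> h \<Longrightarrow> tgt (\<psi> 0) \<in> E \<Longrightarrow> (\<And>i. \<exists>k l. tri k (\<psi> i) l \<and> src k \<in> E)
      \<Longrightarrow> src \<iota> \<in> E"
  shows "coenvelope_closed U T E"
  unfolding coenvelope_closed_def
proof (intro conjI allI impI, goal_cases)
  case 1 show ?case using Z by blast
next
  case 2 show ?case by (rule P)
next
  case (3 Y \<phi> L)
  define \<psi> where "\<psi> i = Arrow (Y (Suc i)) (\<phi> (Suc i)) (Y i)" for i
  from 3 have Y: "\<And>i. Y i \<in> Ob T" "\<And>i. \<phi> (Suc i) \<in> Hom T (Y (Suc i)) (Y i)" "Y 0 \<in> E"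
    and F: "\<And>i. \<exists>F\<in>E. is_cone T (Y (Suc i)) (Y i) (\<phi> (Suc i)) (ShO T 1 F)" and "is_holim T Y \<phi> L" by blast+
  then obtain P p d where L: "L \<in> Ob T" and P: "is_product T UNIV Y P p" and d: "d \<in> Hom T P P"
    and pd: "\<And>i. p i \<cdot> d = Add T (p i) (neg T P (Y i) (\<phi> (Suc i) \<cdot> p (Suc i)))"
    and c: "is_cone T P P d (ShO T 1 L)" unfolding is_holim_def by blast
  have Po: "P \<in> Ob T" and pi: "\<And>i. p i \<in> Hom T P (Y i)" using P unfolding is_product_def by blast+
  have ad: "arr (Arrow P d P)" using d Po by simp
  obtain \<iota> h where t: "tri \<iota> (Arrow P d P) h" "src \<iota> = L"
    using is_cone_fibre_iff[OF ad L] c by auto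
  have "holim \<psi> (\<lambda>i. Arrow P (p i) (Y i)) (Arrow P d P) \<iota> h"
    unfolding holim_def
  proof (intro conjI allI)
    show "arr (\<psi> i)" "src (\<psi> i) = tgt (\<psi> (Suc i))" for i using Y by (simp_all add: \<psi>_def)
    show "prod_cone UNIV (\<lambda>i. tgt (\<psi> i)) (tgt \<iota>) (\<lambda>i. Arrow P (p i) (Y i))"
      using is_product_imp[OF P] triD(4)[OF t(1)] by (simp add: \<psi>_def)
    show "tri \<iota> (Arrow P d P) h" "tgt (Arrow P d P) = tgt \<iota>" using t triD(4)[OF t(1)] by simp_all
    show "Arrow P (p i) (Y i) \<bullet> Arrow P d P = Arrow P (p i) (Y i) \<boxminus> \<psi> i \<bullet> Arrow P (p (Suc i)) (Y (Suc i))" for i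
      using pd[of i] by (intro arrow_eqI) (simp_all add: \<psi>_def)
  qed
  moreover have "\<exists>k l. tri k (\<psi> i) l \<and> src k \<in> E" for i
  proof -
    obtain F where F: "F \<in> E" "is_cone T (Y (Suc i)) (Y i) (\<phi> (Suc i)) (ShO T 1 F)" using F by blast
    have "arr (\<psi> i)" using Y by (simp add: \<psi>_def)
    from is_cone_fibre_iff[OF this, of F] F E show ?thesis by (auto simp: \<psi>_def)
  qed
  moreover have "tgt (\<psi> 0) \<in> E" using Y by (simp add: \<psi>_def)
  ultimately show "L \<in> E" using hl t(2) by blast
qed

lemma coenvelope_closed_basic:
  assumes "coenvelope_closed U T E"
  shows "is_zero T Z \<Longrightarrow> Z \<in> E" "closed_under_products U T E"
  using assms unfolding coenvelope_closed_def by (elim conjE, blast, elim conjE)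

lemma coenvelope_closed_iso:
  "coenvelope_closed U T E \<Longrightarrow> E \<subseteq> Ob T \<Longrightarrow> iso_arr f \<Longrightarrow> src f \<in> E \<longleftrightarrow> tgt f \<in> E"
  using strictD closed_under_products_strict coenvelope_closed_basic(2) by blast

text \<open>Shifting preserves zero objects, products, triangles and homotopy limits. With least
  closed classes this moves membership along shifts, and it provides the class E[1] in which weight
  decompositions end.\<close>

lemma coenvelope_closed_sh:
  assumes E: "coenvelope_closed U T E" "E \<subseteq> Ob T"
  shows "coenvelope_closed U T {X \<in> Ob T. ShO T n X \<in> E}" (is "coenvelope_closed U T ?E")
proof (rule coenvelope_closedI)
  show "?E \<subseteq> Ob T" by blast
  show "is_zero T Z \<Longrightarrow> Z \<in> ?E" for Z
    using coenvelope_closed_basic(1)[OF E(1) is_zero_ShO] is_zero_ob by simp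
  show "closed_under_products U T ?E"
  proof (rule closed_under_productsI)
    fix I X P p assume *: "I \<in> U" "\<And>i. i \<in> I \<Longrightarrow> X i \<in> ?E" "prod_cone I X P p"
    have "ShO T n P \<in> E"
      by (rule closed_prod[OF coenvelope_closed_basic(2)[OF E(1)] small_set[OF *(1)] _ prod_sh[OF *(3)]])
        (use *(2) in simp)
    then show "P \<in> ?E" using prod_ob(1)[OF *(3)] by simp
  qed
  fix \<psi> p d \<iota> h assume hl: "holim \<psi> p d \<iota> h" and 0: "tgt (\<psi> 0) \<in> ?E"
    and fib: "\<And>i. \<exists>k l. tri k (\<psi> i) l \<and> src k \<in> ?E"
  obtain h' where hl': "holim (\<lambda>i. sh n (\<psi> i)) (\<lambda>i. sh n (p i)) (sh n d) (sh n \<iota>) h'" using holim_sh[OF hl] .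
  have "src (sh n \<iota>) \<in> E"
  proof (rule coenvelope_closedD[OF E hl'])
    show "tgt (sh n (\<psi> 0)) \<in> E" using 0 by simp
    show "\<exists>k l. tri k (sh n (\<psi> i)) l \<and> src k \<in> E" for i
    proof -
      obtain k l where kl: "tri k (\<psi> i) l" "src k \<in> ?E" using fib by blast
      obtain l' where "tri (sh n k) (sh n (\<psi> i)) l'" using tri_sh[OF kl(1)] .
      then show ?thesis using kl(2) by auto
    qed
  qed
  then show "src \<iota> \<in> ?E" using holimD(10)[OF hl] by simp
qed

text \<open>The orthogonality argument. Since a coenvelope is a least closed class, Hom(M, X[1]) = 0
  on the generators spreads to all of it; the homotopy limit is the case with content.\<close>

lemma coenvelope_closed_noarr:
  assumes M: "M \<in> Ob T"
  shows "coenvelope_closed U T {X \<in> Ob T. noarr M (ShO T 1 X)}" (is "coenvelope_closed U T ?E")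
proof (rule coenvelope_closedI)
  show "?E \<subseteq> Ob T" by blast
  show "is_zero T Z \<Longrightarrow> Z \<in> ?E" for Z
    using is_zero_noarr(1)[OF is_zero_ShO M] is_zero_ob by blast
  show "closed_under_products U T ?E"
  proof (rule closed_under_productsI)
    fix I X P p assume *: "I \<in> U" "\<And>i. i \<in> I \<Longrightarrow> X i \<in> ?E" "prod_cone I X P p"
    note Ps = prod_sh[OF *(3), of 1]
    have "f = nul M (ShO T 1 P)" if f: "f \<in> Ar M (ShO T 1 P)" for f
    proof (rule prod_eq_nul[OF Ps f])
      show "sh 1 (p i) \<bullet> f = nul M (ShO T 1 (X i))" if "i \<in> I" for i
        using *(2)[OF that] prod_proj[OF *(3) that] f noarrD[of M "ShO T 1 (X i)" "sh 1 (p i) \<bullet> f"] by simp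
    qed
    then show "P \<in> ?E" using prod_ob(1)[OF *(3)] by (simp add: noarr_def del: in_Ar)
  qed
  fix \<psi> p d \<iota> h assume hl: "holim \<psi> p d \<iota> h" and Y0: "tgt (\<psi> 0) \<in> ?E"
    and fib: "\<And>i. \<exists>k l. tri k (\<psi> i) l \<and> src k \<in> ?E"
  note D = holimD[OF hl]
  \<comment> \<open>By induction along the tower: a morphism M -> Y_{i+1}[1] dies in Y_i[1], hence
    comes from the shifted fibre, to which \<open>M\<close> has no morphisms.\<close>
  have 1: "noarr M (ShO T 1 (tgt (\<psi> i)))" for i
  proof (induction i)
    case 0 show ?case using Y0 by simp
  next
    case (Suc i)
    obtain k l where kl: "tri k (\<psi> i) l" "src k \<in> ?E" using fib by blast
    obtain l' where t: "tri (sh 1 k) (sh 1 (\<psi> i)) l'" using tri_sh[OF kl(1)] .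
    show ?case unfolding noarr_def
    proof
      fix f assume f: "f \<in> Ar M (ShO T 1 (tgt (\<psi> (Suc i))))"
      have \<psi>f: "sh 1 (\<psi> i) \<bullet> f = nul M (ShO T 1 (tgt (\<psi> i)))"
        using noarrD[OF Suc, of "sh 1 (\<psi> i) \<bullet> f"] f D(1,2)[of i] by simp
      obtain v where v: "v \<in> Ar (src f) (src (sh 1 k))" "sh 1 k \<bullet> v = f"
        by (rule tri_lift[OF t, of f]) (use \<psi>f f D(2)[of i] triD[OF kl(1)] in simp_all)
      have "v = nul M (ShO T 1 (src k))" using kl(2) v f noarrD[of M "ShO T 1 (src k)" v] by simp
      then show "f = nul M (ShO T 1 (tgt (\<psi> (Suc i))))" using v f triD[OF kl(1)] M D(2)[of i] by auto
    qed
  qed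
  \<comment> \<open>The obstruction to lifting lies in Hom(M, F[1]) for the fibre F, which is
    zero.\<close>
  have 2: "\<exists>x\<in>Ar M (tgt (\<psi> (Suc i))). \<psi> i \<bullet> x = y" if y: "y \<in> Ar M (tgt (\<psi> i))" for i y
  proof -
    obtain k l where kl: "tri k (\<psi> i) l" "src k \<in> ?E" using fib by blast
    note K = triD[OF kl(1)]
    have "l \<bullet> y = nul M (tgt l)" using kl(2) y K noarrD[of M "ShO T 1 (src k)" "l \<bullet> y"] by simp
    then obtain v where "v \<in> Ar M (tgt k)" "\<psi> i \<bullet> v = y" using tri_lift2[OF kl(1), of y] y by auto
    then show ?thesis using K D(2)[of i] by auto
  qed
  \<comment> \<open>Mittag-Leffler: the equation \<open>d \<bullet> z = y\<close> reads
    \<open>\<psi> i \<bullet> x (Suc i) = x i \<boxminus> p i \<bullet> y\<close> in components, and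
    is solved one stage at a time because every \<open>\<psi> i\<close> is onto.\<close>
  have 3: "\<exists>x\<in>Ar M (tgt \<iota>). d \<bullet> x = y" if y: "y \<in> Ar M (tgt \<iota>)" for y
  proof -
    have "\<exists>x. \<forall>i. x i \<in> Ar M (tgt (\<psi> i)) \<and> \<psi> i \<bullet> x (Suc i) = x i \<boxminus> p i \<bullet> y"
    proof (rule dependent_nat_choice)
      show "\<exists>x. x \<in> Ar M (tgt (\<psi> 0))" using M D(1)[of 0] by (intro exI[of _ "nul M (tgt (\<psi> 0))"]) simp
      show "\<exists>z. z \<in> Ar M (tgt (\<psi> (Suc i))) \<and> \<psi> i \<bullet> z = x \<boxminus> p i \<bullet> y" if "x \<in> Ar M (tgt (\<psi> i))" for x i
        using 2[of "x \<boxminus> p i \<bullet> y" i] that y D(7-9)[of i] by auto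
    qed
    then obtain x where x: "\<And>i. x i \<in> Ar M (tgt (\<psi> i))" "\<And>i. \<psi> i \<bullet> x (Suc i) = x i \<boxminus> p i \<bullet> y" by blast
    obtain z where z: "z \<in> Ar M (tgt \<iota>)" "\<forall>i\<in>UNIV. p i \<bullet> z = x i" by (rule prod_ex[OF D(3) M x(1)])
    have "d \<bullet> z = y"
    proof (rule prod_eq[OF D(3)])
      show "d \<bullet> z \<in> Ar M (tgt \<iota>)" "y \<in> Ar M (tgt \<iota>)" using D z y by simp_all
      show "p i \<bullet> (d \<bullet> z) = p i \<bullet> y" for i
        using comp_reduce[OF D(6)[of i], of z] z D x(1)[of i] x(2)[of i] y by simp
    qed
    then show ?thesis using z by blast
  qed
  \<comment> \<open>A morphism to the shifted limit is zero in the shifted product, hence comes from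
    \<open>tgt d\<close> through \<open>h\<close>; as \<open>d\<close> is onto there and
    \<open>h \<bullet> d = 0\<close>, it vanishes.\<close>
  have "noarr M (ShO T 1 (src \<iota>))" unfolding noarr_def
  proof
    fix f assume f: "f \<in> Ar M (ShO T 1 (src \<iota>))"
    have "sh 1 \<iota> \<bullet> f = nul M (ShO T 1 (tgt \<iota>))"
    proof (rule prod_eq_nul[OF prod_sh[OF D(3), of 1]])
      show "sh 1 \<iota> \<bullet> f \<in> Ar M (ShO T 1 (tgt \<iota>))" using f D by simp
      show "sh 1 (p i) \<bullet> (sh 1 \<iota> \<bullet> f) = nul M (ShO T 1 (tgt (\<psi> i)))" for i
        using noarrD[OF 1[of i]] f D by simp
    qed
    then obtain y where y: "y \<in> Ar M (tgt d)" "h \<bullet> y = f" using tri_lift3[OF D(4), of f] f D by auto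
    have "y \<in> Ar M (tgt \<iota>)" using y(1) D(5) by simp
    from 3[OF this] obtain x where x: "x \<in> Ar M (tgt \<iota>)" "d \<bullet> x = y" by blast
    show "f = nul M (ShO T 1 (src \<iota>))"
      using comp_reduce[OF tri_comp0(2)[OF D(4)], of x] x y D by auto
  qed
  then show "src \<iota> \<in> ?E" using D(10) by simp
qed

text \<open>An extension B of C by A is the homotopy limit of the tower C <- B <- B <- ..., whose
  first map has fibre A and whose other maps are identities with zero fibre.\<close>

lemma coenvelope_closed_extension:
  assumes prods: "has_products U T" and E: "coenvelope_closed U T E" "E \<subseteq> Ob T"
    and t: "tri k \<phi> l" and A: "src k \<in> E" and C: "tgt \<phi> \<in> E"
  shows "tgt k \<in> E"
proof -
  note K = triD[OF t]
  let ?B = "tgt k"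
  define \<psi> where "\<psi> i = (case i of 0 \<Rightarrow> \<phi> | Suc _ \<Rightarrow> ide ?B)" for i :: nat
  have \<psi>: "\<psi> 0 = \<phi>" "\<psi> (Suc j) = ide ?B" for j by (simp_all add: \<psi>_def)
  have \<psi>a: "arr (\<psi> i)" "src (\<psi> i) = tgt (\<psi> (Suc i))" for i using K by (cases i; simp add: \<psi>)+
  obtain p d \<iota> h where hl: "holim \<psi> p d \<iota> h" using ex_holim[of \<psi>] prods \<psi>a by blast
  note D = holimD[OF hl]
  have "src \<iota> \<in> E"
  proof (rule coenvelope_closedD[OF E hl])
    show "tgt (\<psi> 0) \<in> E" using C by (simp add: \<psi>)
    fix i show "\<exists>k l. tri k (\<psi> i) l \<and> src k \<in> E"
    proof (cases i)
      case 0 then show ?thesis using t A by (auto simp: \<psi>)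
    next
      case (Suc j)
      obtain Z where Z: "is_zero T Z" using ex_zero by blast
      have "tri (nul (ShO T (-1) Z) ?B) (ide ?B) (nul ?B Z)"
        using tri_unrot[OF tri_ide[OF _ Z, of ?B]] K is_zero_ob[OF Z] by simp
      moreover have "ShO T (-1) Z \<in> E" using coenvelope_closed_basic(1)[OF E(1)] is_zero_ShO[OF Z] by blast
      ultimately show ?thesis using Suc \<psi> by (intro exI conjI) auto
    qed
  qed
  have const: "p (Suc j) \<bullet> \<iota> = p (Suc 0) \<bullet> \<iota>" for j
  proof (induction j)
    case (Suc j) then show ?case using holim_compat[OF hl, of "Suc j"] D(7-9)[of "Suc (Suc j)"] D(10) by (simp add: \<psi>)
  qed simp
  have "iso_arr (p (Suc 0) \<bullet> \<iota>)"
  proof (rule iso_arrI)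
    show "arr (p (Suc 0) \<bullet> \<iota>)" using D by simp
    fix u assume u: "arr u" "tgt u = tgt (p (Suc 0) \<bullet> \<iota>)"
    then have uB: "tgt u = ?B" using D by (simp add: \<psi>)
    define x where "x i = (case i of 0 \<Rightarrow> \<phi> \<bullet> u | Suc _ \<Rightarrow> u)" for i :: nat
    have x: "x i \<in> Ar (src u) (tgt (\<psi> i))" "x i = \<psi> i \<bullet> x (Suc i)" for i
      using u uB K by (cases i; simp add: x_def \<psi>)+
    have So: "src u \<in> Ob T" using u by simp
    obtain y where y: "y \<in> Ar (src u) (src \<iota>)" "\<And>i. p i \<bullet> (\<iota> \<bullet> y) = x i"
      using holim_lift[OF hl So, of x] x by blast
    show "\<exists>v\<in>Ar (src u) (src (p (Suc 0) \<bullet> \<iota>)). (p (Suc 0) \<bullet> \<iota>) \<bullet> v = u"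
      using y D by (intro bexI[of _ y]) (simp_all add: x_def)
  next
    fix v assume v: "arr v" "tgt v = src (p (Suc 0) \<bullet> \<iota>)" and 0: "(p (Suc 0) \<bullet> \<iota>) \<bullet> v = nul (src v) (tgt (p (Suc 0) \<bullet> \<iota>))"
    have S: "p (Suc j) \<bullet> (\<iota> \<bullet> v) = nul (src v) ?B" for j
      using comp_reduce[OF const[of j], of v] D(7-9)[of "Suc j"] D(10) v 0 D(9)[of "Suc 0"] by (simp add: \<psi>)
    have "v = nul (src v) (src \<iota>)"
    proof (rule holim_eq_nul[OF hl])
      show "arr v" "tgt v = src \<iota>" using v by simp_all
      show "p i \<bullet> (\<iota> \<bullet> v) = nul (src v) (tgt (\<psi> i))" for i
      proof (cases i)
        case 0
        have "p 0 \<bullet> (\<iota> \<bullet> v) = \<phi> \<bullet> (p (Suc 0) \<bullet> (\<iota> \<bullet> v))"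
          using comp_reduce[OF holim_compat[OF hl, of 0], of v] D(1-2)[of 0] D(7-9)[of 0] D(7-9)[of "Suc 0"] D(10) v K by (simp add: \<psi>)
        then show ?thesis using S[of 0] 0 v K by (simp add: \<psi>)
      qed (use S in \<open>simp add: \<psi>\<close>)
      fix y assume y: "\<And>i. y i \<in> Ar (ShO T 1 (src v)) (tgt (\<psi> i))"
      let ?S = "ShO T 1 (src v)"
      \<comment> \<open>Above stage 0 the equation is
        \<open>x i \<boxminus> x (Suc i) = y i\<close>, solved by telescoping. Starting with zero at
        stage 1 leaves \<open>x 0 = y 0\<close>.\<close>
      define z where "z = rec_nat (nul ?S ?B) (\<lambda>j w. w \<boxminus> y (Suc j))"
      have zs: "z 0 = nul ?S ?B" "z (Suc j) = z j \<boxminus> y (Suc j)" for j by (simp_all add: z_def)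
      have z: "z j \<in> Ar ?S ?B" for j
      proof (induction j)
        case 0 then show ?case using zs v K by simp
      next
        case (Suc j) then show ?case using zs y[of "Suc j"] by (simp add: \<psi>)
      qed
      define x where "x i = (case i of 0 \<Rightarrow> y 0 | Suc j \<Rightarrow> z j)" for i
      have "x i \<in> Ar ?S (tgt (\<psi> i)) \<and> x i \<boxminus> \<psi> i \<bullet> x (Suc i) = y i" for i
      proof (cases i)
        case 0 then show ?thesis using y[of 0] v K by (simp add: x_def \<psi> zs)
      next
        case (Suc j) then show ?thesis using z[of j] y[of i] zs(2)[of j] by (simp add: x_def \<psi>)
      qed
      then show "\<exists>x. \<forall>i. x i \<in> Ar ?S (tgt (\<psi> i)) \<and> x i \<boxminus> \<psi> i \<bullet> x (Suc i) = y i" by blast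
    qed
    then show "v = nul (src v) (src (p (Suc 0) \<bullet> \<iota>))" by simp
  qed
  from coenvelope_closed_iso[OF E this] show ?thesis using \<open>src \<iota> \<in> E\<close> D(9)[of "Suc 0"] by (simp add: \<psi>)
qed


text \<open>A swindle: for a retract \<open>X\<close> of \<open>A\<close> with idempotent \<open>e\<close>, the fibre of the composite
  \<open>A\<^sup>\<nat> \<rightarrow> A \<rightarrow> X\<close> is isomorphic to \<open>A\<^sup>\<nat>\<close> through \<open>(a\<^sub>i) \<mapsto> ((1 - e) a\<^sub>i + e a\<^sub>i\<^sub>+\<^sub>1)\<close>.\<close>

lemma coenvelope_closed_retract:
  assumes prods: "has_products U T" and E: "coenvelope_closed U T E" "E \<subseteq> Ob T"
    and sh1: "\<And>X. X \<in> E \<Longrightarrow> ShO T 1 X \<in> E"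
  shows "retract_closed T E"
  unfolding retract_closed_iff[OF E(2)]
proof (intro allI impI)
  fix X s r assume s: "s \<in> Ar X (tgt s)" and r: "r \<in> Ar (tgt s) X" and rs: "r \<bullet> s = ide X" and AE: "tgt s \<in> E"
  define A where "A = tgt s"
  define e where "e = s \<bullet> r"
  have X: "X \<in> Ob T" and A: "A \<in> Ob T" using s Ar_ob[OF s] by (simp_all add: A_def)
  have s: "arr s" "src s = X" "tgt s = A" and r: "arr r" "src r = A" "tgt r = X" using s r by (simp_all add: A_def)
  have e: "arr e" "src e = A" "tgt e = A" using s r by (simp_all add: e_def)
  have re: "r \<bullet> e = r" using comp_reduce[OF rs, of r] s r by (simp add: e_def)
  have ee: "e \<bullet> e = e" unfolding e_def using re s r e by (simp add: e_def)
  have ee': "e \<bullet> (e \<bullet> u) = e \<bullet> u" and re': "r \<bullet> (e \<bullet> u) = r \<bullet> u" if "arr u" "tgt u = A" for u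
    using comp_reduce[OF ee] comp_reduce[OF re] that e r by simp_all
  have N: "is_small U (UNIV :: nat set)" by (simp add: is_small_countable)
  obtain P p where P: "prod_cone (UNIV :: nat set) (\<lambda>_. A) P p"
    by (rule ex_prod[OF prods N]) (rule A)
  have pp: "arr (p i)" "src (p i) = P" "tgt (p i) = A" for i using prod_proj[OF P, of i] by simp_all
  have Po: "P \<in> Ob T" by (rule prod_ob(1)[OF P])
  have PE: "P \<in> E" by (rule closed_prod[OF coenvelope_closed_basic(2)[OF E(1)] N _ P]) (use AE A_def in simp)
  define g where "g = r \<bullet> p 0"
  have g: "arr g" "src g = P" "tgt g = X" using r pp by (simp_all add: g_def)
  obtain \<iota> h where t: "tri \<iota> g h" using ex_tri_fibre[OF g(1)] .
  note I = triD[OF t]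
  have I': "tgt \<iota> = P" using I g by simp
  let ?F = "src \<iota>"
  have \<theta>0: "p i \<bullet> \<iota> \<boxminus> e \<bullet> (p i \<bullet> \<iota>) \<boxplus> e \<bullet> (p (Suc i) \<bullet> \<iota>) \<in> Ar ?F A" for i
    using pp[of i] pp[of "Suc i"] I I' e by simp
  obtain \<theta> where \<theta>: "\<theta> \<in> Ar ?F P"
    and "\<forall>i\<in>UNIV. p i \<bullet> \<theta> = p i \<bullet> \<iota> \<boxminus> e \<bullet> (p i \<bullet> \<iota>) \<boxplus> e \<bullet> (p (Suc i) \<bullet> \<iota>)"
    by (rule prod_ex[OF P _ \<theta>0]) (use I in simp)
  then have \<theta>i: "p i \<bullet> \<theta> = p i \<bullet> \<iota> \<boxminus> e \<bullet> (p i \<bullet> \<iota>) \<boxplus> e \<bullet> (p (Suc i) \<bullet> \<iota>)" for i by simp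
  have \<theta>v: "p i \<bullet> (\<theta> \<bullet> v) = p i \<bullet> (\<iota> \<bullet> v) \<boxminus> e \<bullet> (p i \<bullet> (\<iota> \<bullet> v)) \<boxplus> e \<bullet> (p (Suc i) \<bullet> (\<iota> \<bullet> v))"
    if "arr v" "tgt v = ?F" for i v
    using comp_reduce[OF \<theta>i[of i], of v] that \<theta> pp[of i] pp[of "Suc i"] e I I' by simp
  have gv: "r \<bullet> (p 0 \<bullet> (\<iota> \<bullet> v)) = nul (src v) X" if "arr v" "tgt v = ?F" for v
    using comp_reduce[OF tri_comp0(1)[OF t], of v] that g I I' pp[of 0] r X by (simp add: g_def)
  have "iso_arr \<theta>"
  proof (rule iso_arrI)
    show "arr \<theta>" using \<theta> by simp
    fix u assume u: "arr u" "tgt u = tgt \<theta>"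
    let ?S = "src u"
    have So: "?S \<in> Ob T" using u by simp
    define b where "b i = p i \<bullet> u" for i
    have b: "arr (b i)" "src (b i) = ?S" "tgt (b i) = A" for i using pp[of i] u \<theta> by (simp_all add: b_def)
    \<comment> \<open>The inverse of \<theta>: \<open>a 0 = (1 - e) b 0\<close> and
      \<open>a (j + 1) = e b j + (1 - e) b (j + 1)\<close>. Since
      \<open>e \<bullet> a 0 = 0\<close>, this family lies in the fibre of \<open>g\<close>.\<close>
    define a where "a i = (case i of 0 \<Rightarrow> b 0 \<boxminus> e \<bullet> b 0 | Suc j \<Rightarrow> e \<bullet> b j \<boxplus> (b (Suc j) \<boxminus> e \<bullet> b (Suc j)))" for i
    have a: "a i \<in> Ar ?S A" for i using b e by (cases i) (simp_all add: a_def)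
    obtain a' where a': "a' \<in> Ar ?S P" "\<forall>i\<in>UNIV. p i \<bullet> a' = a i" by (rule prod_ex[OF P So a])
    have ea0: "e \<bullet> a 0 = nul ?S A" using b[of 0] e ee' by (simp add: a_def)
    have eaS: "e \<bullet> a (Suc j) = e \<bullet> b j" for j using b e ee' A So by (simp add: a_def)
    have "g \<bullet> a' = r \<bullet> (e \<bullet> a 0)" using a' a[of 0] re' pp[of 0] r by (simp add: g_def)
    also have "\<dots> = nul ?S X" using ea0 r So by simp
    finally have ga: "g \<bullet> a' = nul (src a') (tgt g)" using a' g by simp
    obtain v where v: "v \<in> Ar (src a') ?F" "\<iota> \<bullet> v = a'"
      by (rule tri_lift[OF t, of a']) (use a' ga g I' in simp_all)
    have "\<theta> \<bullet> v = u"
    proof (rule prod_eq[OF P])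
      show "\<theta> \<bullet> v \<in> Ar ?S P" "u \<in> Ar ?S P" using \<theta> v u a' by simp_all
      fix i
      have 1: "p i \<bullet> (\<theta> \<bullet> v) = a i \<boxminus> e \<bullet> a i \<boxplus> e \<bullet> b i"
        using \<theta>v[of v i] v a' eaS[of i] by simp
      have "a i \<boxminus> e \<bullet> a i \<boxplus> e \<bullet> b i = b i"
      proof (cases i)
        case 0 then show ?thesis using ea0 b[of 0] e A So by (simp add: a_def)
      next
        case (Suc j)
        have "a i \<boxminus> e \<bullet> a i = b i \<boxminus> e \<bullet> b i"
          unfolding Suc eaS using b e add_commute[of "e \<bullet> b j" "b (Suc j) \<boxminus> e \<bullet> b (Suc j)"] A So
          by (simp add: a_def)
        then show ?thesis using b e A So by simp
      qed
      with 1 show "p i \<bullet> (\<theta> \<bullet> v) = p i \<bullet> u" by (simp add: b_def)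
    qed
    moreover have "v \<in> Ar ?S (src \<theta>)" using v a' \<theta> by simp
    ultimately show "\<exists>v\<in>Ar ?S (src \<theta>). \<theta> \<bullet> v = u" by blast
  next
    fix v assume v: "arr v" "tgt v = src \<theta>" and 0: "\<theta> \<bullet> v = nul (src v) (tgt \<theta>)"
    have vF: "tgt v = ?F" using v \<theta> by simp
    let ?S = "src v"
    have So: "?S \<in> Ob T" using v by simp
    define a where "a i = p i \<bullet> (\<iota> \<bullet> v)" for i
    have a: "arr (a i)" "src (a i) = ?S" "tgt (a i) = A" for i using pp[of i] v vF I I' by (simp_all add: a_def)
    have aeq: "a i \<boxminus> e \<bullet> a i \<boxplus> e \<bullet> a (Suc i) = nul ?S A" for i
      using \<theta>v[OF v(1) vF, of i] 0 \<theta> pp[of i] So by (simp add: a_def)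
    have eaS: "e \<bullet> a (Suc i) = nul ?S A" for i
      using arg_cong[OF aeq[of i], of "\<lambda>x. e \<bullet> x"] a[of i] a[of "Suc i"] e ee' So A by simp
    have ea0: "e \<bullet> a 0 = nul ?S A"
      using gv[OF v(1) vF] a[of 0] s r So by (simp add: e_def a_def)
    have "e \<bullet> a i = nul ?S A" for i using ea0 eaS by (cases i) simp_all
    then have "a i = nul ?S A" for i using aeq[of i] a[of i] So A by simp
    then have "\<iota> \<bullet> v = nul ?S (tgt \<iota>)"
      unfolding I' by (intro prod_eq_nul[OF P]) (use I v vF I' a_def in simp_all)
    \<comment> \<open>\<iota> is injective on morphisms because \<open>g\<close> is a split
      epimorphism: \<open>y\<close> is hit by \<open>s \<bullet> y\<close> placed in the factor
      0.\<close>
    then have "v = nul ?S ?F"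
    proof (rule tri_mono[OF t v(1) vF])
      fix y assume y: "y \<in> Ar (ShO T 1 (src v)) (tgt g)"
      have \<sigma>0: "(if i = 0 then s \<bullet> y else nul (src y) A) \<in> Ar (src y) A" for i :: nat
        using y s g A Ar_ob[OF y] by simp
      obtain \<sigma> where \<sigma>: "\<sigma> \<in> Ar (src y) P" "\<forall>i\<in>UNIV. p i \<bullet> \<sigma> = (if i = 0 then s \<bullet> y else nul (src y) A)"
        by (rule prod_ex[OF P _ \<sigma>0]) (use y v in simp)
      have "g \<bullet> \<sigma> = y" using \<sigma> comp_reduce[OF rs, of y] y s r pp[of 0] g by (simp add: g_def)
      then show "\<exists>x\<in>Ar (ShO T 1 (src v)) (tgt \<iota>). g \<bullet> x = y"
        using \<sigma> y I' by (intro bexI[of _ \<sigma>]) simp_all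
    qed
    then show "v = nul (src v) (src \<theta>)" using \<theta> by simp
  qed
  then have "?F \<in> E" using coenvelope_closed_iso[OF E, of \<theta>] PE \<theta> by simp
  \<comment> \<open>Rotation makes \<open>X\<close> an extension of F[1] by \<open>P\<close>; this
    is where closure under the positive shift enters.\<close>
  then have "ShO T 1 ?F \<in> E" by (rule sh1)
  then show "X \<in> E" using coenvelope_closed_extension[OF prods E tri_rot[OF t]] PE g I by simp
qed

text \<open>An idempotent \<open>e\<close> is split by the homotopy limit of X <- X <- ... with all
  maps \<open>e\<close>. The projection to stage 0 is \<open>s\<close>, and the constant family
  \<open>e\<close>, compatible since \<open>e \<bullet> e = e\<close>, lifts to \<open>r\<close>.
  Then \<open>s \<bullet> r = e\<close> is immediate, while \<open>r \<bullet> s = 1\<close> needs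
  that \<open>s\<close> is injective on morphisms.\<close>

lemma karoubianI: assumes prods: "has_products U T" shows "karoubian T"
  unfolding karoubian_def
proof (intro ballI impI)
  fix X e0 assume X: "X \<in> Ob T" and e0: "e0 \<in> Hom T X X" "e0 \<cdot> e0 = e0"
  define e where "e = Arrow X e0 X"
  have e: "arr e" "src e = X" "tgt e = X" using X e0 by (simp_all add: e_def)
  have ee: "e \<bullet> e = e" using e0 by (simp add: e_def comp_def)
  have ee': "e \<bullet> (e \<bullet> u) = e \<bullet> u" if "arr u" "tgt u = X" for u
    using comp_reduce[OF ee] that e by simp
  obtain p d \<iota> h where hl: "holim (\<lambda>_. e) p d \<iota> h" 
    by (rule ex_holim[OF prods, of "\<lambda>_. e"]) (use e in simp_all)
  note D = holimD[OF hl]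
  have pp: "arr (p i)" "src (p i) = tgt \<iota>" "tgt (p i) = X" for i using D(7-9)[of i] e by simp_all
  define s where "s = p 0 \<bullet> \<iota>"
  have s: "arr s" "src s = src \<iota>" "tgt s = X" using pp[of 0] D(10) by (simp_all add: s_def)
  have epi: "e \<bullet> (p i \<bullet> \<iota>) = p i \<bullet> \<iota>" for i
    using holim_compat[OF hl, of i] ee' pp[of "Suc i"] D(10) by simp
  have const: "p i \<bullet> \<iota> = s" for i
  proof (induction i)
    case (Suc i) then show ?case using holim_compat[OF hl, of i] epi by simp
  qed (simp add: s_def)
  obtain r where r: "r \<in> Ar X (src \<iota>)" "\<And>i. p i \<bullet> (\<iota> \<bullet> r) = e"
    using holim_lift[OF hl X, of "\<lambda>_. e"] e ee by auto
  have sr: "s \<bullet> r = e" using r pp[of 0] D(10) by (simp add: s_def)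
  have es: "e \<bullet> s = s" using epi[of 0] by (simp add: s_def)
  have inj: "v = nul (src v) (src \<iota>)" if v: "arr v" "tgt v = src \<iota>" and 0: "s \<bullet> v = nul (src v) X" for v
  proof (rule holim_eq_nul[OF hl v])
    show "p i \<bullet> (\<iota> \<bullet> v) = nul (src v) (tgt e)" for i
      using comp_reduce[OF const[of i], of v] v 0 pp[of i] D(10) e by simp
    let ?S = "ShO T 1 (src v)"
    have So: "?S \<in> Ob T" using v by simp
    fix y :: "nat \<Rightarrow> ('o, 'm) arrow" assume "\<And>i. y i \<in> Ar ?S (tgt e)"
    then have y: "arr (y i)" "src (y i) = ?S" "tgt (y i) = X" for i using e by auto
    \<comment> \<open>The derived limit of an idempotent tower vanishes: the part of
      \<open>y i\<close> killed by \<open>e\<close> is its own solution, and on the image of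
      \<open>e\<close> the tower is constant, so \<open>z\<close> telescopes.\<close>
    define z where "z = rec_nat (nul ?S X) (\<lambda>j w. w \<boxminus> e \<bullet> y j)"
    have zs: "z 0 = nul ?S X" "z (Suc j) = z j \<boxminus> e \<bullet> y j" for j by (simp_all add: z_def)
    have z: "z j \<in> Ar ?S X \<and> e \<bullet> z j = z j" for j
    proof (induction j)
      case 0 then show ?case using zs e X So by simp
    next
      case (Suc j) then show ?case using zs y[of j] e ee' by simp
    qed
    have "(y i \<boxminus> e \<bullet> y i) \<boxplus> z i \<in> Ar ?S (tgt e)
        \<and> ((y i \<boxminus> e \<bullet> y i) \<boxplus> z i) \<boxminus> e \<bullet> ((y (Suc i) \<boxminus> e \<bullet> y (Suc i)) \<boxplus> z (Suc i)) = y i" for i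
    proof
      show "(y i \<boxminus> e \<bullet> y i) \<boxplus> z i \<in> Ar ?S (tgt e)" using y[of i] z[of i] e by simp
      have "e \<bullet> ((y (Suc i) \<boxminus> e \<bullet> y (Suc i)) \<boxplus> z (Suc i)) = z (Suc i)"
        using y[of "Suc i"] z[of "Suc i"] e ee' So X by simp
      also have "\<dots> = z i \<boxminus> e \<bullet> y i" by (rule zs)
      finally show "((y i \<boxminus> e \<bullet> y i) \<boxplus> z i) \<boxminus> e \<bullet> ((y (Suc i) \<boxminus> e \<bullet> y (Suc i)) \<boxplus> z (Suc i)) = y i"
        using y[of i] z[of i] e So X by simp
    qed
    then show "\<exists>x. \<forall>i. x i \<in> Ar ?S (tgt e) \<and> x i \<boxminus> e \<bullet> x (Suc i) = y i"
      by (intro exI[of _ "\<lambda>i. (y i \<boxminus> e \<bullet> y i) \<boxplus> z i"]) blast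
  qed
  have "s \<bullet> (r \<bullet> s \<boxminus> ide (src \<iota>)) = nul (src \<iota>) X"
    using comp_reduce[OF sr, of s] es s r D(10) by simp
  then have "r \<bullet> s \<boxminus> ide (src \<iota>) = nul (src \<iota>) (src \<iota>)"
    using inj[of "r \<bullet> s \<boxminus> ide (src \<iota>)"] s r D(10) by simp
  then have rs: "r \<bullet> s = ide (src \<iota>)" using add_eq_iff[of "r \<bullet> s" "ide (src \<iota>)"] s r D(10) by simp
  have "mor r \<cdot> mor s = Idm T (src \<iota>)" using arg_cong[OF rs, of mor] by simp
  moreover have "mor s \<cdot> mor r = e0" using arg_cong[OF sr, of mor] by (simp add: e_def)
  moreover have "mor s \<in> Hom T (src \<iota>) X" "mor r \<in> Hom T X (src \<iota>)" "src \<iota> \<in> Ob T"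
    using arr_hom[of s] arr_hom[of r] s r D(10) by simp_all
  ultimately show "\<exists>Y\<in>Ob T. \<exists>s\<in>Hom T Y X. \<exists>r\<in>Hom T X Y. r \<cdot> s = Idm T Y \<and> s \<cdot> r = e0"
    by blast
qed


section \<open>Cocompact objects\<close>

text \<open>Cocompactness says that a morphism from a product is a finite sum of morphisms through
  single factors; as an induction rule this hides the group-theoretic sum. The shift
  \<open>n\<close> is built in, by passing to P[-n], so that the rule serves all shifts of
  \<open>c\<close>.\<close>

lemma cocompact_induct:
  assumes c: "cocompact U T c" and J: "is_small U J" and P: "prod_cone J Y P p" and g: "g \<in> Ar P (ShO T n c)"
    and zero: "Q (nul P (ShO T n c))"
    and add: "\<And>a b. a \<in> Ar P (ShO T n c) \<Longrightarrow> b \<in> Ar P (ShO T n c) \<Longrightarrow> Q a \<Longrightarrow> Q b \<Longrightarrow> Q (a \<boxplus> b)"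
    and base: "\<And>j f. j \<in> J \<Longrightarrow> f \<in> Ar (Y j) (ShO T n c) \<Longrightarrow> Q (f \<bullet> p j)"
  shows "Q g"
proof -
  obtain I where I: "I \<in> U" "J \<approx> I" using J by (auto simp: is_small_def)
  obtain k where k: "bij_betw k I J" using I(2) eqpoll_def eqpoll_sym by blast
  have kJ: "i \<in> I \<Longrightarrow> k i \<in> J" for i using k by (auto simp: bij_betw_def)
  define P' where "P' = ShO T (-n) P"
  define Y' where "Y' i = ShO T (-n) (Y (k i))" for i
  define p' where "p' i = sh (-n) (p (k i))" for i
  have cO: "c \<in> Ob T" using c by (simp add: cocompact_def)
  have PO: "P \<in> Ob T" by (rule prod_ob(1)[OF P])
  have P'O: "P' \<in> Ob T" using PO by (simp add: P'_def)
  have P': "prod_cone I Y' P' p'"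
    unfolding P'_def Y'_def p'_def by (rule prod_sh[OF prod_reindex[OF k P]])
  have pk: "arr (p (k i))" "src (p (k i)) = P" "tgt (p (k i)) = Y (k i)" if "i \<in> I" for i
    using prod_proj[OF P kJ[OF that]] .
  have pp: "arr (p' i)" "src (p' i) = P'" "tgt (p' i) = Y' i" if "i \<in> I" for i
    using prod_proj[OF P' that] .
  have Y'O: "i \<in> I \<Longrightarrow> Y' i \<in> Ob T" for i using pp(1,3) arr_ob(2) by metis
  let ?G = "Defs.hom_group T P' c"
  interpret G: comm_group ?G by (rule hom_group[OF P'O cO])
  let ?S = "sum_group I (\<lambda>i. Defs.hom_group T (Y' i) c)"
  have "(\<lambda>f. gfinprod ?G (\<lambda>i. f i \<cdot> mor (p' i)) I) \<in> iso ?S ?G"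
    using c I(1) is_product_of_prod_cone[OF P'] by (auto simp: cocompact_def)
  then have "(\<lambda>f. gfinprod ?G (\<lambda>i. f i \<cdot> mor (p' i)) I) ` carrier ?S = carrier ?G"
    by (simp add: iso_def bij_betw_def)
  moreover have "mor (sh (-n) g) \<in> carrier ?G"
    using arr_hom[of "sh (-n) g"] g cO PO by (simp add: hom_group_simps P'_def)
  ultimately obtain f where f: "f \<in> carrier ?S"
    and gf: "mor (sh (-n) g) = gfinprod ?G (\<lambda>i. f i \<cdot> mor (p' i)) I" by (metis (no_types, lifting) imageE)
  have grp: "i \<in> I \<Longrightarrow> group (Defs.hom_group T (Y' i) c)" for i
    using hom_group[OF Y'O cO] comm_group.axioms(2) by blast
  have fi: "f i \<in> Hom T (Y' i) c" if "i \<in> I" for i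
  proof -
    have "f \<in> (\<Pi>\<^sub>E i\<in>I. carrier (Defs.hom_group T (Y' i) c))"
      using f carrier_sum_group[of I "\<lambda>i. Defs.hom_group T (Y' i) c"] grp by auto
    then show ?thesis using that by (auto simp: hom_group_simps PiE_iff)
  qed
  have fp: "f i \<cdot> mor (p' i) \<in> Hom T P' c" if "i \<in> I" for i
    using arr_hom[of "Arrow (Y' i) (f i) c \<bullet> p' i"] fi[OF that] pp[OF that] Y'O[OF that] cO by simp
  have fin: "finprod ?G (\<lambda>i. f i \<cdot> mor (p' i)) B \<in> Hom T P' c \<and>
      Q (sh n (Arrow P' (finprod ?G (\<lambda>i. f i \<cdot> mor (p' i)) B) c))" if "finite B" "B \<subseteq> I" for B
    using that
  proof (induction B rule: finite_induct)
    case empty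
    have "sh n (Arrow P' (Zero T P' c) c) = nul P (ShO T n c)"
      using sh_nul[OF P'O cO, of n] PO by (simp add: nul_def P'_def)
    then show ?case using zero Hom_group_laws(1)[OF P'O cO] by (simp add: hom_group_simps)
  next
    case (insert i B)
    let ?r = "finprod ?G (\<lambda>i. f i \<cdot> mor (p' i)) B"
    have i: "i \<in> I" using insert by simp
    have "finprod ?G (\<lambda>i. f i \<cdot> mor (p' i)) (insert i B) = Add T (f i \<cdot> mor (p' i)) ?r"
    proof -
      have "(\<lambda>i. f i \<cdot> mor (p' i)) \<in> B \<rightarrow> carrier ?G" "f i \<cdot> mor (p' i) \<in> carrier ?G"
        using insert.prems fp i by (auto simp: hom_group_simps)
      from G.finprod_insert[OF insert.hyps(1,2) this] show ?thesis by (simp add: hom_group_simps)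
    qed
    moreover have r: "?r \<in> Hom T P' c" and Qr: "Q (sh n (Arrow P' ?r c))" using insert by simp_all
    define fa where "fa = Arrow (Y' i) (f i) c"
    have fa: "arr fa" "src fa = Y' i" "tgt fa = c" using fi[OF i] Y'O[OF i] cO by (simp_all add: fa_def)
    have "sh n (Arrow P' (Add T (f i \<cdot> mor (p' i)) ?r) c) = sh n (fa \<bullet> p' i) \<boxplus> sh n (Arrow P' ?r c)"
    proof -
      have "Arrow P' (Add T (f i \<cdot> mor (p' i)) ?r) c = fa \<bullet> p' i \<boxplus> Arrow P' ?r c"
        using pp[OF i] by (intro arrow_eqI) (simp_all add: fa_def)
      then show ?thesis using fa pp[OF i] r P'O cO by simp
    qed
    moreover have "sh n (fa \<bullet> p' i) = sh n fa \<bullet> p (k i)"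
      using fa pp[OF i] pk[OF i] by (simp add: p'_def)
    moreover have "Q (sh n fa \<bullet> p (k i))"
      by (rule base[OF kJ[OF i]]) (use fa prod_ob(2)[OF P kJ[OF i]] in \<open>simp add: Y'_def\<close>)
    moreover have "sh n fa \<bullet> p (k i) \<in> Ar P (ShO T n c)" "sh n (Arrow P' ?r c) \<in> Ar P (ShO T n c)"
      using fa pk[OF i] r P'O cO PO prod_ob(2)[OF P kJ[OF i]] by (simp_all add: Y'_def P'_def)
    moreover have "Add T (f i \<cdot> mor (p' i)) ?r \<in> Hom T P' c"
      by (rule Hom_group_laws(2)[OF P'O cO fp[OF i] r])
    ultimately show ?case using add Qr by simp
  qed
  have "Q (sh n (Arrow P' (gfinprod ?G (\<lambda>i. f i \<cdot> mor (p' i)) I) c))"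
  \<comment> \<open>Outside finite support \<open>gfinprod\<close> is by definition the neutral
    element, that is, the empty sum.\<close>
  proof (cases "finite {i \<in> I. f i \<cdot> mor (p' i) \<noteq> one ?G}")
    case True
    then show ?thesis using fin[of "{i \<in> I. f i \<cdot> mor (p' i) \<noteq> one ?G}"] by (simp add: gfinprod_def)
  next
    case False
    then show ?thesis using fin[of "{}"] by (simp add: gfinprod_def)
  qed
  moreover have "sh n (Arrow P' (mor (sh (-n) g)) c) = g"
  proof -
    have "Arrow P' (mor (sh (-n) g)) c = sh (-n) g" using g cO by (intro arrow_eqI) (simp_all add: P'_def)
    then show ?thesis using g by simp
  qed
  ultimately show ?thesis using gf by simp
qed

lemma cocompact_noarr_product:
  assumes c: "cocompact U T c" and J: "is_small U J" and P: "prod_cone J Y P p"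
    and Y: "\<And>j. j \<in> J \<Longrightarrow> noarr (Y j) (ShO T n c)"
  shows "noarr P (ShO T n c)"
  unfolding noarr_def
proof
  have cO: "ShO T n c \<in> Ob T" using c by (simp add: cocompact_def)
  have PO: "P \<in> Ob T" by (rule prod_ob(1)[OF P])
  fix g assume g: "g \<in> Ar P (ShO T n c)"
  show "g = nul P (ShO T n c)"
  proof (rule cocompact_induct[OF c J P g, of "\<lambda>g. g = nul P (ShO T n c)"])
    show "f \<bullet> p j = nul P (ShO T n c)" if "j \<in> J" "f \<in> Ar (Y j) (ShO T n c)" for j f
      using noarrD[OF Y[OF that(1)], of f] that(2) prod_proj[OF P that(1)] cO by simp
  qed (use PO cO in simp_all)
qed

text \<open>With \<open>t N\<close> the projection of \<open>\<Prod> Y\<^sub>i\<close> onto its first \<open>N\<close> factors, every morphism \<open>g\<close> from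
  \<open>\<Prod> Y\<^sub>i\<close> to a cocompact object satisfies \<open>g = g \<circ> t N\<close> for large \<open>N\<close>; hence \<open>g \<circ> d = 0\<close> implies \<open>g = 0\<close>.\<close>

lemma holim_cocompact_factor:
  assumes c: "cocompact U T c" and hl: "holim \<psi> p d \<iota> h" and u: "u \<in> Ar (src \<iota>) (ShO T n c)"
  shows "\<exists>k. \<exists>f\<in>Ar (tgt (\<psi> k)) (ShO T n c). u = f \<bullet> (p k \<bullet> \<iota>)"
proof -
  note D = holimD[OF hl]
  define P where "P = tgt \<iota>"
  define Y where "Y = (\<lambda>i. tgt (\<psi> i))"
  have P: "prod_cone UNIV Y P p" using D(3) by (simp add: P_def Y_def)
  have pp: "arr (p i)" "src (p i) = P" "tgt (p i) = Y i" for i using prod_proj[OF P, of i] by simp_all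
  have \<psi>: "arr (\<psi> i)" "src (\<psi> i) = Y (Suc i)" "tgt (\<psi> i) = Y i" for i using D(1,2)[of i] by (simp_all add: Y_def)
  have d: "arr d" "src d = P" "tgt d = P" using D by (simp_all add: P_def)
  have pd: "p i \<bullet> d = p i \<boxminus> \<psi> i \<bullet> p (Suc i)" for i by (rule D(6))
  have \<iota>: "arr \<iota>" "tgt \<iota> = P" using D by (simp_all add: P_def)
  have PO: "P \<in> Ob T" by (rule prod_ob(1)[OF P])
  have YO: "Y i \<in> Ob T" for i using pp[of i] arr_ob(2)[of "p i"] by simp
  have cO: "ShO T m c \<in> Ob T" for m using c by (simp add: cocompact_def)
  have N: "is_small U (UNIV :: nat set)" by (simp add: is_small_countable)
  have "\<exists>t\<in>Ar P P. \<forall>i\<in>UNIV. p i \<bullet> t = (if i < N then p i else nul P (Y i))" for N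
  proof -
    have "(if i < N then p i else nul P (Y i)) \<in> Ar P (Y i)" for i using pp[of i] PO YO by simp
    from prod_ex[OF P PO this] show ?thesis by blast
  qed
  then obtain t where t: "\<And>N. t N \<in> Ar P P" and "\<And>N. \<forall>i\<in>UNIV. p i \<bullet> t N = (if i < N then p i else nul P (Y i))"
    by metis
  then have pt: "p i \<bullet> t N = (if i < N then p i else nul P (Y i))" for i N by simp
  \<comment> \<open>The inclusion of the factor \<open>N\<close> into the product, used to write
    \<open>t (Suc N)\<close> as \<open>t N \<boxplus> j N \<bullet> p N\<close>.\<close>
  have "\<exists>j\<in>Ar (Y N) P. \<forall>i\<in>UNIV. p i \<bullet> j = (if i = N then ide (Y N) else nul (Y N) (Y i))" for N
  proof -
    have "(if i = N then ide (Y N) else nul (Y N) (Y i)) \<in> Ar (Y N) (Y i)" for i using YO by simp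
    from prod_ex[OF P YO this] show ?thesis by blast
  qed
  then obtain j where j: "\<And>N. j N \<in> Ar (Y N) P"
    and "\<And>N. \<forall>i\<in>UNIV. p i \<bullet> j N = (if i = N then ide (Y N) else nul (Y N) (Y i))" by metis
  then have pj: "p i \<bullet> j N = (if i = N then ide (Y N) else nul (Y N) (Y i))" for i N by simp
  have t0: "t 0 = nul P P" by (rule prod_eq_nul[OF P t]) (simp add: pt)
  have tS: "t (Suc N) = t N \<boxplus> j N \<bullet> p N" for N
  proof (rule prod_eq[OF P t])
    show "t N \<boxplus> j N \<bullet> p N \<in> Ar P P" using t[of N] j[of N] pp[of N] by simp
    fix i
    have "p i \<bullet> (t N \<boxplus> j N \<bullet> p N) = p i \<bullet> t N \<boxplus> (p i \<bullet> j N) \<bullet> p N"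
      using t[of N] j[of N] pp[of N] pp[of i] by simp
    also have "\<dots> = p i \<bullet> t (Suc N)"
      unfolding pt pj using pp[of N] pp[of i] YO PO by (cases "i = N"; cases "i < N") simp_all
    finally show "p i \<bullet> t (Suc N) = p i \<bullet> (t N \<boxplus> j N \<bullet> p N)" by simp
  qed
  have dj0: "d \<bullet> j 0 = j 0"
  proof (rule prod_eq[OF P])
    show "d \<bullet> j 0 \<in> Ar (Y 0) P" "j 0 \<in> Ar (Y 0) P" using d j[of 0] by simp_all
    fix i
    have "p i \<bullet> (d \<bullet> j 0) = p i \<bullet> j 0 \<boxminus> \<psi> i \<bullet> (p (Suc i) \<bullet> j 0)"
      using comp_reduce[OF pd[of i], of "j 0"] d j[of 0] pp[of i] pp[of "Suc i"] \<psi>[of i] by simp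
    also have "\<dots> = p i \<bullet> j 0" using pp[of i] j[of 0] \<psi>[of i] YO by (simp add: pj)
    finally show "p i \<bullet> (d \<bullet> j 0) = p i \<bullet> j 0" .
  qed
  have djS: "d \<bullet> j (Suc k) = j (Suc k) \<boxminus> j k \<bullet> \<psi> k" for k
  proof (rule prod_eq[OF P])
    show "d \<bullet> j (Suc k) \<in> Ar (Y (Suc k)) P" "j (Suc k) \<boxminus> j k \<bullet> \<psi> k \<in> Ar (Y (Suc k)) P"
      using d j[of "Suc k"] j[of k] \<psi>[of k] by simp_all
    fix i
    have "p i \<bullet> (d \<bullet> j (Suc k)) = p i \<bullet> j (Suc k) \<boxminus> \<psi> i \<bullet> (p (Suc i) \<bullet> j (Suc k))"
      using comp_reduce[OF pd[of i], of "j (Suc k)"] d j[of "Suc k"] pp[of i] pp[of "Suc i"] \<psi>[of i] by simp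
    moreover have "p i \<bullet> (j (Suc k) \<boxminus> j k \<bullet> \<psi> k) = p i \<bullet> j (Suc k) \<boxminus> (p i \<bullet> j k) \<bullet> \<psi> k"
      using j[of "Suc k"] j[of k] \<psi>[of k] pp[of i] by simp
    moreover have "\<psi> i \<bullet> (p (Suc i) \<bullet> j (Suc k)) = (p i \<bullet> j k) \<bullet> \<psi> k"
      unfolding pj using \<psi>[of i] \<psi>[of k] YO by (cases "i = k") simp_all
    ultimately show "p i \<bullet> (d \<bullet> j (Suc k)) = p i \<bullet> (j (Suc k) \<boxminus> j k \<bullet> \<psi> k)" by simp
  qed
  \<comment> \<open>From \<open>d \<bullet> j (Suc k) = j (Suc k) \<boxminus> j k \<bullet> \<psi>
    k\<close> and \<open>d \<bullet> j 0 = j 0\<close>, induction gives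
    \<open>g \<bullet> j k = 0\<close> for all \<open>k\<close>, hence
    \<open>g \<bullet> t N = 0\<close> for all \<open>N\<close>.\<close>
  have vanish: "g = nul P (ShO T m c)" if g: "g \<in> Ar P (ShO T m c)" and gd: "g \<bullet> d = nul P (ShO T m c)" for g m
  proof -
    have gj: "g \<bullet> j k = nul (Y k) (ShO T m c)" for k
    proof (induction k)
      case 0
      show ?case using comp_reduce[OF gd, of "j 0"] dj0 g d j[of 0] cO by simp
    next
      case (Suc k)
      have "nul (Y (Suc k)) (ShO T m c) = g \<bullet> (d \<bullet> j (Suc k))"
        using comp_reduce[OF gd, of "j (Suc k)"] g d j[of "Suc k"] cO by simp
      also have "\<dots> = g \<bullet> j (Suc k) \<boxminus> (g \<bullet> j k) \<bullet> \<psi> k"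
        unfolding djS using g j[of "Suc k"] j[of k] \<psi>[of k] by simp
      also have "\<dots> = g \<bullet> j (Suc k)" unfolding Suc using g j[of "Suc k"] \<psi>[of k] cO YO by simp
      finally show ?case by simp
    qed
    have gt: "g \<bullet> t N = nul P (ShO T m c)" for N
    proof (induction N)
      case 0 then show ?case using t0 g PO by simp
    next
      case (Suc N)
      have "g \<bullet> t (Suc N) = g \<bullet> t N \<boxplus> (g \<bullet> j N) \<bullet> p N"
        unfolding tS using g t[of N] j[of N] pp[of N] by simp
      then show ?case unfolding Suc gj using pp[of N] cO PO by simp
    qed
    have "\<exists>N. \<forall>M\<ge>N. g \<bullet> t M = g"
    proof (rule cocompact_induct[OF c N P g])
      show "\<exists>N. \<forall>M\<ge>N. nul P (ShO T m c) \<bullet> t M = nul P (ShO T m c)"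
        using t cO by auto
      show "\<exists>N. \<forall>M\<ge>N. (a \<boxplus> b) \<bullet> t M = a \<boxplus> b" if a: "a \<in> Ar P (ShO T m c)" and b: "b \<in> Ar P (ShO T m c)"
        and ab: "\<exists>N. \<forall>M\<ge>N. a \<bullet> t M = a" "\<exists>N. \<forall>M\<ge>N. b \<bullet> t M = b" for a b
      proof -
        obtain N N' where "\<forall>M\<ge>N. a \<bullet> t M = a" "\<forall>M\<ge>N'. b \<bullet> t M = b" using ab by blast
        then have "\<forall>M\<ge>max N N'. (a \<boxplus> b) \<bullet> t M = a \<boxplus> b" using a b t by auto
        then show ?thesis by blast
      qed
      show "\<exists>N. \<forall>M\<ge>N. (f \<bullet> p i) \<bullet> t M = f \<bullet> p i" if "f \<in> Ar (Y i) (ShO T m c)" for i f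
      proof (intro exI[of _ "Suc i"] allI impI)
        fix M assume "Suc i \<le> M"
        then show "(f \<bullet> p i) \<bullet> t M = f \<bullet> p i" using that pp[of i] t[of M] pt[of i M] by simp
      qed
    qed
    then show ?thesis using gt by auto
  qed
  have su: "arr (sh 1 u)" "src (sh 1 u) = ShO T 1 (src \<iota>)" "tgt (sh 1 u) = ShO T (1 + n) c"
    using u c by (simp_all add: cocompact_def)
  \<comment> \<open>This composite is the obstruction to extending \<open>u\<close> along \<iota> to
    the product. It is killed by \<open>d\<close> because \<open>h \<bullet> d = 0\<close>, so it
    vanishes.\<close>
  have "sh 1 u \<bullet> h = nul P (ShO T (1 + n) c)"
  proof (rule vanish)
    show "sh 1 u \<bullet> h \<in> Ar P (ShO T (1 + n) c)" using su D by (simp add: P_def)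
    show "(sh 1 u \<bullet> h) \<bullet> d = nul P (ShO T (1 + n) c)"
      using su D tri_comp0(2)[OF D(4)] by (simp add: P_def)
  qed
  then have suh: "sh 1 u \<bullet> h = nul (tgt d) (tgt (sh 1 u))" using su d by simp
  obtain v where v: "v \<in> Ar (ShO T 1 (tgt \<iota>)) (tgt (sh 1 u))" "v \<bullet> sh 1 \<iota> = sh 1 u"
    by (rule tri_extend3[OF D(4), of "sh 1 u"]) (use su D suh in simp_all)
  define g where "g = sh (-1) v"
  have g: "g \<in> Ar P (ShO T n c)" using v u \<iota> c PO by (simp add: g_def cocompact_def)
  have "g \<bullet> \<iota> = u"
    using sh_inj[of "g \<bullet> \<iota>" u 1] g u v \<iota> by (simp add: g_def)
  \<comment> \<open>Asked for all late stages, so that two factorisations can be moved to a common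
    stage and added.\<close>
  have "\<exists>k. \<forall>m\<ge>k. \<exists>f\<in>Ar (Y m) (ShO T n c). g \<bullet> \<iota> = f \<bullet> (p m \<bullet> \<iota>)"
  proof (rule cocompact_induct[OF c N P g])
    show "\<exists>k. \<forall>m\<ge>k. \<exists>f\<in>Ar (Y m) (ShO T n c). nul P (ShO T n c) \<bullet> \<iota> = f \<bullet> (p m \<bullet> \<iota>)"
    proof (intro exI[of _ 0] allI impI)
      fix m show "\<exists>f\<in>Ar (Y m) (ShO T n c). nul P (ShO T n c) \<bullet> \<iota> = f \<bullet> (p m \<bullet> \<iota>)"
        using pp[of m] \<iota> YO cO by (intro bexI[of _ "nul (Y m) (ShO T n c)"]) simp_all
    qed
    show "\<exists>k. \<forall>m\<ge>k. \<exists>f\<in>Ar (Y m) (ShO T n c). (a \<boxplus> b) \<bullet> \<iota> = f \<bullet> (p m \<bullet> \<iota>)"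
      if a: "a \<in> Ar P (ShO T n c)" and b: "b \<in> Ar P (ShO T n c)"
        and ab: "\<exists>k. \<forall>m\<ge>k. \<exists>f\<in>Ar (Y m) (ShO T n c). a \<bullet> \<iota> = f \<bullet> (p m \<bullet> \<iota>)"
        "\<exists>k. \<forall>m\<ge>k. \<exists>f\<in>Ar (Y m) (ShO T n c). b \<bullet> \<iota> = f \<bullet> (p m \<bullet> \<iota>)" for a b
    proof -
      from ab obtain k k' where k: "\<forall>m\<ge>k. \<exists>f\<in>Ar (Y m) (ShO T n c). a \<bullet> \<iota> = f \<bullet> (p m \<bullet> \<iota>)"
        "\<forall>m\<ge>k'. \<exists>f\<in>Ar (Y m) (ShO T n c). b \<bullet> \<iota> = f \<bullet> (p m \<bullet> \<iota>)" by (elim exE)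
      show ?thesis
      proof (intro exI[of _ "max k k'"] allI impI)
        fix m assume "max k k' \<le> m"
        then obtain f f' where f: "f \<in> Ar (Y m) (ShO T n c)" "f' \<in> Ar (Y m) (ShO T n c)"
          "a \<bullet> \<iota> = f \<bullet> (p m \<bullet> \<iota>)" "b \<bullet> \<iota> = f' \<bullet> (p m \<bullet> \<iota>)"
          using k(1)[rule_format, of m] k(2)[rule_format, of m] unfolding max.bounded_iff by blast
        then show "\<exists>f\<in>Ar (Y m) (ShO T n c). (a \<boxplus> b) \<bullet> \<iota> = f \<bullet> (p m \<bullet> \<iota>)"
          using a b pp[of m] \<iota> by (intro bexI[of _ "f \<boxplus> f'"]) simp_all
      qed
    qed
    show "\<exists>k. \<forall>m\<ge>k. \<exists>f\<in>Ar (Y m) (ShO T n c). (f' \<bullet> p i) \<bullet> \<iota> = f \<bullet> (p m \<bullet> \<iota>)"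
      if f': "f' \<in> Ar (Y i) (ShO T n c)" for i f'
    proof (intro exI[of _ i] allI impI)
      fix m assume "i \<le> m"
      from holim_compat_le[OF hl this] obtain w where w: "w \<in> Ar (Y m) (Y i)" "p i \<bullet> \<iota> = w \<bullet> (p m \<bullet> \<iota>)"
        unfolding Y_def by blast
      then show "\<exists>f\<in>Ar (Y m) (ShO T n c). (f' \<bullet> p i) \<bullet> \<iota> = f \<bullet> (p m \<bullet> \<iota>)"
        using f' pp[of i] pp[of m] \<iota> by (intro bexI[of _ "f' \<bullet> w"]) simp_all
    qed
  qed
  then show ?thesis unfolding \<open>g \<bullet> \<iota> = u\<close> Y_def by blast
qed


section \<open>Weight decompositions\<close>

text \<open>Inductively let \<open>M (k + 1)\<close> be the fibre of an approximation \<open>M k \<rightarrow> Q k\<close>, and \<open>A k\<close> the cone of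
  \<open>M k \<rightarrow> M\<close>; the fibre of a lift of \<open>M \<rightarrow> (A k)\<close> to the homotopy limit of the \<open>A k\<close> is the first term of the
  decomposition.  Working with the limit of the \<open>A k\<close>, not of the \<open>M k\<close>, avoids comparing two homotopy limits.\<close>

lemma ex_decomposition:
  assumes prods: "has_products U T" and E: "coenvelope_closed U T E" "E \<subseteq> Ob T"
    and C: "\<And>c. c \<in> C \<Longrightarrow> \<exists>c0 n. cocompact U T c0 \<and> c = ShO T n c0"
    and approx: "\<And>M. M \<in> Ob T \<Longrightarrow> \<exists>q. arr q \<and> src q = M \<and> tgt q \<in> E \<and>
      (\<forall>c\<in>C. \<forall>f\<in>Ar M c. \<exists>f'\<in>Ar (tgt q) c. f = f' \<bullet> q)"
    and M: "M \<in> Ob T"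
  obtains b a e where "tri b a e" "tgt b = M" "tgt a \<in> E" "\<And>c. c \<in> C \<Longrightarrow> noarr (src b) c"
proof -
  \<comment> \<open>A state is the triangle M_k -> M -> A_k. \<open>R\<close> relates consecutive
    states: \<open>n\<close> maps M_{k+1} to M_k and kills every morphism from M_k to an object of
    \<open>C\<close>, and \<phi> maps A_{k+1} to A_k with fibre in \<open>E\<close>.\<close>
  define R where "R st st' \<longleftrightarrow> (\<exists>n \<phi> k l. n \<in> Ar (src (fst st')) (src (fst st)) \<and>
      fst st' = fst st \<bullet> n \<and> tri k \<phi> l \<and> src k \<in> E \<and> src \<phi> = tgt (fst (snd st')) \<and> tgt \<phi> = tgt (fst (snd st)) \<and>
      \<phi> \<bullet> fst (snd st') = fst (snd st) \<and> snd (snd st) \<bullet> \<phi> = sh 1 n \<bullet> snd (snd st') \<and>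
      (\<forall>c\<in>C. \<forall>f\<in>Ar (src (fst st)) c. f \<bullet> n = nul (src n) c))"
    for st st' :: "('o, 'm) arrow \<times> ('o, 'm) arrow \<times> ('o, 'm) arrow"
  have "\<exists>st. \<forall>k. (tri (fst (st k)) (fst (snd (st k))) (snd (snd (st k))) \<and> tgt (fst (st k)) = M \<and>
      (k = 0 \<longrightarrow> tgt (fst (snd (st k))) \<in> E)) \<and> R (st k) (st (Suc k))"
  proof (rule dependent_nat_choice)
    \<comment> \<open>The start is M_0 = M with A_0 a zero object.\<close>
    obtain Z where Z: "is_zero T Z" using ex_zero by blast
    then show "\<exists>st. tri (fst st) (fst (snd st)) (snd (snd st)) \<and> tgt (fst st) = M \<and> (0 = (0::nat) \<longrightarrow> tgt (fst (snd st)) \<in> E)"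
      using tri_ide[OF M Z] coenvelope_closed_basic(1)[OF E(1) Z]
      by (intro exI[of _ "(ide M, nul M Z, nul Z (ShO T 1 M))"]) simp
    fix st :: "('o, 'm) arrow \<times> ('o, 'm) arrow \<times> ('o, 'm) arrow" and k :: nat
    assume "tri (fst st) (fst (snd st)) (snd (snd st)) \<and> tgt (fst st) = M \<and> (k = 0 \<longrightarrow> tgt (fst (snd st)) \<in> E)"
    then obtain m a \<delta> where st: "st = (m, a, \<delta>)" and t: "tri m a \<delta>" and mM: "tgt m = M" by (cases st) auto
    note t' = triD[OF t]
    obtain q where q: "arr q" "src q = src m" "tgt q \<in> E"
      and qf: "\<forall>c\<in>C. \<forall>f\<in>Ar (src m) c. \<exists>f'\<in>Ar (tgt q) c. f = f' \<bullet> q"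
      using approx[of "src m"] t' by auto
    obtain n h where tn: "tri n q h" using ex_tri_fibre[OF q(1)] .
    note n = triD[OF tn]
    have sm: "src m = tgt n" using q n by simp
    have "arr (m \<bullet> n)" using sm n t' by simp
    then obtain a' \<delta>' where t2: "tri (m \<bullet> n) a' \<delta>'" using ex_tri by blast
    \<comment> \<open>The octahedron on M_{k+1} -> M_k -> M identifies the fibre of A_{k+1} -> A_k
      with the approximating object \<open>tgt q\<close>.\<close>
    obtain k \<phi> where o: "tri k \<phi> (sh 1 q \<bullet> \<delta>)" "src k = tgt q" "tgt k = tgt a'" "tgt \<phi> = tgt a"
      "k \<bullet> q = a' \<bullet> m" "\<delta>' \<bullet> k = h" "\<phi> \<bullet> a' = a" "\<delta> \<bullet> \<phi> = sh 1 n \<bullet> \<delta>'"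
      using tri_octahedral[OF tn t t2 sm] by blast
    have kill: "f \<bullet> n = nul (src n) c" if c: "c \<in> C" "f \<in> Ar (src m) c" for c f
    proof -
      from qf c obtain f' where "f' \<in> Ar (tgt q) c" "f = f' \<bullet> q" by blast
      then show ?thesis using tri_comp0(1)[OF tn] q n by auto
    qed
    have R: "R st (m \<bullet> n, a', \<delta>')"
      unfolding R_def st
      apply (rule exI[of _ n], rule exI[of _ \<phi>], rule exI[of _ k], rule exI[of _ "sh 1 q \<bullet> \<delta>"])
      using o n sm q(3) kill triD[OF o(1)] by simp
    show "\<exists>st'. (tri (fst st') (fst (snd st')) (snd (snd st')) \<and> tgt (fst st') = M \<and>
        (Suc k' = 0 \<longrightarrow> tgt (fst (snd st')) \<in> E)) \<and> R st st'" for k'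
      using R t2 mM by (intro exI[of _ "(m \<bullet> n, a', \<delta>')"]) simp
  qed
  then obtain st where st: "\<And>k. tri (fst (st k)) (fst (snd (st k))) (snd (snd (st k)))" "\<And>k. tgt (fst (st k)) = M"
    "tgt (fst (snd (st 0))) \<in> E" "\<And>k. R (st k) (st (Suc k))" by blast
  define m where "m k = fst (st k)" for k
  define a where "a k = fst (snd (st k))" for k
  define \<delta> where "\<delta> k = snd (snd (st k))" for k
  have t: "tri (m k) (a k) (\<delta> k)" and mM: "tgt (m k) = M" for k using st by (simp_all add: m_def a_def \<delta>_def)
  note t' = triD[OF t]
  have "\<forall>k. \<exists>n \<phi> x l. n \<in> Ar (src (m (Suc k))) (src (m k)) \<and> m (Suc k) = m k \<bullet> n \<and>
      tri x \<phi> l \<and> src x \<in> E \<and> src \<phi> = tgt (a (Suc k)) \<and> tgt \<phi> = tgt (a k) \<and> \<phi> \<bullet> a (Suc k) = a k \<and>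
      \<delta> k \<bullet> \<phi> = sh 1 n \<bullet> \<delta> (Suc k) \<and> (\<forall>c\<in>C. \<forall>f\<in>Ar (src (m k)) c. f \<bullet> n = nul (src n) c)"
    using st(4) unfolding R_def m_def a_def \<delta>_def by blast
  then obtain n \<phi> where n: "\<And>k. n k \<in> Ar (src (m (Suc k))) (src (m k))" "\<And>k. m (Suc k) = m k \<bullet> n k"
    and fib: "\<And>k. \<exists>x l. tri x (\<phi> k) l \<and> src x \<in> E"
    and \<phi>: "\<And>k. src (\<phi> k) = tgt (a (Suc k))" "\<And>k. tgt (\<phi> k) = tgt (a k)" "\<And>k. \<phi> k \<bullet> a (Suc k) = a k"
     "\<And>k. \<delta> k \<bullet> \<phi> k = sh 1 (n k) \<bullet> \<delta> (Suc k)"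
    and kill: "\<And>k c f. c \<in> C \<Longrightarrow> f \<in> Ar (src (m k)) c \<Longrightarrow> f \<bullet> n k = nul (src (n k)) c"
    by metis
  have \<phi>a: "arr (\<phi> k)" for k using fib[of k] triD(2) by blast
  have \<phi>s: "src (\<phi> k) = tgt (\<phi> (Suc k))" for k using \<phi> by simp
  obtain p d \<iota> h where hl: "holim \<phi> p d \<iota> h" by (rule ex_holim[OF prods, of \<phi>, OF \<phi>a \<phi>s])
  note D = holimD[OF hl]
  let ?L = "src \<iota>"
  have LE: "?L \<in> E" by (rule coenvelope_closedD[OF E hl _ fib]) (use st(3) \<phi>(2) in \<open>simp add: a_def\<close>)
  have ax: "a k \<in> Ar M (tgt (\<phi> k))" "a k = \<phi> k \<bullet> a (Suc k)" for k using t'[of k] mM[of k] \<phi> by simp_all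
  obtain x where x: "x \<in> Ar M ?L" "\<And>k. p k \<bullet> (\<iota> \<bullet> x) = a k"
    using holim_lift[OF hl M ax(1) ax(2)] by blast
  have xa: "arr x" using x by simp
  obtain b e where tb: "tri b x e" using ex_tri_fibre[OF xa] .
  note B = triD[OF tb]
  have "noarr (src b) c" if c: "c \<in> C" for c
    unfolding noarr_def
  proof
    fix f assume f: "f \<in> Ar (src b) c"
    obtain c0 j where c0: "cocompact U T c0" "c = ShO T j c0" using C[OF c] by blast
    have cO: "c \<in> Ob T" using Ar_ob[OF f] by simp
    have c0O: "c0 \<in> Ob T" using c0(1) by (simp add: cocompact_def)
    \<comment> \<open>The aim is \<open>g = 0\<close>: then \<open>f\<close> extends from the first
      term of the decomposition to \<open>M\<close>.\<close>
    define g where "g = sh 1 f \<bullet> e"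
    have g: "g \<in> Ar ?L (ShO T (1 + j) c0)" using f B x c0O c0(2) by (simp add: g_def)
    have gx: "g \<bullet> x = nul M (ShO T 1 c)" using f B x tri_comp0(2)[OF tb] cO M by (simp add: g_def)
    obtain k gk where gk: "gk \<in> Ar (tgt (\<phi> k)) (ShO T (1 + j) c0)" "g = gk \<bullet> (p k \<bullet> \<iota>)"
      using holim_cocompact_factor[OF c0(1) hl g] by blast
    \<comment> \<open>\<open>a k\<close> is \<open>x\<close> followed by the projection, so
      \<open>gk\<close> kills it and hence is \<delta>_k followed by the shift of a morphism M_k ->
      c. One stage further that morphism is killed, which forces \<open>g = 0\<close>.\<close>
    have "gk \<bullet> a k = nul M (ShO T 1 c)" using gx gk x D(7-9)[of k] D(10) by simp
    then have ga: "gk \<bullet> a k = nul (tgt (m k)) (tgt gk)" using mM gk(1) c0O c0(2) by simp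
    obtain h' where h': "h' \<in> Ar (ShO T 1 (src (m k))) (tgt gk)" "h' \<bullet> \<delta> k = gk"
      by (rule tri_extend2[OF t[of k], of gk]) (use gk(1) \<phi>(2)[of k] ga in simp_all)
    define h0 where "h0 = sh (-1) h'"
    have h0: "h0 \<in> Ar (src (m k)) c" "sh 1 h0 = h'"
      using h' gk(1) c0O c0(2) t'[of k] by (simp_all add: h0_def)
    have nk: "arr (n k)" "src (n k) = src (m (Suc k))" "tgt (n k) = src (m k)" using n(1)[of k] by simp_all
    have "sh 1 h0 \<bullet> sh 1 (n k) = nul (ShO T 1 (src (n k))) (ShO T 1 c)"
      using kill[OF c h0(1)] h0(1) nk cO t'(1)[of "Suc k"] by (simp flip: sh_comp)
    then have hn: "h' \<bullet> sh 1 (n k) = nul (ShO T 1 (src (n k))) (ShO T 1 c)" using h0 by simp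
    have "gk \<bullet> \<phi> k = h' \<bullet> (sh 1 (n k) \<bullet> \<delta> (Suc k))"
      using comp_reduce[OF h'(2), of "\<phi> k"] h' t'[of k] \<phi>a[of k] \<phi>(2)[of k] \<phi>(4)[of k] gk by auto
    also have "\<dots> = nul (tgt (\<phi> (Suc k))) (ShO T 1 c)"
      using comp_reduce[OF hn, of "\<delta> (Suc k)"] h' nk t'[of "Suc k"] cO \<phi>(2)[of "Suc k"] by simp
    finally have g\<phi>: "gk \<bullet> \<phi> k = nul (tgt (\<phi> (Suc k))) (ShO T 1 c)" .
    have "g = gk \<bullet> (\<phi> k \<bullet> (p (Suc k) \<bullet> \<iota>))" using gk(2) holim_compat[OF hl, of k] by simp
    also have "\<dots> = nul ?L (ShO T 1 c)"
      using comp_reduce[OF g\<phi>, of "p (Suc k) \<bullet> \<iota>"] gk(1) D(1,2)[of k] D(7-9)[of "Suc k"] D(10) cO by simp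
    finally have fe: "sh 1 f \<bullet> e = nul (tgt x) (tgt (sh 1 f))" using f x by (simp add: g_def)
    \<comment> \<open>The extension \<open>y\<close> of \<open>f\<close> dies on M_1, since the
      first step killed all morphisms from M_0 to \<open>c\<close>. So \<open>y\<close> factors
      through A_1, therefore through \<open>x\<close>, and \<open>x \<bullet> b = 0\<close>.\<close>
    obtain v where v: "v \<in> Ar (ShO T 1 (tgt b)) (tgt (sh 1 f))" "v \<bullet> sh 1 b = sh 1 f"
      by (rule tri_extend3[OF tb, of "sh 1 f"]) (use f B fe in simp_all)
    define y where "y = sh (-1) v"
    have y: "y \<in> Ar M c" using v f B x cO M by (simp add: y_def)
    have yb: "y \<bullet> b = f" using sh_inj[of "y \<bullet> b" f 1] y v f B x by (simp add: y_def)
    have m0: "arr (m 0)" "tgt (m 0) = M" using t'[of 0] mM[of 0] by simp_all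
    have n0: "arr (n 0)" "src (n 0) = src (m (Suc 0))" "tgt (n 0) = src (m 0)" using n(1)[of 0] by simp_all
    have "y \<bullet> m (Suc 0) = (y \<bullet> m 0) \<bullet> n 0" using y m0 n0(1,3) n(2)[of 0] by simp
    also have "\<dots> = nul (src (m (Suc 0))) c" using kill[OF c, of "y \<bullet> m 0" 0] y m0 n0 by simp
    finally have "y \<bullet> m (Suc 0) = nul (src (m (Suc 0))) c" .
    then have ym: "y \<bullet> m (Suc 0) = nul (src (m (Suc 0))) (tgt y)" using y by simp
    obtain z where z: "z \<in> Ar (tgt (a (Suc 0))) (tgt y)" "z \<bullet> a (Suc 0) = y"
      by (rule tri_extend[OF t[of "Suc 0"], of y]) (use y ym mM in simp_all)
    have "y = (z \<bullet> (p (Suc 0) \<bullet> \<iota>)) \<bullet> x"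
      using z x \<phi>(2)[of "Suc 0"] D(7-9)[of "Suc 0"] D(10) by simp
    moreover have "z \<bullet> (p (Suc 0) \<bullet> \<iota>) \<in> Ar ?L c" using z y \<phi>(2)[of "Suc 0"] D(7-9)[of "Suc 0"] D(10) by simp
    ultimately have "y \<bullet> b = nul (src b) c"
      using tri_comp0(1)[OF tb] B x cO by simp
    then show "f = nul (src b) c" using yb by simp
  qed
  then show ?thesis using that[OF tb] LE x B by simp
qed

text \<open>The product runs over all pairs of an object \<open>c\<close> and a morphism
  \<open>M \<rightarrow> c\<close>; the component of \<open>q\<close> there is the first half of a
  factorisation through \<open>X c\<close>, so every morphism is recovered from a projection. It is
  used with \<open>X c = c\<close> for the decompositions and with \<open>X c\<close> the term c^0
  for the heart. Smallness of the Hom sets makes the index set small.\<close>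

lemma ex_approximation:
  assumes prods: "has_products U T" and C: "is_small U C" "C \<subseteq> Ob T" and M: "M \<in> Ob T"
    and H: "\<And>c. c \<in> C \<Longrightarrow> is_small U (Hom T M c)"
    and X: "\<And>c f. c \<in> C \<Longrightarrow> f \<in> Ar M c \<Longrightarrow> \<exists>g h. g \<in> Ar M (X c) \<and> h \<in> Ar (X c) c \<and> f = h \<bullet> g"
  obtains q p where "arr q" "src q = M" "prod_cone (Sigma C (Hom T M)) (\<lambda>j. X (fst j)) (tgt q) p"
    "is_small U (Sigma C (Hom T M))" "\<And>c f. c \<in> C \<Longrightarrow> f \<in> Ar M c \<Longrightarrow> \<exists>f'\<in>Ar (tgt q) c. f = f' \<bullet> q"
proof -
  let ?J = "Sigma C (Hom T M)"
  have J: "is_small U ?J" by (rule is_small_Sigma[OF C(1) H])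
  have "\<exists>g h. g \<in> Ar M (X (fst j)) \<and> h \<in> Ar (X (fst j)) (fst j) \<and> Arrow M (snd j) (fst j) = h \<bullet> g" if "j \<in> ?J" for j
    using X[of "fst j" "Arrow M (snd j) (fst j)"] that C(2) M by auto
  then obtain g h where gh: "\<And>j. j \<in> ?J \<Longrightarrow> g j \<in> Ar M (X (fst j))" "\<And>j. j \<in> ?J \<Longrightarrow> h j \<in> Ar (X (fst j)) (fst j)"
      "\<And>j. j \<in> ?J \<Longrightarrow> Arrow M (snd j) (fst j) = h j \<bullet> g j" by metis
  obtain Q p where P: "prod_cone ?J (\<lambda>j. X (fst j)) Q p"
    by (rule ex_prod[OF prods J]) (use Ar_ob[OF gh(1)] in blast)
  obtain q where q: "q \<in> Ar M Q" "\<forall>j\<in>?J. p j \<bullet> q = g j" by (rule prod_ex[OF P M gh(1)])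
  have "\<exists>f'\<in>Ar (tgt q) c. f = f' \<bullet> q" if c: "c \<in> C" and f: "f \<in> Ar M c" for c f
  proof -
    define j where "j = (c, mor f)"
    have j: "j \<in> ?J" using c f arr_hom[of f] by (simp add: j_def)
    have "f = h j \<bullet> (p j \<bullet> q)" 
      using gh(3)[OF j] q(2) j f arrow.collapse[of f] unfolding j_def by (metis fst_conv snd_conv in_Ar)
    then show ?thesis using gh(2)[OF j] prod_proj[OF P j] q by (intro bexI[of _ "h j \<bullet> p j"]) (simp_all add: j_def)
  qed
  moreover have "prod_cone ?J (\<lambda>j. X (fst j)) (tgt q) p" using P q by simp
  ultimately show ?thesis using that[of q p] q J by simp
qed

section \<open>The coenvelope as a least closed class\<close>

lemma coenvelope_least: "E \<subseteq> Ob T \<Longrightarrow> coenvelope_closed U T E \<Longrightarrow> D \<subseteq> E \<Longrightarrow> coenvelope U T D \<subseteq> E"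
  by (auto simp: coenvelope_def)

lemma coenvelope_closed_Ob: "coenvelope_closed U T (Ob T)"
  by (rule coenvelope_closedI) (auto intro: is_zero_ob closed_under_productsI prod_ob(1) dest: holimD(10))

lemma coenvelope_sub: "D \<subseteq> Ob T \<Longrightarrow> coenvelope U T D \<subseteq> Ob T"
  using coenvelope_least coenvelope_closed_Ob by blast

lemma coenvelope_sup: "D \<subseteq> coenvelope U T D"
  by (auto simp: coenvelope_def)

lemma coenvelope_mono: "D \<subseteq> D' \<Longrightarrow> coenvelope U T D \<subseteq> coenvelope U T D'"
  unfolding coenvelope_def by blast

lemma coenvelope_closed_coenvelope:
  assumes "D \<subseteq> Ob T" shows "coenvelope_closed U T (coenvelope U T D)"
proof (rule coenvelope_closedI[OF coenvelope_sub[OF assms]])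
  let ?S = "{E. E \<subseteq> Ob T \<and> coenvelope_closed U T E \<and> D \<subseteq> E}"
  show "is_zero T Z \<Longrightarrow> Z \<in> coenvelope U T D" for Z
    unfolding coenvelope_def using coenvelope_closed_basic(1) by blast
  show "closed_under_products U T (coenvelope U T D)"
  proof (rule closed_under_productsI)
    fix I X P p assume *: "I \<in> U" "\<And>i. i \<in> I \<Longrightarrow> X i \<in> coenvelope U T D" "prod_cone I X P p"
    have "P \<in> E" if E: "E \<in> ?S" for E
      by (rule closed_prod[OF coenvelope_closed_basic(2) small_set[OF *(1)] _ *(3)])
        (use E *(2) in \<open>auto simp: coenvelope_def\<close>)
    then show "P \<in> coenvelope U T D" by (auto simp: coenvelope_def)
  qed
  fix \<psi> p d \<iota> h assume hl: "holim \<psi> p d \<iota> h" and 0: "tgt (\<psi> 0) \<in> coenvelope U T D"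
    and fib: "\<And>i. \<exists>k l. tri k (\<psi> i) l \<and> src k \<in> coenvelope U T D"
  have "src \<iota> \<in> E" if E: "E \<subseteq> Ob T" "coenvelope_closed U T E" "D \<subseteq> E" for E
  proof -
    have sub: "coenvelope U T D \<subseteq> E" by (rule coenvelope_least[OF E])
    show ?thesis
      by (rule coenvelope_closedD[OF E(2,1) hl]) (use 0 fib sub in blast)+
  qed
  then show "src \<iota> \<in> coenvelope U T D" by (auto simp: coenvelope_def)
qed

lemma ShO_image_iff: "D \<subseteq> Ob T \<Longrightarrow> X \<in> ShO T n ` D \<longleftrightarrow> X \<in> Ob T \<and> ShO T (- n) X \<in> D"
  by (auto intro!: image_eqI[of _ _ "ShO T (- n) X"])

lemma ShO_image_sub: "D \<subseteq> Ob T \<Longrightarrow> ShO T n ` D \<subseteq> Ob T"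
  by auto

text \<open>Minimality: the objects whose shift by \<open>n\<close> lies in the target coenvelope
  form a closed class containing \<open>D\<close>.\<close>

lemma coenvelope_ShO:
  assumes "D \<subseteq> Ob T" "ShO T n ` D \<subseteq> D'" "D' \<subseteq> Ob T" and X: "X \<in> coenvelope U T D"
  shows "ShO T n X \<in> coenvelope U T D'"
proof -
  have "coenvelope U T D \<subseteq> {X \<in> Ob T. ShO T n X \<in> coenvelope U T D'}"
  proof (rule coenvelope_least)
    show "coenvelope_closed U T {X \<in> Ob T. ShO T n X \<in> coenvelope U T D'}"
      by (rule coenvelope_closed_sh[OF coenvelope_closed_coenvelope coenvelope_sub]) (rule assms)+
    show "D \<subseteq> {X \<in> Ob T. ShO T n X \<in> coenvelope U T D'}" using assms(1,2) coenvelope_sup[of D'] by auto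
  qed blast
  then show ?thesis using X by blast
qed

section \<open>Left orthogonals, extensions and weight decompositions in terms of arrows\<close>

lemma left_orthogonal_retract: "E \<subseteq> Ob T \<Longrightarrow> retract_closed T (left_orthogonal T E)"
  unfolding retract_closed_iff[OF left_orthogonal_sub]
proof (intro allI impI)
  fix X s r assume E: "E \<subseteq> Ob T" and s: "s \<in> Ar X (tgt s)" and r: "r \<in> Ar (tgt s) X" and rs: "r \<bullet> s = ide X"
    and o: "tgt s \<in> left_orthogonal T E"
  have "noarr X Y" if Y: "Y \<in> E" for Y
    unfolding noarr_def
  proof
    fix f assume f: "f \<in> Ar X Y"
    have YO: "Y \<in> Ob T" using Y E by blast
    have "noarr (tgt s) Y" using o Y left_orthogonal_iff[OF E] by blast
    from noarrD[OF this, of "f \<bullet> r"] have "f \<bullet> r = nul (tgt s) Y" using f r by simp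
    from comp_reduce[OF this, of s] show "f = nul X Y" using rs s r f YO by simp
  qed
  then show "X \<in> left_orthogonal T E" using left_orthogonal_iff[OF E] Ar_ob[OF s] by blast
qed

lemma left_orthogonal_extension:
  assumes E: "E \<subseteq> Ob T" and t: "tri f g h" and "src f \<in> left_orthogonal T E" "tgt g \<in> left_orthogonal T E"
  shows "tgt f \<in> left_orthogonal T E"
proof -
  note D = triD[OF t]
  have "noarr (tgt f) Y" if Y: "Y \<in> E" for Y
    unfolding noarr_def
  proof
    fix u assume u: "u \<in> Ar (tgt f) Y"
    have YO: "Y \<in> Ob T" using Y E by blast
    have n: "noarr (src f) Y" "noarr (tgt g) Y" using assms Y left_orthogonal_iff[OF E] by blast+
    have uf: "u \<bullet> f = nul (src f) (tgt u)" using noarrD[OF n(1), of "u \<bullet> f"] u D by simp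
    obtain v where "v \<in> Ar (tgt g) (tgt u)" "v \<bullet> g = u" by (rule tri_extend[OF t _ _ uf]) (use u in simp_all)
    then show "u = nul (tgt f) Y" using noarrD[OF n(2), of v] u D YO by auto
  qed
  then show ?thesis using left_orthogonal_iff[OF E] D by simp
qed

lemma left_orthogonal_zero: "E \<subseteq> Ob T \<Longrightarrow> is_zero T Z \<Longrightarrow> Z \<in> left_orthogonal T E"
  using left_orthogonal_iff is_zero_noarr(2) is_zero_ob by blast

lemma left_orthogonal_product:
  assumes "\<And>c. c \<in> E \<Longrightarrow> \<exists>c0 n. cocompact U T c0 \<and> c = ShO T n c0" "E \<subseteq> Ob T"
  shows "closed_under_products U T (left_orthogonal T E)"
proof (rule closed_under_productsI)
  fix I X P p assume *: "I \<in> U" "\<And>i. i \<in> I \<Longrightarrow> X i \<in> left_orthogonal T E" "prod_cone I X P p"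
  have "noarr P c" if "c \<in> E" for c
  proof -
    obtain c0 n where c: "cocompact U T c0" "c = ShO T n c0" using assms(1)[OF \<open>c \<in> E\<close>] by blast
    show ?thesis unfolding c(2)
      by (rule cocompact_noarr_product[OF c(1) small_set[OF *(1)] *(3)])
        (use *(2) left_orthogonal_iff[OF assms(2)] \<open>c \<in> E\<close> c(2) in blast)
  qed
  then show "P \<in> left_orthogonal T E" using left_orthogonal_iff[OF assms(2)] prod_ob(1)[OF *(3)] by blast
qed

lemma extension_closed_iff: "D \<subseteq> Ob T \<Longrightarrow> extension_closed T D \<longleftrightarrow>
    (\<forall>Z. is_zero T Z \<longrightarrow> Z \<in> D) \<and> (\<forall>f g h. tri f g h \<longrightarrow> src f \<in> D \<longrightarrow> tgt g \<in> D \<longrightarrow> tgt f \<in> D)"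
proof -
  have "(\<forall>A B C f g h. (A, B, C, f, g, h) \<in> Dist T \<and> A \<in> D \<and> C \<in> D \<longrightarrow> B \<in> D)
     \<longleftrightarrow> (\<forall>f g h. tri f g h \<longrightarrow> src f \<in> D \<longrightarrow> tgt g \<in> D \<longrightarrow> tgt f \<in> D)" (is "?l \<longleftrightarrow> ?r")
  proof
    assume ?l then show ?r unfolding tri_def by blast
  next
    assume r: ?r
    show ?l
    proof (intro allI impI, elim conjE)
      fix A B C f g h assume "(A, B, C, f, g, h) \<in> Dist T" and AC: "A \<in> D" "C \<in> D"
      then have "tri (Arrow A f B) (Arrow B g C) (Arrow C h (ShO T 1 A))" using Dist_iff by blast
      from r[rule_format, OF this] AC show "B \<in> D" by simp
    qed
  qed
  then show ?thesis unfolding extension_closed_def by blast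
qed

lemma weight_decomposition_iff:
  assumes "G \<subseteq> Ob T"
  shows "(\<exists>B A b a d. weight_decomposition T L G B M A b a d)
    \<longleftrightarrow> (\<exists>b a d. tri b a d \<and> tgt b = M \<and> src b \<in> L \<and> ShO T (-1) (tgt a) \<in> G)"
proof
  assume "\<exists>B A b a d. weight_decomposition T L G B M A b a d"
  then obtain B A b a d where "B \<in> L" "A \<in> ShO T 1 ` G" "(B, M, A, b, a, d) \<in> Dist T"
    unfolding weight_decomposition_def by blast
  then show "\<exists>b a d. tri b a d \<and> tgt b = M \<and> src b \<in> L \<and> ShO T (-1) (tgt a) \<in> G"
    using Dist_iff ShO_image_iff[OF assms, of A 1]
    by (intro exI[of _ "Arrow B b M"] exI[of _ "Arrow M a A"] exI[of _ "Arrow A d (ShO T 1 B)"]) simp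
next
  assume "\<exists>b a d. tri b a d \<and> tgt b = M \<and> src b \<in> L \<and> ShO T (-1) (tgt a) \<in> G"
  then obtain b a d where t: "tri b a d" and b: "tgt b = M" "src b \<in> L" "ShO T (-1) (tgt a) \<in> G" by blast
  have "tgt a \<in> ShO T 1 ` G" using ShO_image_iff[OF assms, of "tgt a" 1] triD(2)[OF t] b by simp
  moreover have "(src b, M, tgt a, mor b, mor a, mor d) \<in> Dist T" using t b unfolding tri_def by blast
  ultimately have "weight_decomposition T L G (src b) M (tgt a) (mor b) (mor a) (mor d)"
    using b unfolding weight_decomposition_def by blast
  then show "\<exists>B A b a d. weight_decomposition T L G B M A b a d" by blast
qed

text \<open>The generators are only required to be shifts of cocompact objects, so that the result
  applies to \<open>C'\<close> and also to the class of all its shifts. The last two conclusions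
  repeat decomposition and orthogonality in the arrow form that later steps use.\<close>

theorem generated_weight_structure:
  assumes prods: "has_products U T" and C: "\<And>c. c \<in> C \<Longrightarrow> \<exists>c0 n. cocompact U T c0 \<and> c = ShO T n c0"
    and small: "is_small U C" and H: "\<And>c M. c \<in> C \<Longrightarrow> M \<in> Ob T \<Longrightarrow> is_small U (Hom T M c)"
    and sh1: "ShO T 1 ` C \<subseteq> C"
  shows "weight_structure T (left_orthogonal T (ShO T 1 ` C)) (coenvelope U T C)"
    and "\<And>M. M \<in> Ob T \<Longrightarrow> \<exists>b a d. tri b a d \<and> tgt b = M \<and> src b \<in> left_orthogonal T (ShO T 1 ` C) \<and>
        ShO T (-1) (tgt a) \<in> coenvelope U T C"
    and "\<And>M X. M \<in> left_orthogonal T (ShO T 1 ` C) \<Longrightarrow> X \<in> coenvelope U T C \<Longrightarrow> noarr M (ShO T 1 X)"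
proof -
  let ?G = "coenvelope U T C" and ?L = "left_orthogonal T (ShO T 1 ` C)"
  have cO: "cocompact U T c \<Longrightarrow> c \<in> Ob T" for c by (simp add: cocompact_def)
  have CO: "C \<subseteq> Ob T" using C cO ShO_in by blast
  have C1O: "ShO T 1 ` C \<subseteq> Ob T" using CO by auto
  have GO: "?G \<subseteq> Ob T" by (rule coenvelope_sub[OF CO])
  have LO: "?L \<subseteq> Ob T" by (rule left_orthogonal_sub)
  have G: "coenvelope_closed U T ?G" by (rule coenvelope_closed_coenvelope[OF CO])
  have G1: "ShO T 1 X \<in> ?G" if "X \<in> ?G" for X by (rule coenvelope_ShO[OF CO sh1 CO that])
  \<comment> \<open>The class \<open>?G[1]\<close>, again coenvelope-closed. The second term of a
    weight decomposition has to lie in it, and it contains the test objects C[1].\<close>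
  let ?G1 = "{X \<in> Ob T. ShO T (-1) X \<in> ?G}"
  have G1c: "coenvelope_closed U T ?G1" by (rule coenvelope_closed_sh[OF G GO])
  show dec: "\<exists>b a d. tri b a d \<and> tgt b = M \<and> src b \<in> ?L \<and> ShO T (-1) (tgt a) \<in> ?G" if M: "M \<in> Ob T" for M
  proof -
    have approx: "\<exists>q. arr q \<and> src q = M \<and> tgt q \<in> ?G1 \<and>
        (\<forall>c\<in>ShO T 1 ` C. \<forall>f\<in>Ar M c. \<exists>f'\<in>Ar (tgt q) c. f = f' \<bullet> q)" if M: "M \<in> Ob T" for M
    proof -
      have s1: "is_small U (ShO T 1 ` C)" by (rule is_small_surj[OF small, of _ "ShO T 1"]) simp
      have H1: "is_small U (Hom T M c)" if "c \<in> ShO T 1 ` C" for c using H[OF subsetD[OF sh1 that] M] .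
      have X: "\<exists>g h. g \<in> Ar M c \<and> h \<in> Ar c c \<and> f = h \<bullet> g" if "c \<in> ShO T 1 ` C" "f \<in> Ar M c" for c f
        using that(2) Ar_ob[OF that(2)] by (intro exI[of _ f] exI[of _ "ide c"]) simp
      obtain q p where q: "arr q" "src q = M"
          "prod_cone (Sigma (ShO T 1 ` C) (Hom T M)) fst (tgt q) p"
          "is_small U (Sigma (ShO T 1 ` C) (Hom T M))"
          and f: "\<And>c f. c \<in> ShO T 1 ` C \<Longrightarrow> f \<in> Ar M c \<Longrightarrow> \<exists>f'\<in>Ar (tgt q) c. f = f' \<bullet> q"
        using ex_approximation[where X = "\<lambda>c. c", OF prods s1 C1O M H1 X] by blast
      have "tgt q \<in> ?G1"
      proof (rule closed_prod[OF coenvelope_closed_basic(2)[OF G1c] q(4) _ q(3)])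
        fix j assume "j \<in> Sigma (ShO T 1 ` C) (Hom T M)"
        then obtain c where "c \<in> C" "fst j = ShO T 1 c" by auto
        moreover from this have "c \<in> Ob T" "c \<in> ?G" using CO coenvelope_sup[of C] by blast+
        ultimately show "fst j \<in> ?G1" by simp
      qed
      then show ?thesis using q f by blast
    qed
    have C1': "\<exists>c0 n. cocompact U T c0 \<and> c = ShO T n c0" if "c \<in> ShO T 1 ` C" for c
      using C[OF subsetD[OF sh1 that]] .
    have G1O: "?G1 \<subseteq> Ob T" by blast
    obtain b a e where d: "tri b a e" "tgt b = M" "tgt a \<in> ?G1" and n: "\<And>c. c \<in> ShO T 1 ` C \<Longrightarrow> noarr (src b) c"
      using ex_decomposition[OF prods G1c G1O C1' approx M] by blast
    have "src b \<in> Ob T" using triD(1)[OF d(1)] by simp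
    then have "src b \<in> ?L" using left_orthogonal_iff[OF C1O, of "src b"] n by simp
    with d show ?thesis by blast
  qed
  show orth: "noarr M (ShO T 1 X)" if M: "M \<in> ?L" and X: "X \<in> ?G" for M X
  proof -
    have MO: "M \<in> Ob T" using M LO by blast
    \<comment> \<open>On the generators this is the very definition of \<open>?L\<close>.\<close>
    have "?G \<subseteq> {X \<in> Ob T. noarr M (ShO T 1 X)}"
      by (rule coenvelope_least[OF _ coenvelope_closed_noarr[OF MO]])
        (use M left_orthogonal_iff[OF C1O] CO in auto)
    then show ?thesis using X by blast
  qed
  show "weight_structure T ?L ?G"
    unfolding weight_structure_def
  proof (intro conjI ballI)
    show "?L \<subseteq> Ob T" "?G \<subseteq> Ob T" by (rule LO, rule GO)
    show "retract_closed T ?L" by (rule left_orthogonal_retract[OF C1O])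
    show "retract_closed T ?G" by (rule coenvelope_closed_retract[OF prods G GO G1])
    show "?L \<subseteq> ShO T 1 ` ?L"
    proof
      fix X assume X: "X \<in> ?L"
      have XO: "X \<in> Ob T" using X LO by blast
      have "noarr (ShO T (-1) X) Y" if Y: "Y \<in> ShO T 1 ` C" for Y
      proof -
        have "noarr X (ShO T 1 Y)" using X left_orthogonal_iff[OF C1O] Y sh1 by blast
        then show ?thesis using noarr_sh'[of X Y "-1"] XO Y C1O by auto
      qed
      then have "ShO T (-1) X \<in> ?L" using left_orthogonal_iff[OF C1O] XO by simp
      then show "X \<in> ShO T 1 ` ?L" using ShO_image_iff[OF LO] XO by simp
    qed
    show "ShO T 1 ` ?G \<subseteq> ?G" using G1 by blast
    show "orthogonal T ?L (ShO T 1 ` ?G)"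
      unfolding orthogonal_iff[OF LO ShO_image_sub[OF GO]]
    proof (intro ballI)
      fix X Y assume X: "X \<in> ?L" and "Y \<in> ShO T 1 ` ?G"
      then obtain Y' where "Y' \<in> ?G" "Y = ShO T 1 Y'" by blast
      then show "noarr X Y" using orth[OF X] by simp
    qed
    fix M assume "M \<in> Ob T"
    from dec[OF this] show "\<exists>B A b a d. weight_decomposition T ?L ?G B M A b a d"
      unfolding weight_decomposition_iff[OF GO] .
  qed
qed


section \<open>Full subcategories\<close>

lemma full_sub_simps [simp]: "Ob (full_sub T D) = D" "Hom (full_sub T D) = Hom T" "Idm (full_sub T D) = Idm T"
  "Cmp (full_sub T D) = Cmp T" "Add (full_sub T D) = Add T" "Zero (full_sub T D) = Zero T"
  "ShO (full_sub T D) = ShO T" "ShM (full_sub T D) = ShM T"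
  "(X, Y, Z, f, g, h) \<in> Dist (full_sub T D) \<longleftrightarrow> (X, Y, Z, f, g, h) \<in> Dist T \<and> X \<in> D \<and> Y \<in> D \<and> Z \<in> D"
  by (simp_all add: full_sub_def)

lemma full_sub_neg [simp]: "neg (full_sub T D) = neg T"
  by (simp add: neg_def[abs_def] hom_group_def)

lemma full_sub_is_iso [simp]: "is_iso (full_sub T D) = is_iso T"
  by (simp add: is_iso_def[abs_def])

lemma full_sub_is_zero: "D \<subseteq> Ob T \<Longrightarrow> is_zero (full_sub T D) Z \<longleftrightarrow> is_zero T Z \<and> Z \<in> D"
proof
  assume D: "D \<subseteq> Ob T" and Z: "is_zero (full_sub T D) Z"
  then have ZD: "Z \<in> D" and 1: "\<exists>!f. f \<in> Hom T Z Z" by (auto simp: is_zero_def)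
  have ZO: "Z \<in> Ob T" using ZD D by blast
  have "Hom T Z Z = {Zero T Z Z}" using 1 Hom_group_laws(1)[OF ZO ZO] by blast
  then show "is_zero T Z \<and> Z \<in> D" using noarr_iff[OF ZO ZO] noarr_self_zero[OF ZO] ZD by blast
next
  assume D: "D \<subseteq> Ob T" and Z: "is_zero T Z \<and> Z \<in> D"
  then show "is_zero (full_sub T D) Z" unfolding is_zero_def full_sub_simps by blast
qed

lemma full_sub_is_product:
  "D \<subseteq> Ob T \<Longrightarrow> is_product T I X P p \<Longrightarrow> X ` I \<subseteq> D \<Longrightarrow> P \<in> D \<Longrightarrow> is_product (full_sub T D) I X P p"
  unfolding is_product_def full_sub_simps by (intro conjI; blast)

text \<open>Closure under extensions and shifts keeps cones inside \<open>D\<close>, and products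
  indexed by \<open>bool\<close>, a small set, supply the binary ones. The other axioms are
  inherited from the ambient category.\<close>

lemma triangulated_full_sub:
  assumes D: "D \<subseteq> Ob T" and ext: "extension_closed T D" and sh: "\<And>X n. X \<in> D \<Longrightarrow> ShO T n X \<in> D"
    and P: "closed_under_products U T D"
  shows "triangulated_category (full_sub T D)"
proof -
  note DO = subsetD[OF D]
  have ext': "tgt f \<in> D" if "tri f g h" "src f \<in> D" "tgt g \<in> D" for f g h
    using ext that extension_closed_iff[OF D] by blast
  \<comment> \<open>A cone of X -> Y is an extension of X[1] by Y.\<close>
  have cone: "tgt g \<in> D" if t: "tri f g h" and "src f \<in> D" "tgt f \<in> D" for f g h
    using ext'[OF tri_rot[OF t]] sh[of "src f" 1] that triD[OF t] by simp
  show ?thesis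
  proof (intro triangulated_category.intro additive_category.intro category.intro
      additive_category_axioms.intro triangulated_category_axioms.intro, unfold full_sub_simps full_sub_neg full_sub_is_iso full_sub_is_zero[OF D], goal_cases)
    case 1 then show ?case by (simp add: Idm_in DO)
  next
    case 2 then show ?case by (meson Cmp_in DO)
  next
    case 3 then show ?case by (meson Idm_left DO)
  next
    case 4 then show ?case by (meson Idm_right DO)
  next
    case 5 then show ?case by (meson Cmp_assoc DO)
  next
    case 6 then show ?case using hom_group[OF DO DO] by (simp add: hom_group_def)
  next
    case 7 then show ?case by (meson Cmp_Add_left DO)
  next
    case 8 then show ?case by (meson Cmp_Add_right DO)
  next
    case 9 then show ?case using ex_zero ext extension_closed_iff[OF D] by blast
  next
    case (10 X Y)
    then obtain Q q where Q: "is_product T (UNIV :: bool set) (\<lambda>b. if b then X else Y) Q q"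
      using ex_binary_product[OF DO DO] by blast
    have s: "is_small U (UNIV :: bool set)" by (simp add: is_small_countable)
    have "Q \<in> D" by (rule closed_prod[OF P s _ is_product_imp[OF Q]]) (use 10 in simp)
    then show ?case using full_sub_is_product[OF D Q] 10 by (intro exI) auto
  next
    case 11 then show ?case by (simp add: sh)
  next
    case 12 then show ?case by (simp add: DO)
  next
    case 13 then show ?case by (simp add: DO)
  next
    case 14 then show ?case by (meson ShM_in DO)
  next
    case 15 then show ?case by (meson ShM_0 DO)
  next
    case 16 then show ?case by (meson ShM_add DO)
  next
    case 17 then show ?case by (meson ShM_Idm DO)
  next
    case 18 then show ?case by (meson ShM_Cmp DO)
  next
    case 19 then show ?case by (meson ShM_Add DO)
  next
    case 20 then show ?case using Dist_in by blast
  next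
    case (21 X Y Z f g h X' Y' Z' f' g' h' a b c)
    then show ?case using Dist_iso[of X Y Z f g h X' Y' Z' f' g' h' a b c] DO by simp
  next
    case 22 then show ?case using Dist_Idm DO by blast
  next
    case (23 X Y f)
    obtain g h where t: "tri (Arrow X f Y) g h" using ex_tri[of "Arrow X f Y"] 23 DO by auto
    then show ?case using cone[OF t] 23 unfolding tri_def by auto
  next
    case (24 X Y Z f g h)
    then show ?case using rotate[of X Y Z f g h] DO sh by blast
  next
    case 25 then show ?case using complete_map by blast
  next
    case (26 X Y A f u du Z B g v dv C w dw)
    then show ?case using octahedral[of X Y A f u du Z B g v dv C w dw] by blast
  qed
qed

lemma triangulated_subcategoryI:
  assumes "D \<subseteq> Ob T" "extension_closed T D" "\<And>X n. X \<in> D \<Longrightarrow> ShO T n X \<in> D" "closed_under_products U T D"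
  shows "triangulated_subcategory T D"
  unfolding triangulated_subcategory_def
  using assms triangulated_full_sub closed_under_products_strict by blast

section \<open>Products of weight decompositions, towers and complexes\<close>


lemma dist_product:
  assumes t: "\<And>i. i \<in> I \<Longrightarrow> (X i, Y i, Z i, f i, g i, h i) \<in> Dist T"
    and P: "is_product T I X PX p" "is_product T I Y PY q" "is_product T I Z PZ r"
    and u: "is_product_map T I f PX p PY q u" and v: "is_product_map T I g PY q PZ r v"
    and w: "is_product_map T I h PZ r (ShO T 1 PX) (\<lambda>i. ShM T 1 (p i)) w"
  shows "(PX, PY, PZ, u, v, w) \<in> Dist T"
proof -
  have O: "PX \<in> Ob T" "PY \<in> Ob T" "PZ \<in> Ob T" using P by (simp_all add: is_product_def)
  have "tri (Arrow PX u PY) (Arrow PY v PZ) (Arrow PZ w (ShO T 1 PX))"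
  proof (rule tri_product[where f = "\<lambda>i. Arrow (X i) (f i) (Y i)" and g = "\<lambda>i. Arrow (Y i) (g i) (Z i)"
        and h = "\<lambda>i. Arrow (Z i) (h i) (ShO T 1 (X i))"])
    show "i \<in> I \<Longrightarrow> tri (Arrow (X i) (f i) (Y i)) (Arrow (Y i) (g i) (Z i)) (Arrow (Z i) (h i) (ShO T 1 (X i)))" for i
      using t Dist_iff by blast
    show "prod_cone I (\<lambda>i. src (Arrow (X i) (f i) (Y i))) PX (\<lambda>i. Arrow PX (p i) (X i))"
      "prod_cone I (\<lambda>i. tgt (Arrow (X i) (f i) (Y i))) PY (\<lambda>i. Arrow PY (q i) (Y i))"
      "prod_cone I (\<lambda>i. tgt (Arrow (Y i) (g i) (Z i))) PZ (\<lambda>i. Arrow PZ (r i) (Z i))"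
      using P[THEN is_product_imp] by simp_all
    show "Arrow PX u PY \<in> Ar PX PY" "Arrow PY v PZ \<in> Ar PY PZ" "Arrow PZ w (ShO T 1 PX) \<in> Ar PZ (ShO T 1 PX)"
      using u v w O by (simp_all add: is_product_map_def)
  qed (use u v w in \<open>auto simp: is_product_map_def intro!: arrow_eqI\<close>)
  then show ?thesis using Dist_iff by blast
qed

lemma closed_under_products_ShO:
  assumes "closed_under_products U T D" "D \<subseteq> Ob T"
  shows "closed_under_products U T (ShO T n ` D)"
proof (rule closed_under_productsI)
  fix I X P p assume *: "I \<in> U" "\<And>i. i \<in> I \<Longrightarrow> X i \<in> ShO T n ` D" "prod_cone I X P p"
  have "ShO T (-n) P \<in> D"
    by (rule closed_prod[OF assms(1) small_set[OF *(1)] _ prod_sh[OF *(3)]])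
      (use *(2) ShO_image_iff[OF assms(2)] in blast)
  then show "P \<in> ShO T n ` D" using ShO_image_iff[OF assms(2)] prod_ob(1)[OF *(3)] by blast
qed

lemma closed_is_product:
  "closed_under_products U T D \<Longrightarrow> I \<in> U \<Longrightarrow> is_product T I X P p \<Longrightarrow> (\<And>i. i \<in> I \<Longrightarrow> X i \<in> D) \<Longrightarrow> P \<in> D"
  unfolding closed_under_products_def by (metis image_subsetI)

lemma products_of_weight_decompositionsI:
  assumes L: "closed_under_products U T L" and G: "closed_under_products U T G" "G \<subseteq> Ob T"
  shows "products_of_weight_decompositions U T L G"
  unfolding products_of_weight_decompositions_def
proof (intro ballI allI impI, elim conjE)
  fix I B M A b a d PB pB PM pM PA pA u v w
  assume I: "I \<in> U" and wd: "\<forall>i\<in>I. weight_decomposition T L G (B i) (M i) (A i) (b i) (a i) (d i)"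
    and P: "is_product T I B PB pB" "is_product T I M PM pM" "is_product T I A PA pA"
    and m: "is_product_map T I b PB pB PM pM u" "is_product_map T I a PM pM PA pA v"
      "is_product_map T I d PA pA (ShO T 1 PB) (\<lambda>i. ShM T 1 (pB i)) w"
  have wd: "B i \<in> L" "A i \<in> ShO T 1 ` G" "(B i, M i, A i, b i, a i, d i) \<in> Dist T" if "i \<in> I" for i
    using wd that unfolding weight_decomposition_def by blast+
  show "weight_decomposition T L G PB PM PA u v w"
    unfolding weight_decomposition_def
    using closed_is_product[OF L I P(1) wd(1)]
      closed_is_product[OF closed_under_products_ShO[OF G] I P(3) wd(2)] dist_product[OF wd(3) P m] by blast
qed

text \<open>The triangles of the product tower are products of triangles. The cone of its
  augmentation is not among the data and has to be produced.\<close>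

lemma products_of_weight_Postnikov_towersI:
  assumes prods: "has_products U T" and L: "closed_under_products U T L" "L \<subseteq> Ob T"
    and G: "closed_under_products U T G" "G \<subseteq> Ob T"
  shows "products_of_weight_Postnikov_towers U T L G"
  unfolding products_of_weight_Postnikov_towers_def
proof (intro ballI allI impI, elim conjE)
  fix I M t PM pM s
  assume I: "I \<in> U" and t: "\<forall>i\<in>I. weight_Postnikov_tower T L G (M i) (t i)"
    and PM: "is_product T I M PM pM" and s: "is_product_tower T I t PM pM s"
  have t: "lev (t i) n \<in> ShO T n ` L" "\<exists>A\<in>ShO T (n + 1) ` G. is_cone T (lev (t i) n) (M i) (aug (t i) n) A"
    "aug (t i) n \<cdot> lnk (t i) n = aug (t i) (n - 1)"
    "(lev (t i) (n - 1), lev (t i) n, gr (t i) n, lnk (t i) n, prj (t i) n, bnd (t i) n) \<in> Dist T"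
    if "i \<in> I" for i n
    using t that unfolding weight_Postnikov_tower_def by blast+
  obtain q r where s: "is_product T I (\<lambda>i. lev (t i) n) (lev s n) (q n)"
     "is_product T I (\<lambda>i. gr (t i) n) (gr s n) (r n)"
     "is_product_map T I (\<lambda>i. aug (t i) n) (lev s n) (q n) PM pM (aug s n)"
     "is_product_map T I (\<lambda>i. lnk (t i) n) (lev s (n - 1)) (q (n - 1)) (lev s n) (q n) (lnk s n)"
     "is_product_map T I (\<lambda>i. prj (t i) n) (lev s n) (q n) (gr s n) (r n) (prj s n)"
     "is_product_map T I (\<lambda>i. bnd (t i) n) (gr s n) (r n)
       (ShO T 1 (lev s (n - 1))) (\<lambda>i. ShM T 1 (q (n - 1) i)) (bnd s n)" for n
    using s unfolding is_product_tower_def by blast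
  note PMc = is_product_imp[OF PM]
  show "weight_Postnikov_tower T L G PM s"
    unfolding weight_Postnikov_tower_def
  proof (intro allI conjI)
    fix n
    show "lev s n \<in> ShO T n ` L" by (rule closed_is_product[OF closed_under_products_ShO[OF L] I s(1) t(1)])
    show "(lev s (n - 1), lev s n, gr s n, lnk s n, prj s n, bnd s n) \<in> Dist T"
      by (rule dist_product[OF t(4) s(1) s(1) s(2) s(4) s(5) s(6)])
    have sO: "lev s n \<in> Ob T" "lev s (n - 1) \<in> Ob T" "PM \<in> Ob T" using s(1)[of n] s(1)[of "n - 1"] PM by (simp_all add: is_product_def)
    have am: "aug s n \<in> Hom T (lev s n) PM" "aug s (n - 1) \<in> Hom T (lev s (n - 1)) PM" "lnk s n \<in> Hom T (lev s (n - 1)) (lev s n)"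
      using s(3)[of n] s(3)[of "n - 1"] s(4)[of n] by (simp_all add: is_product_map_def)
    have tO: "lev (t i) n \<in> Ob T" "lev (t i) (n - 1) \<in> Ob T" "M i \<in> Ob T" "aug (t i) n \<in> Hom T (lev (t i) n) (M i)"
      "lnk (t i) n \<in> Hom T (lev (t i) (n - 1)) (lev (t i) n)" if i: "i \<in> I" for i
      using Dist_in[OF t(4)[OF i, of n]] t(2)[OF i, of n] Dist_in unfolding is_cone_def by blast+
    have "Arrow (lev s n) (aug s n) PM \<bullet> Arrow (lev s (n - 1)) (lnk s n) (lev s n) = Arrow (lev s (n - 1)) (aug s (n - 1)) PM"
    proof (rule prod_eq[OF PMc])
      show "Arrow (lev s n) (aug s n) PM \<bullet> Arrow (lev s (n - 1)) (lnk s n) (lev s n) \<in> Ar (lev s (n - 1)) PM"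
        "Arrow (lev s (n - 1)) (aug s (n - 1)) PM \<in> Ar (lev s (n - 1)) PM" using sO am by simp_all
      fix i assume i: "i \<in> I"
      let ?p = "Arrow PM (pM i) (M i)" and ?q = "\<lambda>n. Arrow (lev s n) (q n i) (lev (t i) n)"
      let ?a = "\<lambda>n. Arrow (lev (t i) n) (aug (t i) n) (M i)" and ?l = "Arrow (lev (t i) (n - 1)) (lnk (t i) n) (lev (t i) n)"
      let ?sa = "\<lambda>n. Arrow (lev s n) (aug s n) PM" and ?sl = "Arrow (lev s (n - 1)) (lnk s n) (lev s n)"
      have p: "arr ?p" "arr (?q n)" "arr (?q (n - 1))"
        using PM s(1)[of n] s(1)[of "n - 1"] i by (auto simp: is_product_def)
      have 1: "?p \<bullet> ?sa m = ?a m \<bullet> ?q m" for m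
        using s(3)[of m] i by (intro arrow_eqI) (simp_all add: is_product_map_def)
      have 2: "?q n \<bullet> ?sl = ?l \<bullet> ?q (n - 1)"
        using s(4)[of n] i by (intro arrow_eqI) (simp_all add: is_product_map_def)
      have 3: "?a n \<bullet> ?l = ?a (n - 1)" using t(3)[OF i, of n] by (intro arrow_eqI) simp_all
      have a: "arr (?a n)" "arr ?l" "arr (?sa n)" "arr (?sa (n - 1))" "arr ?sl" using tO[OF i] am sO by simp_all
      have "?p \<bullet> (?sa n \<bullet> ?sl) = ?a n \<bullet> (?q n \<bullet> ?sl)" by (rule comp_swap[OF 1]) (use p a in simp_all)
      also have "\<dots> = ?a n \<bullet> (?l \<bullet> ?q (n - 1))" unfolding 2 ..
      also have "\<dots> = ?a (n - 1) \<bullet> ?q (n - 1)" by (rule comp_reduce[OF 3]) (use p a in simp_all)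
      also have "\<dots> = ?p \<bullet> ?sa (n - 1)" unfolding 1 ..
      finally show "?p \<bullet> (?sa n \<bullet> ?sl) = ?p \<bullet> ?sa (n - 1)" .
    qed
    from arg_cong[OF this, of mor] show "aug s n \<cdot> lnk s n = aug s (n - 1)" by simp
    \<comment> \<open>Choose a cone in every component; their product is a cone of the product
      augmentation and has the required weights.\<close>
    have "\<exists>A a d. A \<in> ShO T (n + 1) ` G \<and> (lev (t i) n, M i, A, aug (t i) n, a, d) \<in> Dist T" if "i \<in> I" for i
      using t(2)[OF that] unfolding is_cone_def by blast
    then obtain A a d where A: "\<And>i. i \<in> I \<Longrightarrow> A i \<in> ShO T (n + 1) ` G"
      and ad: "\<And>i. i \<in> I \<Longrightarrow> (lev (t i) n, M i, A i, aug (t i) n, a i, d i) \<in> Dist T" by metis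
    have AO: "i \<in> I \<Longrightarrow> A i \<in> Ob T \<and> a i \<in> Hom T (M i) (A i) \<and> d i \<in> Hom T (A i) (ShO T 1 (lev (t i) n))" for i
      using Dist_in[OF ad] by blast
    obtain PA pA where PA: "is_product T I A PA pA" using prods I AO unfolding has_products_def by (metis image_subsetI)
    note PAc = is_product_imp[OF PA]
    have PAO: "PA \<in> Ob T" using PA by (simp add: is_product_def)
    have pO: "i \<in> I \<Longrightarrow> pA i \<in> Hom T PA (A i)" "i \<in> I \<Longrightarrow> pM i \<in> Hom T PM (M i)" for i
      using PA PM by (simp_all add: is_product_def)
    have "i \<in> I \<Longrightarrow> Arrow (M i) (a i) (A i) \<bullet> Arrow PM (pM i) (M i) \<in> Ar PM (A i)" for i
      using AO[of i] tO[of i] pO[of i] sO by simp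
    then obtain v where v: "v \<in> Ar PM PA" "\<forall>i\<in>I. Arrow PA (pA i) (A i) \<bullet> v = Arrow (M i) (a i) (A i) \<bullet> Arrow PM (pM i) (M i)"
      using prod_ex[OF PAc sO(3), of "\<lambda>i. Arrow (M i) (a i) (A i) \<bullet> Arrow PM (pM i) (M i)"] by blast
    note Lc = prod_sh[OF is_product_imp[OF s(1)[of n]], of 1]
    have "i \<in> I \<Longrightarrow> Arrow (A i) (d i) (ShO T 1 (lev (t i) n)) \<bullet> Arrow PA (pA i) (A i) \<in> Ar PA (ShO T 1 (lev (t i) n))" for i
      using AO[of i] tO[of i] pO[of i] PAO by simp
    then obtain w where w: "w \<in> Ar PA (ShO T 1 (lev s n))"
       "\<forall>i\<in>I. sh 1 (Arrow (lev s n) (q n i) (lev (t i) n)) \<bullet> w = Arrow (A i) (d i) (ShO T 1 (lev (t i) n)) \<bullet> Arrow PA (pA i) (A i)"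
      using prod_ex[OF Lc PAO, of "\<lambda>i. Arrow (A i) (d i) (ShO T 1 (lev (t i) n)) \<bullet> Arrow PA (pA i) (A i)"] by blast
    have "(lev s n, PM, PA, aug s n, mor v, mor w) \<in> Dist T"
    proof (rule dist_product[OF ad s(1) PM PA s(3)])
      show "is_product_map T I a PM pM PA pA (mor v)"
        unfolding is_product_map_def
      proof (intro conjI ballI)
        show "mor v \<in> Hom T PM PA" using v arr_hom[of v] by simp
        show "pA i \<cdot> mor v = a i \<cdot> pM i" if "i \<in> I" for i
          using arg_cong[OF v(2)[rule_format, OF that], of mor] by simp
      qed
      show "is_product_map T I d PA pA (ShO T 1 (lev s n)) (\<lambda>i. ShM T 1 (q n i)) (mor w)"
        unfolding is_product_map_def
      proof (intro conjI ballI)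
        show "mor w \<in> Hom T PA (ShO T 1 (lev s n))" using w arr_hom[of w] by simp
        show "ShM T 1 (q n i) \<cdot> mor w = d i \<cdot> pA i" if "i \<in> I" for i
          using arg_cong[OF w(2)[rule_format, OF that], of mor] by simp
      qed
    qed
    moreover have "PA \<in> ShO T (n + 1) ` G" by (rule closed_is_product[OF closed_under_products_ShO[OF G] I PA A])
    ultimately show "\<exists>A\<in>ShO T (n + 1) ` G. is_cone T (lev s n) PM (aug s n) A" unfolding is_cone_def by blast
  qed
qed

text \<open>A product complex prescribes only the graded pieces and differentials. The levels are
  multiplied afresh, a product tower is built on them with exactly the prescribed pieces, and its
  differentials are compared with the given ones.\<close>

lemma products_of_weight_complexesI:
  assumes prods: "has_products U T" and L: "closed_under_products U T L" "L \<subseteq> Ob T"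
    and G: "closed_under_products U T G" "G \<subseteq> Ob T"
  shows "products_of_weight_complexes U T L G"
  unfolding products_of_weight_complexes_def
proof (intro ballI allI impI, elim conjE)
  fix I M X d PM pM Q e
  assume I: "I \<in> U" and wc: "\<forall>i\<in>I. is_weight_complex T L G (M i) (X i) (d i)"
    and PM: "is_product T I M PM pM" and "is_product_complex T I X d Q e"
  then obtain q where Q: "\<And>n. is_product T I (\<lambda>i. X i n) (Q n) (q n)"
    and e: "\<And>n. is_product_map T I (\<lambda>i. d i n) (Q n) (q n) (Q (n + 1)) (q (n + 1)) (e n)"
    unfolding is_product_complex_def by blast
  have "\<forall>i\<in>I. \<exists>t. weight_Postnikov_tower T L G (M i) t \<and> (\<forall>p. X i p = ShO T p (gr t (- p)) \<and>
      d i p = ShM T (p + 1) (prj t (- p - 1)) \<cdot> ShM T p (bnd t (- p)))"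
    using wc unfolding is_weight_complex_def by blast
  then obtain t where t: "\<forall>i\<in>I. weight_Postnikov_tower T L G (M i) (t i)"
    and Xd: "\<And>i p. i \<in> I \<Longrightarrow> X i p = ShO T p (gr (t i) (- p))"
      "\<And>i p. i \<in> I \<Longrightarrow> d i p = ShM T (p + 1) (prj (t i) (- p - 1)) \<cdot> ShM T p (bnd (t i) (- p))"
    by metis
  have tD: "(lev (t i) (n - 1), lev (t i) n, gr (t i) n, lnk (t i) n, prj (t i) n, bnd (t i) n) \<in> Dist T"
    "\<exists>A a d. (lev (t i) n, M i, A, aug (t i) n, a, d) \<in> Dist T" if "i \<in> I" for i n
    using t that unfolding weight_Postnikov_tower_def is_cone_def by blast+
  define aa where "aa i n = Arrow (lev (t i) n) (aug (t i) n) (M i)" for i n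
  define ll where "ll i n = Arrow (lev (t i) (n - 1)) (lnk (t i) n) (lev (t i) n)" for i n
  define pj where "pj i n = Arrow (lev (t i) n) (prj (t i) n) (gr (t i) n)" for i n
  define bb where "bb i n = Arrow (gr (t i) n) (bnd (t i) n) (ShO T 1 (lev (t i) (n - 1)))" for i n
  have st [simp]: "src (aa i n) = lev (t i) n" "tgt (aa i n) = M i" "src (ll i n) = lev (t i) (n - 1)" "tgt (ll i n) = lev (t i) n"
    "src (pj i n) = lev (t i) n" "tgt (pj i n) = gr (t i) n" "src (bb i n) = gr (t i) n" "tgt (bb i n) = ShO T 1 (lev (t i) (n - 1))" for i n
    by (simp_all add: aa_def ll_def pj_def bb_def)
  have ta: "arr (aa i n)" "arr (ll i n)" "arr (pj i n)" "arr (bb i n)" if "i \<in> I" for i n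
    using Dist_in[OF tD(1)[OF that, of n]] tD(2)[OF that, of n] Dist_in[of "lev (t i) n" "M i" _ "aug (t i) n"]
    by (auto simp: aa_def ll_def pj_def bb_def)
  have levO: "i \<in> I \<Longrightarrow> lev (t i) n \<in> Ob T" for i n using Dist_in[OF tD(1)] by blast
  have grO: "i \<in> I \<Longrightarrow> gr (t i) n \<in> Ob T" for i n using Dist_in[OF tD(1)] by blast
  note PMc = is_product_imp[OF PM]
  define \<pi> where "\<pi> i = Arrow PM (pM i) (M i)" for i
  have PMc: "prod_cone I M PM \<pi>" using is_product_imp[OF PM] by (simp add: \<pi>_def[abs_def])
  have "\<exists>P p. prod_cone I (\<lambda>i. lev (t i) n) P p" for n
    using ex_prod[OF prods small_set[OF I], of "\<lambda>i. lev (t i) n"] levO by metis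
  then obtain LV lv where LV: "\<And>n. prod_cone I (\<lambda>i. lev (t i) n) (LV n) (lv n)" by metis
  \<comment> \<open>Inverts M^p = M_{-p}[p], so that the new tower has the terms \<open>Q\<close> on
    the nose.\<close>
  define GR where "GR n = ShO T n (Q (- n))" for n
  define qa where "qa n i = Arrow (Q n) (q n i) (X i n)" for n i
  have Qc: "prod_cone I (\<lambda>i. X i n) (Q n) (qa n)" for n using is_product_imp[OF Q[of n]] by (simp add: qa_def[abs_def])
  define rr where "rr n i = sh n (qa (- n) i)" for n i
  have GRc: "prod_cone I (\<lambda>i. gr (t i) n) (GR n) (rr n)" for n
    unfolding GR_def rr_def by (rule prod_cong[OF prod_sh[OF Qc]]) (use Xd(1) grO in simp_all)
  note lvp = prod_proj[OF LV] and rrp = prod_proj[OF GRc] and qap = prod_proj[OF Qc]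
  have LVO: "LV n \<in> Ob T" and GRO: "GR n \<in> Ob T" and QO: "Q n \<in> Ob T" for n
    using prod_ob(1)[OF LV] prod_ob(1)[OF GRc] prod_ob(1)[OF Qc] by simp_all
  have "\<exists>u\<in>Ar (LV n) PM. \<forall>i\<in>I. \<pi> i \<bullet> u = aa i n \<bullet> lv n i" for n
  proof -
    have "i \<in> I \<Longrightarrow> aa i n \<bullet> lv n i \<in> Ar (LV n) (M i)" for i using ta lvp by simp
    from prod_ex[OF PMc LVO this] show ?thesis by blast
  qed
  then obtain Au where Au: "\<And>n. Au n \<in> Ar (LV n) PM" "\<And>n. \<forall>i\<in>I. \<pi> i \<bullet> Au n = aa i n \<bullet> lv n i" by metis
  have "\<exists>u\<in>Ar (LV (n - 1)) (LV n). \<forall>i\<in>I. lv n i \<bullet> u = ll i n \<bullet> lv (n - 1) i" for n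
  proof -
    have "i \<in> I \<Longrightarrow> ll i n \<bullet> lv (n - 1) i \<in> Ar (LV (n - 1)) (lev (t i) n)" for i using ta lvp by simp
    from prod_ex[OF LV LVO this] show ?thesis by blast
  qed
  then obtain Li where Li: "\<And>n. Li n \<in> Ar (LV (n - 1)) (LV n)" "\<And>n. \<forall>i\<in>I. lv n i \<bullet> Li n = ll i n \<bullet> lv (n - 1) i" by metis
  have "\<exists>u\<in>Ar (LV n) (GR n). \<forall>i\<in>I. rr n i \<bullet> u = pj i n \<bullet> lv n i" for n
  proof -
    have "i \<in> I \<Longrightarrow> pj i n \<bullet> lv n i \<in> Ar (LV n) (gr (t i) n)" for i using ta lvp by simp
    from prod_ex[OF GRc LVO this] show ?thesis by blast
  qed
  then obtain Pj where Pj: "\<And>n. Pj n \<in> Ar (LV n) (GR n)" "\<And>n. \<forall>i\<in>I. rr n i \<bullet> Pj n = pj i n \<bullet> lv n i" by metis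
  have "\<exists>u\<in>Ar (GR n) (ShO T 1 (LV (n - 1))). \<forall>i\<in>I. sh 1 (lv (n - 1) i) \<bullet> u = bb i n \<bullet> rr n i" for n
  proof -
    have "i \<in> I \<Longrightarrow> bb i n \<bullet> rr n i \<in> Ar (GR n) (ShO T 1 (lev (t i) (n - 1)))" for i using ta rrp by simp
    from prod_ex[OF prod_sh[OF LV] GRO this] show ?thesis by blast
  qed
  then obtain Bd where Bd: "\<And>n. Bd n \<in> Ar (GR n) (ShO T 1 (LV (n - 1)))"
    "\<And>n. \<forall>i\<in>I. sh 1 (lv (n - 1) i) \<bullet> Bd n = bb i n \<bullet> rr n i" by metis
  define s where "s = \<lparr>lev = LV, aug = \<lambda>n. mor (Au n), lnk = \<lambda>n. mor (Li n), gr = GR, prj = \<lambda>n. mor (Pj n), bnd = \<lambda>n. mor (Bd n)\<rparr>"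
  have s: "lev s = LV" "aug s n = mor (Au n)" "lnk s n = mor (Li n)" "gr s = GR" "prj s n = mor (Pj n)" "bnd s n = mor (Bd n)" for n
    by (simp_all add: s_def)
  have pm: "is_product_map T I f P (\<lambda>i. mor (p i)) Q' (\<lambda>i. mor (q' i)) (mor u)"
    if "u \<in> Ar P Q'" "\<forall>i\<in>I. q' i \<bullet> u = g i \<bullet> p i" "\<And>i. f i = mor (g i)" for f P p Q' q' u g
    unfolding is_product_map_def
  proof (intro conjI ballI)
    show "mor u \<in> Hom T P Q'" using that(1) arr_hom[of u] by simp
    fix i assume "i \<in> I"
    with that(2) have "q' i \<bullet> u = g i \<bullet> p i" by blast
    from arg_cong[OF this, of mor] show "mor (q' i) \<cdot> mor u = f i \<cdot> mor (p i)" by (simp add: that(3))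
  qed
  have "is_product_tower T I t PM pM s"
    unfolding is_product_tower_def s
  proof (rule exI[of _ "\<lambda>n i. mor (lv n i)"], rule exI[of _ "\<lambda>n i. mor (rr n i)"], intro allI conjI)
    fix n
    show "is_product T I (\<lambda>i. lev (t i) n) (LV n) (\<lambda>i. mor (lv n i))" by (rule is_product_of_prod_cone[OF LV])
    show "is_product T I (\<lambda>i. gr (t i) n) (GR n) (\<lambda>i. mor (rr n i))" by (rule is_product_of_prod_cone[OF GRc])
    have "pM = (\<lambda>i. mor (\<pi> i))" by (simp add: \<pi>_def)
    then show "is_product_map T I (\<lambda>i. aug (t i) n) (LV n) (\<lambda>i. mor (lv n i)) PM pM (mor (Au n))"
      using pm[OF Au(1) Au(2), of "\<lambda>i. aug (t i) n"] by (simp add: aa_def)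
    show "is_product_map T I (\<lambda>i. lnk (t i) n) (LV (n - 1)) (\<lambda>i. mor (lv (n - 1) i)) (LV n) (\<lambda>i. mor (lv n i)) (mor (Li n))"
      by (rule pm[OF Li(1) Li(2)]) (simp add: ll_def)
    show "is_product_map T I (\<lambda>i. prj (t i) n) (LV n) (\<lambda>i. mor (lv n i)) (GR n) (\<lambda>i. mor (rr n i)) (mor (Pj n))"
      by (rule pm[OF Pj(1) Pj(2)]) (simp add: pj_def)
    have "is_product_map T I (\<lambda>i. bnd (t i) n) (GR n) (\<lambda>i. mor (rr n i)) (ShO T 1 (LV (n - 1)))
        (\<lambda>i. mor (sh 1 (lv (n - 1) i))) (mor (Bd n))"
      by (rule pm[OF Bd(1) Bd(2)]) (simp add: bb_def)
    then show "is_product_map T I (\<lambda>i. bnd (t i) n) (GR n) (\<lambda>i. mor (rr n i)) (ShO T 1 (LV (n - 1)))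
        (\<lambda>i. ShM T 1 (mor (lv (n - 1) i))) (mor (Bd n))" by simp
  qed
  then have "weight_Postnikov_tower T L G PM s"
    using products_of_weight_Postnikov_towersI[OF assms] I t PM unfolding products_of_weight_Postnikov_towers_def by blast
  moreover have "Q p = ShO T p (gr s (- p))" for p using QO by (simp add: s GR_def)
  moreover have "e p = ShM T (p + 1) (prj s (- p - 1)) \<cdot> ShM T p (bnd s (- p))" for p
  proof -
    define ea where "ea = Arrow (Q p) (e p) (Q (p + 1))"
    let ?P = "sh (p + 1) (Pj (- p - 1))" and ?B = "sh p (Bd (- p))"
    have PjB: "arr (Pj n)" "src (Pj n) = LV n" "tgt (Pj n) = GR n"
      "arr (Bd n)" "src (Bd n) = GR n" "tgt (Bd n) = ShO T 1 (LV (n - 1))" for n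
      using Pj(1)[of n] Bd(1)[of n] by simp_all
    have PB: "arr ?P" "arr ?B" "src ?B = Q p" "tgt ?P = Q (p + 1)" "src ?P = ShO T (p + 1) (LV (- p - 1))" "tgt ?B = src ?P"
      using PjB[of "- p - 1"] PjB[of "- p"] QO LVO by (simp_all add: GR_def add.commute)
    \<comment> \<open>After projection to a factor both sides become the differential of that factor
      composed with the projection of \<open>Q p\<close>.\<close>
    have "ea = ?P \<bullet> ?B"
    proof (rule prod_eq[OF Qc])
      show "ea \<in> Ar (Q p) (Q (p + 1))" using e[of p] QO by (simp add: ea_def is_product_map_def)
      show "?P \<bullet> ?B \<in> Ar (Q p) (Q (p + 1))" using PB by simp
      fix i assume i: "i \<in> I"
      note ti = ta[OF i] and lvi = lvp[OF i] and rri = rrp[OF i] and qai = qap[OF i]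
      have r1: "sh (p + 1) (rr (- p - 1) i) = qa (p + 1) i" using qai by (simp add: rr_def add.commute)
      have r2: "sh p (rr (- p) i) = qa p i" using qai by (simp add: rr_def)
      have "qa (p + 1) i \<bullet> ea = sh (p + 1) (pj i (- p - 1)) \<bullet> (sh p (bb i (- p)) \<bullet> qa p i)"
      proof -
        have "qa (p + 1) i \<bullet> ea = Arrow (X i p) (d i p) (X i (p + 1)) \<bullet> qa p i"
          using e[of p] i by (intro arrow_eqI) (simp_all add: ea_def qa_def is_product_map_def)
        also have "Arrow (X i p) (d i p) (X i (p + 1)) = sh (p + 1) (pj i (- p - 1)) \<bullet> sh p (bb i (- p))"
          using Xd(1)[OF i, of p] Xd(1)[OF i, of "p + 1"] Xd(2)[OF i, of p]
          by (intro arrow_eqI) (simp_all add: pj_def bb_def)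
        finally show ?thesis
          using ti qai[of p] Xd(1)[OF i, of p] levO[OF i] by (simp add: add.commute)
      qed
      moreover have "qa (p + 1) i \<bullet> (?P \<bullet> ?B) = sh (p + 1) (pj i (- p - 1)) \<bullet> (sh (p + 1) (lv (- p - 1) i) \<bullet> ?B)"
      proof (rule comp_swap)
        show "qa (p + 1) i \<bullet> ?P = sh (p + 1) (pj i (- p - 1)) \<bullet> sh (p + 1) (lv (- p - 1) i)"
          using Pj(2)[of "- p - 1"] i r1[symmetric] PjB ti lvi rri by (simp flip: sh_comp)
      qed (use PB PjB ti lvi qai QO in simp_all)
      moreover have "sh (p + 1) (lv (- p - 1) i) \<bullet> ?B = sh p (bb i (- p)) \<bullet> qa p i"
      proof -
        have "sh (p + 1) (lv (- p - 1) i) = sh p (sh 1 (lv (- p - 1) i))" using lvi by simp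
        then show ?thesis using Bd(2)[of "- p"] i r2[symmetric] PjB ti lvi rri by (simp flip: sh_comp del: sh_sh)
      qed
      ultimately show "qa (p + 1) i \<bullet> ea = qa (p + 1) i \<bullet> (?P \<bullet> ?B)" by simp
    qed
    from arg_cong[OF this, of mor] show ?thesis by (simp add: ea_def s)
  qed
  ultimately show "is_weight_complex T L G PM Q e" unfolding is_weight_complex_def by blast
qed


section \<open>The heart\<close>

text \<open>The piece M_n is an extension of Y_{n-1}[1] by Y_n, which bounds its weights above. With
  A_k the cone of Y_k -> M, the octahedron presents M_n as an extension of A_{n-1} by A_n[-1], which
  bounds them below.\<close>

lemma tower_gr_heart:
  assumes L: "L \<subseteq> Ob T" "extension_closed T L" "\<And>X. X \<in> L \<Longrightarrow> ShO T (-1) X \<in> L"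
    and G: "G \<subseteq> Ob T" "extension_closed T G" "\<And>X. X \<in> G \<Longrightarrow> ShO T 1 X \<in> G"
    and t: "weight_Postnikov_tower T L G M t"
  shows "ShO T (- n) (gr t n) \<in> L \<inter> G"
proof -
  have ext: "ShO T k (tgt f) \<in> D" if D: "D \<subseteq> Ob T" "extension_closed T D"
    and fgh: "tri f g h" "ShO T k (src f) \<in> D" "ShO T k (tgt g) \<in> D" for D f g h k
  proof -
    obtain h' where "tri (sh k f) (sh k g) h'" using tri_sh[OF fgh(1)] .
    then show ?thesis using D fgh extension_closed_iff[OF D(1)] by (metis sh_simps(1,2))
  qed
  have lev: "ShO T (- m) (lev t m) \<in> L" "lev t m \<in> Ob T" for m
    using t ShO_image_iff[OF L(1), of "lev t m" m] unfolding weight_Postnikov_tower_def by blast+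
  have cone: "\<exists>g h. tri (Arrow (lev t m) (aug t m) M) g h \<and> ShO T (- m - 1) (tgt g) \<in> G" for m
  proof -
    obtain A where A: "A \<in> ShO T (m + 1) ` G" "is_cone T (lev t m) M (aug t m) A"
      using t unfolding weight_Postnikov_tower_def by blast
    then obtain g h where "(lev t m, M, A, aug t m, g, h) \<in> Dist T" by (auto simp: is_cone_def)
    then show ?thesis using Dist_iff A(1) ShO_image_iff[OF G(1), of A "m + 1"]
      by (intro exI[of _ "Arrow M g A"] exI[of _ "Arrow A h (ShO T 1 (lev t m))"]) simp
  qed
  define l where "l = Arrow (lev t (n - 1)) (lnk t n) (lev t n)"
  define p where "p = Arrow (lev t n) (prj t n) (gr t n)"
  define b where "b = Arrow (gr t n) (bnd t n) (ShO T 1 (lev t (n - 1)))"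
  have T: "tri l p b" using t Dist_iff unfolding weight_Postnikov_tower_def l_def p_def b_def by blast
  note D = triD[OF T]
  have ao: "Arrow (lev t n) (aug t n) M \<bullet> l = Arrow (lev t (n - 1)) (aug t (n - 1)) M"
    using t by (intro arrow_eqI) (simp_all add: weight_Postnikov_tower_def l_def)
  have grO: "gr t n \<in> Ob T" using D arr_ob(2)[of p] by (simp add: p_def)
  have "ShO T (- n) (tgt p) \<in> L"
  proof (rule ext[OF L(1,2) tri_rot[OF T]])
    show "ShO T (- n) (src p) \<in> L" using lev(1)[of n] by (simp add: p_def)
    show "ShO T (- n) (tgt b) \<in> L" using lev(1)[of "n - 1"] lev(2) by (simp add: b_def)
  qed
  moreover obtain v dv where v: "tri (Arrow (lev t n) (aug t n) M) v dv" "ShO T (- n - 1) (tgt v) \<in> G" using cone by blast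
  obtain w dw where w: "tri (Arrow (lev t (n - 1)) (aug t (n - 1)) M) w dw" "ShO T (- (n - 1) - 1) (tgt w) \<in> G" using cone by blast
  \<comment> \<open>The octahedron on Y_{n-1} -> Y_n -> M yields a triangle from the piece to
    A_{n-1} to A_n.\<close>
  obtain x y where xy: "tri x y (sh 1 p \<bullet> dv)" "src x = tgt p" "tgt x = tgt w" "tgt y = tgt v"
    using tri_octahedral[OF T v(1), of w dw] w(1) ao by (metis l_def arrow.sel(1,3))
  have "ShO T (- n) (tgt (opp (sh (- 1) (sh 1 p \<bullet> dv)))) \<in> G"
  proof (rule ext[OF G(1,2) tri_unrot[OF xy(1)]])
    show "ShO T (- n) (src (opp (sh (- 1) (sh 1 p \<bullet> dv)))) \<in> G"
      using v(2) triD[OF v(1)] arr_ob(2)[of v] by simp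
    show "ShO T (- n) (tgt x) \<in> G" using w(2) xy by simp
  qed
  moreover have "tgt (opp (sh (- 1) (sh 1 p \<bullet> dv))) = gr t n" using grO by (simp add: p_def)
  ultimately show ?thesis by (simp add: p_def)
qed

lemma products_of_objectsI:
  assumes "is_small U J" "prod_cone J X P p" "\<And>j. j \<in> J \<Longrightarrow> X j \<in> D"
  shows "P \<in> products_of_objects U T D"
proof -
  obtain I where I: "I \<in> U" "J \<approx> I" using assms(1) by (auto simp: is_small_def)
  then obtain k where k: "bij_betw k I J" using eqpoll_def eqpoll_sym by blast
  have "is_product T I (\<lambda>i. X (k i)) P (\<lambda>i. mor (p (k i)))"
    using is_product_of_prod_cone[OF prod_reindex[OF k assms(2)]] .
  moreover have "(\<lambda>i. X (k i)) ` I \<subseteq> D" using assms(3) k by (auto simp: bij_betw_def)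
  ultimately show ?thesis using I(1) unfolding products_of_objects_def by blast
qed

text \<open>A morphism M -> c factors through w_{<=0} c since \<open>M\<close> lies in
  \<open>L\<close>, and w_{<=0} c is a retract of c^0; this turns the product of the terms c^0 into
  a test object for \<open>M\<close>. The hypothesis \<open>detect\<close> expresses that
  \<open>L\<close> is cut out by orthogonality to C[1].\<close>

lemma heart_object_retract:
  assumes prods: "has_products U T"
    and L: "L \<subseteq> Ob T" "extension_closed T L" "\<And>X. X \<in> L \<Longrightarrow> ShO T (-1) X \<in> L" "closed_under_products U T L"
    and G: "G \<subseteq> Ob T" "extension_closed T G" "\<And>X. X \<in> G \<Longrightarrow> ShO T 1 X \<in> G"
    and orth: "\<And>X Y. X \<in> L \<Longrightarrow> Y \<in> G \<Longrightarrow> noarr X (ShO T 1 Y)"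
    and C: "C \<subseteq> G" "is_small U C" "\<And>c M. c \<in> C \<Longrightarrow> M \<in> Ob T \<Longrightarrow> is_small U (Hom T M c)"
    and detect: "\<And>N. N \<in> Ob T \<Longrightarrow> (\<And>c. c \<in> C \<Longrightarrow> noarr N c) \<Longrightarrow> ShO T 1 N \<in> L"
    and wc: "\<And>c. c \<in> C \<Longrightarrow> is_weight_complex T L G c (cx c) (dx c)"
    and M: "M \<in> L" "M \<in> G"
  obtains P where "P \<in> products_of_objects U T {cx c n | c n. c \<in> C}" "is_retract T M P"
proof -
  have MO: "M \<in> Ob T" using M L by blast
  have CO: "C \<subseteq> Ob T" using C G by blast
  have fac: "\<exists>g h. g \<in> Ar M (cx c 0) \<and> h \<in> Ar (cx c 0) c \<and> f = h \<bullet> g" and cx0: "cx c 0 \<in> L"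
    if c: "c \<in> C" and f: "f \<in> Ar M c" for c f
  proof -
    obtain t where t: "weight_Postnikov_tower T L G c t" and cx: "cx c 0 = ShO T 0 (gr t (- 0))"
      using wc[OF c] unfolding is_weight_complex_def by blast
    have cG: "c \<in> G" using c C by blast
    have lev: "ShO T (- m) (lev t m) \<in> L" "lev t m \<in> Ob T" for m
      using t ShO_image_iff[OF L(1), of "lev t m" m] unfolding weight_Postnikov_tower_def by blast+
    define a where "a = Arrow (lev t 0) (aug t 0) c"
    obtain A x y where A: "A \<in> ShO T 1 ` G" and "(lev t 0, c, A, aug t 0, x, y) \<in> Dist T"
    proof -
      have "\<exists>A\<in>ShO T (0 + 1) ` G. is_cone T (lev t 0) c (aug t 0) A"
        using t unfolding weight_Postnikov_tower_def by blast
      then show ?thesis using that by (auto simp: is_cone_def)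
    qed
    then have ta: "tri a (Arrow c x A) (Arrow A y (ShO T 1 (lev t 0)))" unfolding a_def using Dist_iff by blast
    note Da = triD[OF ta]
    obtain A' where A': "A' \<in> G" "A = ShO T 1 A'" using A by blast
    have "Arrow c x A \<bullet> f = nul M A"
      using noarrD[OF orth[OF M(1) A'(1)], of "Arrow c x A \<bullet> f"] f Da A' by (simp add: a_def)
    then have xf: "Arrow c x A \<bullet> f = nul (src f) (tgt (Arrow c x A))" using f by simp
    obtain f0 where f0: "f0 \<in> Ar (src f) (src a)" "a \<bullet> f0 = f"
      by (rule tri_lift[OF ta _ _ xf]) (use f in \<open>simp_all add: a_def\<close>)
    have A'O: "A' \<in> Ob T" using A' G by blast
    \<comment> \<open>As a fibre of c -> A, this level is an extension of \<open>c\<close> by A[-1],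
      and both lie in \<open>G\<close>.\<close>
    have G0: "lev t 0 \<in> G"
    proof -
      have "tri (opp (sh (- 1) (Arrow A y (ShO T 1 (lev t 0))))) a (Arrow c x A)" by (rule tri_unrot[OF ta])
      then show ?thesis using extension_closed_iff[OF G(1)] G(2) A' A'O cG lev(2)[of 0] a_def by fastforce
    qed
    define l where "l = Arrow (lev t (0 - 1)) (lnk t 0) (lev t 0)"
    define p where "p = Arrow (lev t 0) (prj t 0) (gr t 0)"
    have T: "tri l p (Arrow (gr t 0) (bnd t 0) (ShO T 1 (lev t (0 - 1))))"
      using t Dist_iff unfolding weight_Postnikov_tower_def l_def p_def by blast
    note D = triD[OF T]
    have l1: "ShO T 1 (lev t (- 1)) \<in> L" using lev(1)[of "- 1"] by simp
    \<comment> \<open>The level -1 has weights at most -1 and the level 0 has weights at least 0, so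
      the link is zero and \<open>prj t 0\<close> is a split monomorphism.\<close>
    have "noarr (lev t (- 1)) (lev t 0)"
      using orth[OF l1 G0] noarr_sh[of "lev t (- 1)" "lev t 0" 1] lev(2) by simp
    then have "l = nul (lev t (- 1)) (lev t 0)" using noarrD D(1) by (simp add: l_def)
    then have il: "ide (lev t 0) \<bullet> l = nul (src l) (tgt (ide (lev t 0)))"
      using lev(2) by simp
    obtain r where r: "r \<in> Ar (tgt p) (tgt (ide (lev t 0)))" "r \<bullet> p = ide (lev t 0)"
      by (rule tri_extend[OF T _ _ il]) (use lev(2) in \<open>simp_all add: l_def\<close>)
    have grO: "gr t 0 \<in> Ob T" using arr_ob(2)[OF D(2)] by (simp add: p_def)
    have cx: "cx c 0 = gr t 0" using cx grO by simp
    have "(a \<bullet> r) \<bullet> (p \<bullet> f0) = a \<bullet> ((r \<bullet> p) \<bullet> f0)"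
      using f0(1) r(1) D Da f by (simp add: a_def p_def)
    then have "f = (a \<bullet> r) \<bullet> (p \<bullet> f0)" using f0 r(2) by (simp add: a_def)
    moreover have "p \<bullet> f0 \<in> Ar M (cx c 0)" "a \<bullet> r \<in> Ar (cx c 0) c"
      using f0 f r D Da cx by (simp_all add: a_def p_def)
    ultimately show "\<exists>g h. g \<in> Ar M (cx c 0) \<and> h \<in> Ar (cx c 0) c \<and> f = h \<bullet> g" by blast
    show "cx c 0 \<in> L" using tower_gr_heart[OF L(1-3) G t, of 0] cx grO by simp
  qed
  obtain q p where q: "arr q" "src q = M" "prod_cone (Sigma C (Hom T M)) (\<lambda>j. cx (fst j) 0) (tgt q) p"
      "is_small U (Sigma C (Hom T M))" and qf: "\<And>c f. c \<in> C \<Longrightarrow> f \<in> Ar M c \<Longrightarrow> \<exists>f'\<in>Ar (tgt q) c. f = f' \<bullet> q"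
    using ex_approximation[where X = "\<lambda>c. cx c 0", OF prods C(2) CO MO C(3)[OF _ MO] fac] by blast
  have QL: "tgt q \<in> L"
  proof (rule closed_prod[OF L(4) q(4) _ q(3)])
    fix j assume j: "j \<in> Sigma C (Hom T M)"
    then have "Arrow M (snd j) (fst j) \<in> Ar M (fst j)" "fst j \<in> C" using MO CO by auto
    then show "cx (fst j) 0 \<in> L" using cx0 by blast
  qed
  obtain n h where tn: "tri n q h" using ex_tri_fibre[OF q(1)] .
  note N = triD[OF tn]
  \<comment> \<open>Because the product lies in \<open>L\<close>, a morphism from the fibre to
    \<open>c\<close> extends to \<open>M\<close>; there it factors through \<open>q\<close>, and
    \<open>q \<bullet> n = 0\<close>.\<close>
  have "noarr (src n) c" if c: "c \<in> C" for c
    unfolding noarr_def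
  proof
    fix u assume u: "u \<in> Ar (src n) c"
    have cO: "c \<in> Ob T" using c CO by blast
    have "sh 1 u \<bullet> h = nul (tgt q) (ShO T 1 c)"
      using noarrD[OF orth[OF QL subsetD[OF C(1) c]], of "sh 1 u \<bullet> h"] u N by simp
    then have uh: "sh 1 u \<bullet> h = nul (tgt q) (tgt (sh 1 u))" using u by simp
    obtain v where v: "v \<in> Ar (ShO T 1 (tgt n)) (tgt (sh 1 u))" "v \<bullet> sh 1 n = sh 1 u"
      by (rule tri_extend3[OF tn _ _ uh]) (use u N in simp_all)
    define f where "f = sh (- 1) v"
    have nM: "tgt n = M" using N q by simp
    have f: "f \<in> Ar M c" using v u cO MO nM by (simp add: f_def)
    have fn: "f \<bullet> n = u" using sh_inj[of "f \<bullet> n" u 1] f v u N nM by (simp add: f_def)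
    obtain f' where f': "f' \<in> Ar (tgt q) c" "f = f' \<bullet> q" using qf[OF c f] by blast
    have "f' \<bullet> (q \<bullet> n) = nul (src n) c" using tri_comp0(1)[OF tn] f' N by simp
    then show "u = nul (src n) c" using fn f' N q by simp
  qed
  then have NL: "ShO T 1 (src n) \<in> L" using detect[of "src n"] N by simp
  have nM: "tgt n = M" using N q by simp
  \<comment> \<open>The fibre lies in L[-1] and \<open>M\<close> in \<open>G\<close>, so
    \<open>n\<close> is zero and the identity of \<open>M\<close> extends along
    \<open>q\<close>.\<close>
  have "noarr (src n) M" using orth[OF NL M(2)] noarr_sh[of "src n" M 1] N MO by simp
  then have "n = nul (src n) M" using noarrD[of "src n" M n] N nM by simp
  then have idn: "ide M \<bullet> n = nul (src n) (tgt (ide M))" using N nM by simp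
  obtain r where r: "r \<in> Ar (tgt q) (tgt (ide M))" "r \<bullet> q = ide M"
    by (rule tri_extend[OF tn _ _ idn]) (use MO nM in simp_all)
  have "is_retract T M (tgt q)"
    using is_retract_iff[OF MO, of "tgt q"] q r by auto
  moreover have "tgt q \<in> products_of_objects U T {cx c n | c n. c \<in> C}"
    by (rule products_of_objectsI[OF q(4) q(3)]) auto
  ultimately show ?thesis using that by blast
qed

section \<open>Karoubi envelopes\<close>


lemma karoubian_full_sub:
  assumes "karoubian T" "retract_closed T D" "D \<subseteq> Ob T" shows "karoubian (full_sub T D)"
  unfolding karoubian_def full_sub_simps
proof (intro ballI impI)
  fix X e assume X: "X \<in> D" and e: "e \<in> Hom T X X" "e \<cdot> e = e"
  have "\<forall>X\<in>Ob T. \<forall>e\<in>Hom T X X. e \<cdot> e = e \<longrightarrow>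
     (\<exists>Y\<in>Ob T. \<exists>s\<in>Hom T Y X. \<exists>r\<in>Hom T X Y. r \<cdot> s = Idm T Y \<and> s \<cdot> r = e)"
    using assms(1) unfolding karoubian_def .
  moreover have "X \<in> Ob T" "e \<cdot> e = e" using X e assms(3) by auto
  ultimately obtain Y s r where Y: "Y \<in> Ob T" "s \<in> Hom T Y X" "r \<in> Hom T X Y" "r \<cdot> s = Idm T Y" "s \<cdot> r = e"
    using e(1) by blast
  then have "Y \<in> D" using assms(2) X unfolding retract_closed_def is_retract_def by blast
  then show "\<exists>Y\<in>D. \<exists>s\<in>Hom T Y X. \<exists>r\<in>Hom T X Y. r \<cdot> s = Idm T Y \<and> s \<cdot> r = e"
    using Y by auto
qed

text \<open>Choose for each \<open>M\<close> a presentation as a retract of some \<open>P M\<close>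
  in \<open>Q\<close>, and for each idempotent on an object of \<open>Q\<close> a splitting inside
  \<open>H\<close>. The functors send \<open>M\<close> to \<open>P M\<close> with its idempotent,
  and an idempotent to its image; each composite compares two splittings of the same
  idempotent.\<close>

lemma equivalent_karoubization:
  assumes H: "H \<subseteq> Ob T" and Q: "Q \<subseteq> H" and kar: "karoubian (full_sub T H)"
    and ret: "\<And>M. M \<in> H \<Longrightarrow> \<exists>P\<in>Q. is_retract T M P"
  shows "equivalent_categories (full_sub T H) (karoubization (full_sub T Q))"
proof -
  let ?B = "karoubization (full_sub T Q)"
  have HO: "M \<in> H \<Longrightarrow> M \<in> Ob T" for M using H by blast
  have "\<exists>P s r. P \<in> Q \<and> s \<in> Ar M P \<and> r \<in> Ar P M \<and> r \<bullet> s = ide M" if M: "M \<in> H" for M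
  proof -
    obtain P where P: "P \<in> Q" "is_retract T M P" using ret[OF M] by blast
    moreover have "P \<in> Ob T" using P Q H by blast
    ultimately show ?thesis using is_retract_iff[OF HO[OF M], of P] by blast
  qed
  then obtain P S R where PQ: "\<And>M. M \<in> H \<Longrightarrow> P M \<in> Q" and "\<And>M. M \<in> H \<Longrightarrow> S M \<in> Ar M (P M)"
    and "\<And>M. M \<in> H \<Longrightarrow> R M \<in> Ar (P M) M" and RS: "\<And>M. M \<in> H \<Longrightarrow> R M \<bullet> S M = ide M" by metis
  then have SR: "arr (S M)" "src (S M) = M" "tgt (S M) = P M" "arr (R M)" "src (R M) = P M" "tgt (R M) = M" if "M \<in> H" for M
    using that by auto
  have RS': "R M \<bullet> (S M \<bullet> u) = u" if "M \<in> H" "arr u" "tgt u = M" for M u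
    using comp_reduce[OF RS[OF that(1)], of u] SR[OF that(1)] that by simp
  \<comment> \<open>\<open>E k\<close> is the idempotent of the object \<open>k\<close> of the
    Karoubization, as an arrow; it is also the identity morphism of \<open>k\<close>.\<close>
  define E where "E k = Arrow (fst k) (snd k) (fst k)" for k :: "'o \<times> 'm"
  define KO where "KO = {k. fst k \<in> Q \<and> arr (E k) \<and> E k \<bullet> E k = E k}"
  have ObB: "Ob ?B = KO"
  proof -
    have "k \<in> Ob ?B \<longleftrightarrow> k \<in> KO" for k
      using Q H by (cases k) (auto simp: karoubization_def KO_def E_def comp_def)
    then show ?thesis by blast
  qed
  have Bs: "Idm ?B k = snd k" "Cmp ?B = Cmp T" for k by (simp_all add: karoubization_def case_prod_beta)
  have E: "src (E k) = fst k" "tgt (E k) = fst k" "mor (E k) = snd k" for k by (simp_all add: E_def)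
  have OE: "fst k \<in> Q" "fst k \<in> Ob T" "arr (E k)" "E k \<bullet> E k = E k" if "k \<in> KO" for k
    using that Q H by (auto simp: KO_def)
  have EE': "E k \<bullet> (E k \<bullet> u) = E k \<bullet> u" if "k \<in> KO" "arr u" "tgt u = fst k" for k u
    using comp_reduce[OF OE(4)[OF that(1)], of u] OE[OF that(1)] that E by simp
  have HomB: "f \<in> Hom ?B k k' \<longleftrightarrow> arr (Arrow (fst k) f (fst k')) \<and>
      E k' \<bullet> (Arrow (fst k) f (fst k') \<bullet> E k) = Arrow (fst k) f (fst k')" if "k \<in> KO" "k' \<in> KO" for k k' f
  proof -
    have "f \<in> Hom ?B k k' \<longleftrightarrow> f \<in> Hom T (fst k) (fst k') \<and> snd k' \<cdot> f \<cdot> snd k = f"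
      by (simp add: karoubization_def case_prod_beta)
    also have "\<dots> \<longleftrightarrow> arr (Arrow (fst k) f (fst k')) \<and> (E k' \<bullet> Arrow (fst k) f (fst k')) \<bullet> E k = Arrow (fst k) f (fst k')"
      using OE(2)[OF that(1)] OE(2)[OF that(2)] by (simp add: E_def comp_def)
    also have "\<dots> \<longleftrightarrow> arr (Arrow (fst k) f (fst k')) \<and> E k' \<bullet> (Arrow (fst k) f (fst k') \<bullet> E k) = Arrow (fst k) f (fst k')"
      using OE(3)[OF that(1)] OE(3)[OF that(2)] E[of k] E[of k'] by (auto simp del: arr_Arrow)
    finally show ?thesis .
  qed
  have HomBI: "mor g \<in> Hom ?B k k'" if k: "k \<in> KO" "k' \<in> KO" and g: "arr g" "src g = fst k" "tgt g = fst k'" "E k' \<bullet> (g \<bullet> E k) = g"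
    for k k' g
  proof -
    have "Arrow (fst k) (mor g) (fst k') = g" using g by (intro arrow_eqI) simp_all
    then show ?thesis using HomB[OF k, of "mor g"] g by simp
  qed
  have HomBD: "arr (Arrow (fst k) f (fst k'))" "E k' \<bullet> Arrow (fst k) f (fst k') = Arrow (fst k) f (fst k')"
    "Arrow (fst k) f (fst k') \<bullet> E k = Arrow (fst k) f (fst k')"
    if k: "k \<in> KO" "k' \<in> KO" and f: "f \<in> Hom ?B k k'" for k k' f
  proof -
    let ?f = "Arrow (fst k) f (fst k')"
    have a: "arr ?f" and e: "E k' \<bullet> (?f \<bullet> E k) = ?f" using HomB[OF k] f by blast+
    show "arr ?f" by (rule a)
    show "E k' \<bullet> ?f = ?f"
      using EE'[OF k(2), of "?f \<bullet> E k"] OE(3)[OF k(1)] a E unfolding e by (simp del: arr_Arrow)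
    show "?f \<bullet> E k = ?f"
    proof -
      have "?f \<bullet> E k = (E k' \<bullet> (?f \<bullet> E k)) \<bullet> E k" unfolding e ..
      also have "\<dots> = E k' \<bullet> (?f \<bullet> (E k \<bullet> E k))"
        using a OE(3)[OF k(1)] OE(3)[OF k(2)] E by (simp del: arr_Arrow)
      finally show ?thesis using OE(4)[OF k(1)] e by simp
    qed
  qed
  have "\<exists>Y s r. Y \<in> H \<and> s \<in> Ar Y (fst k) \<and> r \<in> Ar (fst k) Y \<and> r \<bullet> s = ide Y \<and> s \<bullet> r = E k" if k: "k \<in> KO" for k
  proof -
    have fk: "fst k \<in> H" "snd k \<in> Hom T (fst k) (fst k)" "snd k \<cdot> snd k = snd k"
      using OE(1,3)[OF k] arg_cong[OF OE(4)[OF k], of mor] Q by (auto simp: E_def)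
    have "\<forall>X\<in>H. \<forall>e\<in>Hom T X X. e \<cdot> e = e \<longrightarrow> (\<exists>Y\<in>H. \<exists>s\<in>Hom T Y X. \<exists>r\<in>Hom T X Y. r \<cdot> s = Idm T Y \<and> s \<cdot> r = e)"
      using kar unfolding karoubian_def full_sub_simps .
    then obtain Y s r where Y: "Y \<in> H" "s \<in> Hom T Y (fst k)" "r \<in> Hom T (fst k) Y" "r \<cdot> s = Idm T Y" "s \<cdot> r = snd k"
      using fk by blast
    show ?thesis
      by (rule exI[of _ Y], rule exI[of _ "Arrow Y s (fst k)"], rule exI[of _ "Arrow (fst k) r Y"])
        (use Y HO OE(2)[OF k] in \<open>simp add: comp_def ide_def E_def\<close>)
  qed
  then obtain Y \<Sigma> \<rho> where YH: "\<And>k. k \<in> KO \<Longrightarrow> Y k \<in> H" and "\<And>k. k \<in> KO \<Longrightarrow> \<Sigma> k \<in> Ar (Y k) (fst k)"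
     "\<And>k. k \<in> KO \<Longrightarrow> \<rho> k \<in> Ar (fst k) (Y k)"
     and \<rho>\<Sigma>: "\<And>k. k \<in> KO \<Longrightarrow> \<rho> k \<bullet> \<Sigma> k = ide (Y k)" and \<Sigma>\<rho>: "\<And>k. k \<in> KO \<Longrightarrow> \<Sigma> k \<bullet> \<rho> k = E k" by metis
  then have \<Sigma>: "arr (\<Sigma> k)" "src (\<Sigma> k) = Y k" "tgt (\<Sigma> k) = fst k" "arr (\<rho> k)" "src (\<rho> k) = fst k" "tgt (\<rho> k) = Y k"
    if "k \<in> KO" for k using that by auto
  have \<rho>\<Sigma>': "\<rho> k \<bullet> (\<Sigma> k \<bullet> u) = u" if "k \<in> KO" "arr u" "tgt u = Y k" for k u
    using comp_reduce[OF \<rho>\<Sigma>[OF that(1)], of u] \<Sigma>[OF that(1)] that by simp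
  have \<Sigma>\<rho>': "\<Sigma> k \<bullet> (\<rho> k \<bullet> u) = E k \<bullet> u" if "k \<in> KO" "arr u" "tgt u = fst k" for k u
    using comp_reduce[OF \<Sigma>\<rho>[OF that(1)], of u] \<Sigma>[OF that(1)] that by simp
  have E\<Sigma>: "E k \<bullet> \<Sigma> k = \<Sigma> k" "\<rho> k \<bullet> E k = \<rho> k" if k: "k \<in> KO" for k
    unfolding \<Sigma>\<rho>[OF k, symmetric] using \<rho>\<Sigma>[OF k] \<rho>\<Sigma>'[OF k, of "\<rho> k"] \<Sigma>[OF k] by simp_all
  define FO where "FO M = (P M, mor (S M \<bullet> R M))" for M
  define fm where "fm M N f = S N \<bullet> (Arrow M f N \<bullet> R M)" for M N f
  define gm where "gm k k' f = \<rho> k' \<bullet> (Arrow (fst k) f (fst k') \<bullet> \<Sigma> k)" for k k' f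
  \<comment> \<open>\<eta> compares the splitting of \<open>S M \<bullet> R M\<close> by
    \<open>Y (FO M)\<close> with the one by \<open>M\<close>; likewise \<epsilon> passes from the
    chosen retract presentation of \<open>Y k\<close> to the idempotent \<open>k\<close>.\<close>
  define \<eta> where "\<eta> M = R M \<bullet> \<Sigma> (FO M)" for M
  define \<epsilon> where "\<epsilon> k = \<Sigma> k \<bullet> R (Y k)" for k
  have FO1: "fst (FO M) = P M" for M by (simp add: FO_def)
  have EF: "E (FO M) = S M \<bullet> R M" if "M \<in> H" for M
    using SR[OF that] by (intro arrow_eqI) (simp_all add: E_def FO_def)
  have FOO: "FO M \<in> KO" if M: "M \<in> H" for M
    unfolding KO_def using PQ[OF M] EF[OF M] SR[OF M] RS'[OF M, of "R M"] by (simp add: FO1)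
  have A: "arr (Arrow M f N)" if "M \<in> H" "N \<in> H" "f \<in> Hom T M N" for M N f using that HO by simp
  have fm: "arr (fm M N f)" "src (fm M N f) = P M" "tgt (fm M N f) = P N" if "M \<in> H" "N \<in> H" "f \<in> Hom T M N" for M N f
    using A[OF that] SR[OF that(1)] SR[OF that(2)] by (simp_all add: fm_def del: arr_Arrow)
  have fmA: "Arrow (P M) (mor (fm M N f)) (P N) = fm M N f" if "M \<in> H" "N \<in> H" "f \<in> Hom T M N" for M N f
    using fm[OF that] by (intro arrow_eqI) simp_all
  have gm: "arr (gm k k' f)" "src (gm k k' f) = Y k" "tgt (gm k k' f) = Y k'" if "k \<in> KO" "k' \<in> KO" "f \<in> Hom ?B k k'" for k k' f
    using HomBD(1)[OF that] \<Sigma>[OF that(1)] \<Sigma>[OF that(2)] by (simp_all add: gm_def del: arr_Arrow)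
  have gmA: "Arrow (Y k) (mor (gm k k' f)) (Y k') = gm k k' f" if "k \<in> KO" "k' \<in> KO" "f \<in> Hom ?B k k'" for k k' f
    using gm[OF that] by (intro arrow_eqI) simp_all
  have FMB: "mor (fm M N f) \<in> Hom ?B (FO M) (FO N)" if MN: "M \<in> H" "N \<in> H" and f: "f \<in> Hom T M N" for M N f
  proof (rule HomBI[OF FOO[OF MN(1)] FOO[OF MN(2)]])
    show "arr (fm M N f)" "src (fm M N f) = fst (FO M)" "tgt (fm M N f) = fst (FO N)" using fm[OF MN f] FO1 by simp_all
    show "E (FO N) \<bullet> (fm M N f \<bullet> E (FO M)) = fm M N f"
      using A[OF MN f] SR[OF MN(1)] SR[OF MN(2)] RS'[OF MN(1), of "R M"] RS'[OF MN(2), of "Arrow M f N \<bullet> R M"]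
      by (simp add: EF[OF MN(1)] EF[OF MN(2)] fm_def del: arr_Arrow)
  qed
  have 1: "is_functor (full_sub T H) ?B FO (\<lambda>M N f. mor (fm M N f))"
    unfolding is_functor_def full_sub_simps ObB Bs
  proof (intro conjI ballI)
    fix M assume M: "M \<in> H"
    show "FO M \<in> KO" by (rule FOO[OF M])
    have "Arrow M (Idm T M) M \<bullet> R M = R M" using SR[OF M] comp_ide(1)[of "R M" M] by (simp add: ide_def)
    then show "mor (fm M M (Idm T M)) = snd (FO M)" by (simp add: fm_def FO_def del: comp_simps)
    fix N f assume N: "N \<in> H" and f: "f \<in> Hom T M N"
    show "mor (fm M N f) \<in> Hom ?B (FO M) (FO N)" by (rule FMB[OF M N f])
    fix L g assume L: "L \<in> H" and g: "g \<in> Hom T N L"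
    have "fm N L g \<bullet> fm M N f = S L \<bullet> (Arrow N g L \<bullet> (Arrow M f N \<bullet> R M))"
      using A[OF M N f] A[OF N L g] SR[OF M] SR[OF N] SR[OF L] RS'[OF N, of "Arrow M f N \<bullet> R M"]
      by (simp add: fm_def del: arr_Arrow)
    also have "\<dots> = S L \<bullet> ((Arrow N g L \<bullet> Arrow M f N) \<bullet> R M)"
      using A[OF M N f] A[OF N L g] SR[OF M] by (simp del: arr_Arrow)
    also have "\<dots> = fm M L (g \<cdot> f)" by (simp add: fm_def comp_def)
    finally show "mor (fm M L (g \<cdot> f)) = mor (fm N L g) \<cdot> mor (fm M N f)" by (metis comp_simps(3))
  qed
  have 2: "is_functor ?B (full_sub T H) Y (\<lambda>k k' f. mor (gm k k' f))"
    unfolding is_functor_def full_sub_simps ObB Bs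
  proof (intro conjI ballI)
    fix k assume k: "k \<in> KO"
    show "Y k \<in> H" by (rule YH[OF k])
    have "gm k k (snd k) = \<rho> k \<bullet> (E k \<bullet> \<Sigma> k)" by (simp add: gm_def E_def)
    also have "\<dots> = ide (Y k)" using E\<Sigma>[OF k] \<rho>\<Sigma>[OF k] by simp
    finally show "mor (gm k k (snd k)) = Idm T (Y k)" by simp
    fix k' f assume k': "k' \<in> KO" and f: "f \<in> Hom ?B k k'"
    show "mor (gm k k' f) \<in> Hom T (Y k) (Y k')" using gm[OF k k' f] arr_hom[of "gm k k' f"] by simp
    fix l g assume l: "l \<in> KO" and g: "g \<in> Hom ?B k' l"
    let ?f = "Arrow (fst k) f (fst k')" and ?g = "Arrow (fst k') g (fst l)"
    note fD = HomBD[OF k k' f] and gD = HomBD[OF k' l g]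
    have "gm k' l g \<bullet> gm k k' f = \<rho> l \<bullet> (?g \<bullet> (E k' \<bullet> (?f \<bullet> \<Sigma> k)))"
      using fD(1) gD(1) \<Sigma>[OF k] \<Sigma>[OF k'] \<Sigma>[OF l] \<Sigma>\<rho>'[OF k', of "?f \<bullet> \<Sigma> k"] by (simp add: gm_def del: arr_Arrow)
    also have "E k' \<bullet> (?f \<bullet> \<Sigma> k) = ?f \<bullet> \<Sigma> k"
      by (rule comp_reduce[OF fD(2)]) (use fD(1) \<Sigma>[OF k] OE(3)[OF k'] E in \<open>simp_all del: arr_Arrow\<close>)
    also have "?g \<bullet> (?f \<bullet> \<Sigma> k) = (?g \<bullet> ?f) \<bullet> \<Sigma> k" using fD(1) gD(1) \<Sigma>[OF k] by (simp del: arr_Arrow)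
    also have "\<rho> l \<bullet> ((?g \<bullet> ?f) \<bullet> \<Sigma> k) = gm k l (g \<cdot> f)" by (simp add: gm_def comp_def)
    finally show "mor (gm k l (g \<cdot> f)) = mor (gm k' l g) \<cdot> mor (gm k k' f)" by (metis comp_simps(3))
  qed
  have 3: "is_nat_iso (full_sub T H) (full_sub T H) (\<lambda>M. Y (FO M)) (\<lambda>M N f. mor (gm (FO M) (FO N) (mor (fm M N f))))
      (\<lambda>M. M) (\<lambda>M N f. f) (\<lambda>M. mor (\<eta> M))"
    unfolding is_nat_iso_def full_sub_simps full_sub_is_iso
  proof (intro conjI ballI)
    fix M assume M: "M \<in> H"
    note FM = FOO[OF M]
    have \<eta>: "\<eta> M \<in> Ar (Y (FO M)) M" using \<Sigma>[OF FM] SR[OF M] FO1 by (simp add: \<eta>_def)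
    have "iso_arr (\<eta> M)"
      unfolding iso_arr_def
    proof (intro conjI bexI)
      show "arr (\<eta> M)" "\<rho> (FO M) \<bullet> S M \<in> Ar (tgt (\<eta> M)) (src (\<eta> M))"
        using \<eta> \<Sigma>[OF FM] SR[OF M] FO1 by simp_all
      have "(\<rho> (FO M) \<bullet> S M) \<bullet> \<eta> M = \<rho> (FO M) \<bullet> (E (FO M) \<bullet> \<Sigma> (FO M))"
        unfolding EF[OF M] \<eta>_def using \<Sigma>[OF FM] SR[OF M] FO1 by simp
      then show "(\<rho> (FO M) \<bullet> S M) \<bullet> \<eta> M = ide (src (\<eta> M))" using E\<Sigma>[OF FM] \<rho>\<Sigma>[OF FM] \<eta> by simp
      have "\<eta> M \<bullet> (\<rho> (FO M) \<bullet> S M) = R M \<bullet> (E (FO M) \<bullet> S M)"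
        unfolding \<eta>_def using \<Sigma>[OF FM] SR[OF M] FO1 \<Sigma>\<rho>'[OF FM, of "S M"] by simp
      also have "\<dots> = ide M" unfolding EF[OF M] using SR[OF M] RS[OF M] by simp
      finally show "\<eta> M \<bullet> (\<rho> (FO M) \<bullet> S M) = ide (tgt (\<eta> M))" using \<eta> by simp
    qed
    then show "is_iso T (Y (FO M)) M (mor (\<eta> M))" using iso_arr_is_iso \<eta> by blast
    fix N f assume N: "N \<in> H" and f: "f \<in> Hom T M N"
    note FN = FOO[OF N]
    have F: "Arrow (fst (FO M)) (mor (fm M N f)) (fst (FO N)) = fm M N f" using fmA[OF M N f] by (simp add: FO1)
    have "\<eta> N \<bullet> gm (FO M) (FO N) (mor (fm M N f)) = R N \<bullet> (E (FO N) \<bullet> (fm M N f \<bullet> \<Sigma> (FO M)))"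
      unfolding \<eta>_def gm_def F using \<Sigma>[OF FM] \<Sigma>[OF FN] SR[OF N] fm[OF M N f] FO1
        \<Sigma>\<rho>'[OF FN, of "fm M N f \<bullet> \<Sigma> (FO M)"] by simp
    also have "\<dots> = Arrow M f N \<bullet> \<eta> M"
      unfolding EF[OF N] fm_def \<eta>_def
      using A[OF M N f] \<Sigma>[OF FM] SR[OF N] SR[OF M] FO1 RS'[OF N, of "R N \<bullet> (S N \<bullet> (Arrow M f N \<bullet> (R M \<bullet> \<Sigma> (FO M))))"]
        RS'[OF N, of "Arrow M f N \<bullet> (R M \<bullet> \<Sigma> (FO M))"]
      by (simp del: arr_Arrow)
    finally have eq: "\<eta> N \<bullet> gm (FO M) (FO N) (mor (fm M N f)) = Arrow M f N \<bullet> \<eta> M" .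
    show "f \<cdot> mor (\<eta> M) = mor (\<eta> N) \<cdot> mor (gm (FO M) (FO N) (mor (fm M N f)))"
      using arg_cong[OF eq, of mor] by (metis arrow.sel(2) comp_simps(3))
  qed
  have 4: "is_nat_iso ?B ?B (\<lambda>k. FO (Y k)) (\<lambda>k k' f. mor (fm (Y k) (Y k') (mor (gm k k' f))))
      (\<lambda>k. k) (\<lambda>k k' f. f) (\<lambda>k. mor (\<epsilon> k))"
    unfolding is_nat_iso_def ObB Bs
  proof (intro conjI ballI)
    fix k assume k: "k \<in> KO"
    note Yk = YH[OF k] and FY = FOO[OF YH[OF k]]
    have \<epsilon>: "arr (\<epsilon> k)" "src (\<epsilon> k) = P (Y k)" "tgt (\<epsilon> k) = fst k" using \<Sigma>[OF k] SR[OF Yk] by (simp_all add: \<epsilon>_def)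
    define \<epsilon>' where "\<epsilon>' = S (Y k) \<bullet> \<rho> k"
    have \<epsilon>': "arr \<epsilon>'" "src \<epsilon>' = fst k" "tgt \<epsilon>' = P (Y k)" using \<Sigma>[OF k] SR[OF Yk] by (simp_all add: \<epsilon>'_def)
    have e1: "\<epsilon>' \<bullet> \<epsilon> k = E (FO (Y k))"
      unfolding EF[OF Yk] \<epsilon>_def \<epsilon>'_def using \<Sigma>[OF k] SR[OF Yk] \<rho>\<Sigma>'[OF k, of "R (Y k)"] by simp
    have e2: "\<epsilon> k \<bullet> \<epsilon>' = E k"
      unfolding \<epsilon>_def \<epsilon>'_def using \<Sigma>[OF k] SR[OF Yk] RS'[OF Yk, of "\<rho> k"] \<Sigma>\<rho>[OF k] by simp
    have "mor (\<epsilon> k) \<in> Hom ?B (FO (Y k)) k"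
    proof (rule HomBI[OF FY k])
      have "E k \<bullet> (\<Sigma> k \<bullet> R (Y k)) = \<Sigma> k \<bullet> R (Y k)"
        by (rule comp_reduce[OF E\<Sigma>(1)[OF k]]) (use \<Sigma>[OF k] SR[OF Yk] OE(3)[OF k] E in simp_all)
      then show "E k \<bullet> (\<epsilon> k \<bullet> E (FO (Y k))) = \<epsilon> k"
        unfolding EF[OF Yk] \<epsilon>_def using \<Sigma>[OF k] SR[OF Yk] RS'[OF Yk, of "R (Y k)"] by simp
    qed (use \<epsilon> FO1 in simp_all)
    moreover have "mor \<epsilon>' \<in> Hom ?B k (FO (Y k))"
    proof (rule HomBI[OF k FY])
      show "E (FO (Y k)) \<bullet> (\<epsilon>' \<bullet> E k) = \<epsilon>'"
        unfolding EF[OF Yk] \<epsilon>'_def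
        using \<Sigma>[OF k] SR[OF Yk] E\<Sigma>(2)[OF k] RS'[OF Yk, of "\<rho> k"] OE(3)[OF k] E by simp
    qed (use \<epsilon>' FO1 in simp_all)
    ultimately show "is_iso ?B (FO (Y k)) k (mor (\<epsilon> k))"
      unfolding is_iso_def Bs using arg_cong[OF e1, of mor] arg_cong[OF e2, of mor] E(3) by (metis comp_simps(3))
    fix k' f assume k': "k' \<in> KO" and f: "f \<in> Hom ?B k k'"
    note Yk' = YH[OF k']
    let ?f = "Arrow (fst k) f (fst k')"
    note fD = HomBD[OF k k' f]
    have gmH: "mor (gm k k' f) \<in> Hom T (Y k) (Y k')" using gm[OF k k' f] arr_hom[of "gm k k' f"] by simp
    have "\<epsilon> k' \<bullet> fm (Y k) (Y k') (mor (gm k k' f)) = \<Sigma> k' \<bullet> (R (Y k') \<bullet> (S (Y k') \<bullet> (gm k k' f \<bullet> R (Y k))))"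
      unfolding \<epsilon>_def fm_def gmA[OF k k' f] using gm[OF k k' f] \<Sigma>[OF k'] SR[OF Yk] SR[OF Yk'] by simp
    also have "\<dots> = \<Sigma> k' \<bullet> (\<rho> k' \<bullet> (?f \<bullet> (\<Sigma> k \<bullet> R (Y k))))"
      using gm[OF k k' f] SR[OF Yk] SR[OF Yk'] RS'[OF Yk', of "gm k k' f \<bullet> R (Y k)"] fD(1) \<Sigma>[OF k] \<Sigma>[OF k']
      by (simp add: gm_def del: arr_Arrow)
    also have "\<dots> = E k' \<bullet> (?f \<bullet> \<epsilon> k)"
      using \<Sigma>\<rho>'[OF k', of "?f \<bullet> \<epsilon> k"] fD(1) \<epsilon> by (simp add: \<epsilon>_def del: arr_Arrow)
    also have "\<dots> = ?f \<bullet> \<epsilon> k"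
      by (rule comp_reduce[OF fD(2)]) (use fD(1) \<epsilon> OE(3)[OF k'] E in \<open>simp_all del: arr_Arrow\<close>)
    finally have eq: "\<epsilon> k' \<bullet> fm (Y k) (Y k') (mor (gm k k' f)) = ?f \<bullet> \<epsilon> k" .
    show "f \<cdot> mor (\<epsilon> k) = mor (\<epsilon> k') \<cdot> mor (fm (Y k) (Y k') (mor (gm k k' f)))"
      using arg_cong[OF eq, of mor] by (metis arrow.sel(2) comp_simps(3))
  qed
  show ?thesis
    unfolding equivalent_categories_def using 1 2 3 4 by blast
qed

section \<open>Transfer between the category and a full subcategory\<close>

lemma noarr_full_sub:
  assumes "triangulated_category (full_sub T D)" "D \<subseteq> Ob T" "X \<in> D" "Y \<in> D"
  shows "additive_category.noarr (full_sub T D) X Y \<longleftrightarrow> noarr X Y"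
proof -
  interpret K: triangulated_category "full_sub T D" by (rule assms(1))
  show ?thesis using K.noarr_iff[of X Y] noarr_iff[of X Y] assms by auto
qed

text \<open>A product formed in the subcategory agrees with one formed in the ambient category,
  since the latter lies in \<open>D\<close> and is a product there too; the two are isomorphic, and
  \<open>E\<close> is closed under isomorphisms.\<close>

lemma closed_under_products_full_sub:
  assumes K: "triangulated_category (full_sub T D)" and prods: "has_products U T"
    and D: "D \<subseteq> Ob T" "closed_under_products U T D" and E: "E \<subseteq> D" "closed_under_products U T E"
  shows "closed_under_products U (full_sub T D) E"
  unfolding closed_under_products_def
proof (intro ballI allI impI, elim conjE)
  interpret K: triangulated_category "full_sub T D" by (rule K)
  fix I X P p assume I: "I \<in> U" and X: "X ` I \<subseteq> E" and P: "is_product (full_sub T D) I X P p"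
  have XO: "X ` I \<subseteq> Ob T" using X E D by blast
  then obtain P' p' where P': "is_product T I X P' p'" using prods I unfolding has_products_def by blast
  have P'E: "P' \<in> E" using E(2) I X P' unfolding closed_under_products_def by blast
  have "is_product (full_sub T D) I X P' p'"
    by (rule full_sub_is_product[OF D(1) P']) (use X E P'E in blast)+
  then obtain f where f: "K.iso_arr f" "src f = P" "tgt f = P'"
    using K.prod_unique[OF K.is_product_imp[OF P] K.is_product_imp] by metis
  then have "K.arr f" by (simp add: K.iso_arr_def)
  then have "f \<in> K.Ar P P'" using f by simp
  then have "is_iso T P P' (mor f)" "P \<in> D" using K.iso_arr_is_iso[OF f(1)] K.Ar_ob by auto
  then show "P \<in> E"
    using closed_under_products_strict[OF E(2)] E(1) D(1) P'E unfolding strict_def by blast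
qed

lemma has_products_full_sub:
  assumes "has_products U T" "D \<subseteq> Ob T" "closed_under_products U T D"
  shows "has_products U (full_sub T D)"
  unfolding has_products_def full_sub_simps
proof (intro ballI allI impI)
  fix I and X :: "'i \<Rightarrow> 'o" assume I: "I \<in> U" and X: "X ` I \<subseteq> D"
  then have "X ` I \<subseteq> Ob T" using assms(2) by blast
  then obtain P p where P: "is_product T I X P p" using assms(1) I unfolding has_products_def by blast
  then have "P \<in> D" using assms(3) I X unfolding closed_under_products_def by blast
  then show "\<exists>P p. is_product (full_sub T D) I X P p" using full_sub_is_product[OF assms(2) P X] by blast
qed

lemma extension_closed_full_sub:
  assumes "extension_closed T E" "D \<subseteq> Ob T" shows "extension_closed (full_sub T D) E"
  using assms full_sub_is_zero[OF assms(2)] unfolding extension_closed_def full_sub_simps by blast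


lemma is_small_Hom_ShO:
  assumes "X \<in> Ob T" "Y \<in> Ob T" "is_small U (Hom T (ShO T (- n) X) Y)"
  shows "is_small U (Hom T X (ShO T n Y))"
proof (rule is_small_surj[OF assms(3), where f = "ShM T n"], rule subsetI)
  fix f assume "f \<in> Hom T X (ShO T n Y)"
  then have a: "arr (Arrow X f (ShO T n Y))" using assms by simp
  have "ShM T (- n) f \<in> Hom T (ShO T (- n) X) Y" using arr_hom[of "sh (- n) (Arrow X f (ShO T n Y))"] a assms by simp
  moreover have "f = ShM T n (ShM T (- n) f)" 
    using arg_cong[OF sh_sh[OF a, of n "- n"], of mor] ShM_0[of X "ShO T n Y" f] a by simp
  ultimately show "f \<in> ShM T n ` Hom T (ShO T (- n) X) Y" by blast
qed

text \<open>\<open>C'\<close> denotes here the class of all shifts of \<open>C\<close>. Its left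
  orthogonal is shift-stable, so the objects right orthogonal to that form a triangulated
  subcategory containing \<open>C\<close>, hence containing the triangulated closure.\<close>

lemma left_orthogonal_triangulated_closure:
  assumes prods: "has_products U T" and C: "C \<subseteq> Ob T" and C': "C' = (\<Union>i\<in>{..0}. ShO T i ` C)"
    and sh: "\<And>c n. c \<in> C' \<Longrightarrow> ShO T n c \<in> C'" and CC: "C \<subseteq> C'"
  shows "left_orthogonal T (triangulated_closure T C) = left_orthogonal T C'"
proof -
  let ?L = "left_orthogonal T C'"
  have C'O: "C' \<subseteq> Ob T" using C C' by auto
  define V where "V = {X \<in> Ob T. \<forall>M\<in>?L. noarr M X}"
  have VO: "V \<subseteq> Ob T" by (auto simp: V_def)
  have LO: "M \<in> ?L \<Longrightarrow> M \<in> Ob T" for M using left_orthogonal_sub by blast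
  have Lsh: "ShO T n M \<in> ?L" if "M \<in> ?L" for M n
    using that left_orthogonal_iff[OF C'O] sh noarr_sh'[of M _ n] C'O by (simp add: subset_iff)
  have "triangulated_subcategory T V"
  proof (rule triangulated_subcategoryI[OF VO])
    show "extension_closed T V"
      unfolding extension_closed_iff[OF VO]
    proof (intro conjI allI impI)
      show "is_zero T Z \<Longrightarrow> Z \<in> V" for Z using is_zero_noarr(1) is_zero_ob LO by (auto simp: V_def)
      fix f g h assume t: "tri f g h" and fV: "src f \<in> V" and gV: "tgt g \<in> V"
      note D = triD[OF t]
      have "noarr M (tgt f)" if M: "M \<in> ?L" for M
        unfolding noarr_def
      proof
        fix u assume u: "u \<in> Ar M (tgt f)"
        have n: "noarr M (src f)" "noarr M (tgt g)" using fV gV M by (simp_all add: V_def)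
        have gu: "g \<bullet> u = nul (src u) (tgt g)" using noarrD[OF n(2), of "g \<bullet> u"] u D by simp
        obtain v where "v \<in> Ar (src u) (src f)" "f \<bullet> v = u" by (rule tri_lift[OF t _ _ gu]) (use u in simp_all)
        then show "u = nul M (tgt f)" using noarrD[OF n(1), of v] u D LO[OF M] by auto
      qed
      then show "tgt f \<in> V" using D by (simp add: V_def)
    qed
    show "ShO T n X \<in> V" if X: "X \<in> V" for X n
    proof -
      have "noarr M (ShO T n X)" if "M \<in> ?L" for M
        using noarr_sh'[OF LO[OF that], of X "- n"] X Lsh[OF that, of "- n"] by (simp add: V_def)
      then show ?thesis using X by (simp add: V_def)
    qed
    show "closed_under_products U T V"
    proof (rule closed_under_productsI)
      fix I X P p assume *: "I \<in> U" "\<And>i. i \<in> I \<Longrightarrow> X i \<in> V" "prod_cone I X P p"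
      have "noarr M P" if M: "M \<in> ?L" for M
        unfolding noarr_def
      proof
        fix u assume u: "u \<in> Ar M P"
        show "u = nul M P"
        proof (rule prod_eq_nul[OF *(3) u])
          fix i assume i: "i \<in> I"
          have "noarr M (X i)" using *(2)[OF i] M by (simp add: V_def)
          then show "p i \<bullet> u = nul M (X i)" using noarrD[of M "X i" "p i \<bullet> u"] u prod_proj[OF *(3) i] by simp
        qed
      qed
      then show "P \<in> V" using prod_ob(1)[OF *(3)] by (simp add: V_def)
    qed
  qed
  moreover have "C \<subseteq> V" using CC C left_orthogonal_iff[OF C'O] by (auto simp: V_def)
  ultimately have sub: "triangulated_closure T C \<subseteq> V" unfolding triangulated_closure_def by blast
  \<comment> \<open>Every triangulated subcategory is closed under negative shifts, which is all
    that the union in \<open>C'\<close> asks for.\<close>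
  have sup: "C' \<subseteq> triangulated_closure T C"
  proof -
    have "C' \<subseteq> E" if E: "triangulated_subcategory T E" "C \<subseteq> E" for E
    proof -
      interpret E: triangulated_category "full_sub T E" using E(1) by (simp add: triangulated_subcategory_def)
      show ?thesis using E.ShO_in E(2) unfolding C' full_sub_simps by blast
    qed
    then show ?thesis unfolding triangulated_closure_def by blast
  qed
  have cO: "triangulated_closure T C \<subseteq> Ob T" using sub VO by blast
  show ?thesis
  proof (intro equalityI subsetI)
    fix X assume "X \<in> left_orthogonal T (triangulated_closure T C)"
    then show "X \<in> ?L" using left_orthogonal_iff[OF cO] left_orthogonal_iff[OF C'O] sup by blast
  next
    fix X assume X: "X \<in> ?L"
    then show "X \<in> left_orthogonal T (triangulated_closure T C)"
      using left_orthogonal_iff[OF cO] LO sub by (auto simp: V_def)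
  qed
qed

end


theorem theorem2p2p6:
  fixes T :: "('o, 'm) tcat" and U :: "'i set set" and C' C1 C2 D Dperp C1' :: "'o set"
    and K :: "('o, 'm) tcat"
  assumes "smallness U"
    and "triangulated_category T"
    and "has_products U T"
    and "\<And>c. c \<in> C' \<Longrightarrow> cocompact U T c"
    and "is_small U C'"
    and "\<And>c M. \<lbrakk>c \<in> C'; M \<in> Ob T\<rbrakk> \<Longrightarrow> is_small U (Hom T M c)"
    and "ShO T 1 ` C' \<subseteq> C'"
    and "C1 = left_orthogonal T (ShO T 1 ` C')"
    and "C2 = coenvelope U T C'"
    and "D = coenvelope U T (\<Union>i\<in>{..0}. ShO T i ` C')"
    and "Dperp = left_orthogonal T (triangulated_closure T C')"
    and "K = full_sub T D"
    and "C1' = C1 \<inter> D"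
  shows
    "weight_structure T C1 C2 \<and>
     triangulated_subcategory T D \<and> closed_under_products U T D \<and>
     triangulated_subcategory T Dperp \<and> closed_under_products U T Dperp \<and>
     C2 \<subseteq> D \<and> weight_structure K C1' C2 \<and>
     nondegenerate_below K C1' \<and>
     C1 = extension_closure T (C1' \<union> Dperp) \<and>
     closed_under_products U T C1' \<and>
     closed_under_products U K (C1' \<inter> C2) \<and>
     products_of_weight_decompositions U K C1' C2 \<and>
     products_of_weight_Postnikov_towers U K C1' C2 \<and>
     products_of_weight_complexes U K C1' C2 \<and>
     karoubian T \<and> karoubian K \<and> karoubian (full_sub T C1) \<and>
     karoubian (full_sub T C1') \<and> karoubian (full_sub T C2) \<and>
     (\<forall>cx dx. (\<forall>c\<in>C'. is_weight_complex K C1' C2 c (cx c) (dx c)) \<longrightarrow>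
        equivalent_categories
          (full_sub K (C1' \<inter> C2))
          (karoubization (full_sub K (products_of_objects U K {cx c n | c n. c \<in> C'}))))"
proof -
  interpret triangulated_small T U using assms(1,2) by (simp add: triangulated_small_def)
  note prods = assms(3) and coc = assms(4) and C1 = assms(8) and C2 = assms(9) and Kdef = assms(12) and C1' = assms(13)

  \<comment> \<open>The class of all shifts of \<open>C'\<close>\<close>
  have CO: "C' \<subseteq> Ob T" using coc by (auto simp: cocompact_def)
  have C1O: "ShO T 1 ` C' \<subseteq> Ob T" using CO by auto
  have Cn: "ShO T (int n) c \<in> C'" if c: "c \<in> C'" for n c
  proof (induction n)
    case 0 show ?case using c CO by (simp add: subset_iff)
  next
    case (Suc n)
    have "ShO T 1 (ShO T (int n) c) \<in> C'" using Suc assms(7) by blast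
    then show ?case using c CO by (simp add: subset_iff)
  qed
  define C'' where "C'' = (\<Union>i\<in>{..0::int}. ShO T i ` C')"
  \<comment> \<open>The union runs over non-positive shifts only; positive shifts of
    \<open>C'\<close> already lie in \<open>C'\<close>.\<close>
  have C''I: "ShO T n c \<in> C''" if c: "c \<in> C'" for n c
  proof (cases "n \<le> 0")
    case True then show ?thesis using c unfolding C''_def by blast
  next
    case False
    then have "ShO T n c \<in> C'" using Cn[OF c, of "nat n"] by simp
    moreover have "ShO T n c = ShO T 0 (ShO T n c)" using c CO by (simp add: subset_iff)
    ultimately show ?thesis unfolding C''_def by blast
  qed
  have CC'': "C' \<subseteq> C''"
  proof
    fix c assume c: "c \<in> C'"
    then have "c = ShO T 0 c" using CO by (simp add: subset_iff)
    then show "c \<in> C''" using C''I[OF c, of 0] by simp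
  qed
  have C''E: "\<exists>c0\<in>C'. \<exists>n. c = ShO T n c0" if "c \<in> C''" for c using that unfolding C''_def by blast
  have C''O: "C'' \<subseteq> Ob T" using CO C''E ShO_in by blast
  have C''sh: "ShO T n c \<in> C''" if c: "c \<in> C''" for n c
  proof -
    obtain c0 m where c0: "c0 \<in> C'" "c = ShO T m c0" using C''E[OF c] by blast
    then have "ShO T n c = ShO T (n + m) c0" using CO by (simp add: subset_iff)
    then show ?thesis using C''I[OF c0(1)] by simp
  qed
  have C''sh1: "ShO T 1 ` C'' = C''"
  proof
    show "ShO T 1 ` C'' \<subseteq> C''" using C''sh by blast
    show "C'' \<subseteq> ShO T 1 ` C''" using ShO_image_iff[OF C''O, of _ 1] C''sh C''O by blast
  qed
  have C''coc: "\<exists>c0 n. cocompact U T c0 \<and> c = ShO T n c0" if "c \<in> C''" for c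
    using C''E[OF that] coc by blast
  have C'coc: "\<exists>c0 n. cocompact U T c0 \<and> c = ShO T n c0" if "c \<in> C'" for c
    using C''coc CC'' that by blast
  have "is_small U (\<Union>i\<in>{..0::int}. ShO T i ` C')"
    by (rule is_small_UN) (auto intro: is_small_countable is_small_surj[OF assms(5)])
  then have C''small: "is_small U C''" by (simp add: C''_def)
  have C''Hom: "is_small U (Hom T M c)" if c: "c \<in> C''" and M: "M \<in> Ob T" for c M
  proof -
    obtain c0 n where c0: "c0 \<in> C'" "c = ShO T n c0" using C''E[OF c] by blast
    have c0O: "c0 \<in> Ob T" using c0 CO by blast
    show ?thesis unfolding c0(2) by (rule is_small_Hom_ShO[OF M c0O assms(6)[OF c0(1) ShO_in[OF M]]])
  qed
  have D: "D = coenvelope U T C''" using assms(10) by (simp add: C''_def)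
  have Dp: "Dperp = left_orthogonal T C''"
    unfolding assms(11) by (rule left_orthogonal_triangulated_closure[OF prods CO C''_def C''sh CC''])

  \<comment> \<open>The weight structures generated by \<open>C'\<close> and by all its
    shifts\<close>
  have W1: "weight_structure T C1 C2"
    "\<And>M. M \<in> Ob T \<Longrightarrow> \<exists>b a d. tri b a d \<and> tgt b = M \<and> src b \<in> C1 \<and> ShO T (- 1) (tgt a) \<in> C2"
    "\<And>M X. M \<in> C1 \<Longrightarrow> X \<in> C2 \<Longrightarrow> noarr M (ShO T 1 X)"
    unfolding C1 C2
    using generated_weight_structure[OF prods C'coc assms(5) _ assms(7)] assms(6) by simp_all
  \<comment> \<open>Since \<open>C''[1] = C''\<close>, the left class is orthogonal to
    \<open>C''\<close> itself, which makes it \<open>Dperp\<close>.\<close>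
  have W2: "weight_structure T Dperp D"
    "\<And>M. M \<in> Ob T \<Longrightarrow> \<exists>b a d. tri b a d \<and> tgt b = M \<and> src b \<in> Dperp \<and> ShO T (- 1) (tgt a) \<in> D"
    "\<And>M X. M \<in> Dperp \<Longrightarrow> X \<in> D \<Longrightarrow> noarr M (ShO T 1 X)"
    unfolding D Dp
    using generated_weight_structure[OF prods C''coc C''small _ eq_refl[OF C''sh1], unfolded C''sh1] C''Hom by simp_all

  \<comment> \<open>Closure properties of the classes involved\<close>
  have C1_sub: "C1 \<subseteq> Ob T" and Dp_sub: "Dperp \<subseteq> Ob T" unfolding C1 Dp by (rule left_orthogonal_sub)+
  have C2_sub: "C2 \<subseteq> Ob T" and D_sub: "D \<subseteq> Ob T"
    unfolding C2 D by (rule coenvelope_sub[OF CO], rule coenvelope_sub[OF C''O])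
  have C2_env: "coenvelope_closed U T C2" and D_env: "coenvelope_closed U T D"
    unfolding C2 D by (rule coenvelope_closed_coenvelope[OF CO], rule coenvelope_closed_coenvelope[OF C''O])
  have C2D: "C2 \<subseteq> D" unfolding C2 D by (rule coenvelope_mono[OF CC''])
  have D_sh: "ShO T n X \<in> D" if "X \<in> D" for n X
    using coenvelope_ShO[OF C''O _ C''O, of n X] C''sh that unfolding D by blast
  have C2_sh: "ShO T 1 X \<in> C2" if "X \<in> C2" for X
    using coenvelope_ShO[OF CO assms(7) CO, of X] that unfolding C2 by blast
  have C1_sh: "ShO T (- 1) X \<in> C1" if "X \<in> C1" for X
  proof -
    have "X \<in> ShO T 1 ` C1" using W1(1) that unfolding weight_structure_def by blast
    then show ?thesis using ShO_image_iff[OF C1_sub] by blast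
  qed
  have ext_env: "extension_closed T E" if "coenvelope_closed U T E" "E \<subseteq> Ob T" for E
    unfolding extension_closed_iff[OF that(2)]
    using coenvelope_closed_basic(1)[OF that(1)] coenvelope_closed_extension[OF prods that] triD(4) by metis
  have D_ext: "extension_closed T D" and C2_ext: "extension_closed T C2"
    using ext_env D_env D_sub C2_env C2_sub by blast+
  have ext_orth: "extension_closed T (left_orthogonal T E)" if "E \<subseteq> Ob T" for E
    unfolding extension_closed_iff[OF left_orthogonal_sub]
    using left_orthogonal_zero[OF that] left_orthogonal_extension[OF that] by blast
  have C1_ext: "extension_closed T C1" and Dp_ext: "extension_closed T Dperp"
    unfolding C1 Dp using ext_orth C1O C''O by blast+
  have D_prod: "closed_under_products U T D" and C2_prod: "closed_under_products U T C2"
    using coenvelope_closed_basic(2) D_env C2_env by blast+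
  have C1_prod: "closed_under_products U T C1"
    unfolding C1 by (rule left_orthogonal_product[OF _ C1O]) (use coc in blast)
  have Dp_prod: "closed_under_products U T Dperp"
    unfolding Dp by (rule left_orthogonal_product[OF C''coc C''O])
  have C1'_prod: "closed_under_products U T C1'"
    unfolding C1' by (rule closed_under_products_Int[OF C1_prod D_prod])
  have Dp_sh: "ShO T n X \<in> Dperp" if X: "X \<in> Dperp" for n X
  proof -
    have XO: "X \<in> Ob T" using X Dp_sub by blast
    have "noarr (ShO T n X) c" if c: "c \<in> C''" for c
    proof -
      have "noarr X (ShO T (- n) c)"
        using X left_orthogonal_iff[OF C''O, of X] C''sh[OF c, of "- n"] by (simp add: Dp)
      then show ?thesis using noarr_sh'[OF XO, of c n] subsetD[OF C''O c] by simp
    qed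
    then show ?thesis using left_orthogonal_iff[OF C''O, of "ShO T n X"] XO by (simp add: Dp)
  qed
  have DpC1: "Dperp \<subseteq> C1"
  proof
    fix X assume "X \<in> Dperp"
    then have X: "X \<in> Ob T" "\<forall>c\<in>C''. noarr X c" using left_orthogonal_iff[OF C''O, of X] by (simp_all add: Dp)
    then have "\<forall>c\<in>ShO T 1 ` C'. noarr X c" using C''I by blast
    then show "X \<in> C1" using X left_orthogonal_iff[OF C1O, of X] by (simp add: C1)
  qed
  have D_ret: "retract_closed T D" and C2_ret: "retract_closed T C2" and C1_ret: "retract_closed T C1"
    using W1(1) W2(1) unfolding weight_structure_def by blast+
  have C1'_ret: "retract_closed T C1'"
    using C1_ret D_ret unfolding C1' retract_closed_def by blast
  have C1'_sub: "C1' \<subseteq> D" using C1' by blast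
  have C1'_ext: "extension_closed T C1'"
    using C1_ext D_ext unfolding C1' extension_closed_def by blast

  \<comment> \<open>The category \<open>K\<close> on the objects of \<open>D\<close>\<close>
  have triK: "triangulated_category (full_sub T D)" by (rule triangulated_full_sub[OF D_sub D_ext D_sh D_prod])
  interpret K: triangulated_small K U
    unfolding Kdef using triK assms(1) by (simp add: triangulated_small_def)
  note Ks = full_sub_simps[where D = D, folded Kdef]
  have prodsK: "has_products U K" unfolding Kdef by (rule has_products_full_sub[OF prods D_sub D_prod])
  have closedK: "closed_under_products U K E" if "E \<subseteq> D" "closed_under_products U T E" for E
    unfolding Kdef by (rule closed_under_products_full_sub[OF triK prods D_sub D_prod that])
  have C1'K: "closed_under_products U K C1'" and C2K: "closed_under_products U K C2"
    using closedK C1'_sub C1'_prod C2D C2_prod by blast+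
  have HK: "closed_under_products U K (C1' \<inter> C2)"
    by (rule K.closed_under_products_Int[OF C1'K C2K])
  have subK: "C1' \<subseteq> Ob K" "C2 \<subseteq> Ob K" using C1'_sub C2D Ks by simp_all
  have extK: "extension_closed K C1'" "extension_closed K C2"
    unfolding Kdef using extension_closed_full_sub[OF _ D_sub] C1'_ext C2_ext by blast+
  have C1'_sh: "ShO T (- 1) X \<in> C1'" if "X \<in> C1'" for X using that C1_sh D_sh unfolding C1' by blast
  have retK: "retract_closed K E" if "retract_closed T E" for E
    using that D_sub unfolding Kdef retract_closed_def is_retract_def full_sub_simps by blast
  have noarrK: "K.noarr X Y \<longleftrightarrow> noarr X Y" if "X \<in> D" "Y \<in> D" for X Y
    using noarr_full_sub[OF triK D_sub that] unfolding Kdef .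

  \<comment> \<open>The weight structure on \<open>K\<close>\<close>
  have "weight_structure K C1' C2"
    unfolding weight_structure_def
  proof (intro conjI ballI)
    show "C1' \<subseteq> Ob K" "C2 \<subseteq> Ob K" by (rule subK)+
    show "retract_closed K C1'" "retract_closed K C2" by (rule retK[OF C1'_ret], rule retK[OF C2_ret])
    show "C1' \<subseteq> ShO K 1 ` C1'"
      using C1'_sh K.ShO_image_iff[OF subK(1), of _ 1] subK(1) unfolding Ks by blast
    show "ShO K 1 ` C2 \<subseteq> C2" using C2_sh unfolding Ks by blast
    show "orthogonal K C1' (ShO K 1 ` C2)"
      using W1(1) unfolding weight_structure_def orthogonal_def Ks C1' by blast
    fix M assume "M \<in> Ob K"
    then have MD: "M \<in> D" and MO: "M \<in> Ob T" using D_sub unfolding Ks by blast+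
    obtain b a d where t: "tri b a d" and M: "tgt b = M" and b: "src b \<in> C1" and a: "ShO T (- 1) (tgt a) \<in> C2"
      using W1(2)[OF MO] by blast
    note B = triD[OF t]
    have aD1: "ShO T (- 1) (tgt a) \<in> D" using a C2D by blast
    have aD: "tgt a \<in> D" using D_sh[OF aD1, of 1] B by simp
    \<comment> \<open>The decomposition in \<open>T\<close> of an object of \<open>D\<close> already
      lies in \<open>D\<close>: the second term does because \<open>C2\<close> is contained in
      \<open>D\<close>, and the first is its fibre.\<close>
    have bD: "src b \<in> D"
    proof -
      have "tri (opp (sh (- 1) d)) b a" by (rule tri_unrot[OF t])
      then have "src (opp (sh (- 1) d)) \<in> D \<longrightarrow> tgt b \<in> D \<longrightarrow> tgt (opp (sh (- 1) d)) \<in> D"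
        using D_ext unfolding extension_closed_iff[OF D_sub] by blast
      then show ?thesis using aD1 M MD B by simp
    qed
    have "tgt a \<in> ShO T 1 ` C2" using ShO_image_iff[OF C2_sub] a B by simp
    moreover have "(src b, M, tgt a, mor b, mor a, mor d) \<in> Dist K"
      using t M MD aD bD unfolding Kdef full_sub_simps tri_def by blast
    ultimately have "weight_decomposition K C1' C2 (src b) M (tgt a) (mor b) (mor a) (mor d)"
      unfolding weight_decomposition_def Ks C1' using b bD by blast
    then show "\<exists>B A b a d. weight_decomposition K C1' C2 B M A b a d" by blast
  qed

  \<comment> \<open>Non-degeneracy from below\<close>
  moreover have "nondegenerate_below K C1'"
    unfolding nondegenerate_below_def Ks
  proof (intro equalityI subsetI)
    fix X assume "X \<in> (\<Inter>l::int. ShO T l ` C1')"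
    then have all: "X \<in> Ob T \<and> ShO T (- l) X \<in> C1'" for l
      using ShO_image_iff[of C1' X] C1'_sub D_sub by blast
    have XO: "X \<in> Ob T" using all by blast
    have XD: "X \<in> D" using all[of 0] C1'_sub XO by auto
    have "noarr X c" if c: "c \<in> C''" for c
    proof -
      obtain c0 n where c0: "c0 \<in> C'" "c = ShO T n c0" using C''E[OF c] by blast
      have c0O: "c0 \<in> Ob T" using c0 CO by blast
      \<comment> \<open>\<open>C1\<close> is orthogonal to \<open>c0[1]\<close>, so the shift by
        \<open>n - 1\<close> is the one that tests \<open>X\<close> against
        \<open>c0[n]\<close>.\<close>
      have "ShO T (- (n - 1)) X \<in> C1" using all[of "n - 1"] unfolding C1' by blast
      then have "noarr (ShO T (- (n - 1)) X) (ShO T 1 c0)"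
        using left_orthogonal_iff[OF C1O, of "ShO T (- (n - 1)) X"] c0(1) by (simp add: C1)
      then show ?thesis using noarr_sh'[OF XO, of "ShO T 1 c0" "- (n - 1)"] c0O c0(2) by simp
    qed
    then have "X \<in> Dperp" using left_orthogonal_iff[OF C''O, of X] XO by (simp add: Dp)
    \<comment> \<open>Now \<open>X\<close> lies in both halves of the semi-orthogonal decomposition;
      orthogonality is stated against a shift by 1, hence the argument X[-1].\<close>
    from W2(3)[OF this D_sh[OF XD, of "- 1"]] have "noarr X X" using XO by simp
    then have "is_zero T X" by (rule noarr_self_zero[OF XO])
    then show "X \<in> {Z. is_zero K Z}" unfolding Kdef using full_sub_is_zero[OF D_sub] XD by blast
  next
    fix X assume "X \<in> {Z. is_zero K Z}"
    then have X: "is_zero T X" unfolding Kdef using full_sub_is_zero[OF D_sub] by blast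
    have "ShO T (- l) X \<in> C1'" for l
      using is_zero_ShO[OF X] C1'_ext unfolding extension_closed_def by blast
    then have "X \<in> ShO T l ` C1'" for l
      using ShO_image_iff[of C1' X] C1'_sub D_sub is_zero_ob[OF X] by blast
    then show "X \<in> (\<Inter>l. ShO T l ` C1')" by blast
  qed

  \<comment> \<open>\<open>C1\<close> as an extension-closure\<close>
  moreover have "C1 = extension_closure T (C1' \<union> Dperp)"
    unfolding extension_closure_def
  proof (intro equalityI)
    show "\<Inter> {E. E \<subseteq> Ob T \<and> extension_closed T E \<and> C1' \<union> Dperp \<subseteq> E} \<subseteq> C1"
      using C1_sub C1_ext DpC1 C1' by blast
    show "C1 \<subseteq> \<Inter> {E. E \<subseteq> Ob T \<and> extension_closed T E \<and> C1' \<union> Dperp \<subseteq> E}"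
    proof (intro subsetI InterI)
      fix X E assume X: "X \<in> C1" and "E \<in> {E. E \<subseteq> Ob T \<and> extension_closed T E \<and> C1' \<union> Dperp \<subseteq> E}"
      then have E: "E \<subseteq> Ob T" "extension_closed T E" "C1' \<subseteq> E" "Dperp \<subseteq> E" by blast+
      have XO: "X \<in> Ob T" using X C1_sub by blast
      obtain b a d where t: "tri b a d" and M: "tgt b = X" and b: "src b \<in> Dperp" and a: "ShO T (- 1) (tgt a) \<in> D"
        using W2(2)[OF XO] by blast
      note B = triD[OF t]
      have aD: "tgt a \<in> D" using D_sh[OF a, of 1] B by simp
      \<comment> \<open>The component of \<open>X\<close> in \<open>D\<close> is an extension of the
        shifted \<open>Dperp\<close> component by \<open>X\<close>; both lie in \<open>C1\<close>,
        so it lies in \<open>C1'\<close>.\<close>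
      have "tri a d (opp (sh 1 b))" by (rule tri_rot[OF t])
      then have "src a \<in> C1 \<longrightarrow> tgt d \<in> C1 \<longrightarrow> tgt a \<in> C1"
        using C1_ext unfolding extension_closed_iff[OF C1_sub] by blast
      moreover have "tgt d \<in> C1" using Dp_sh[OF b, of 1] DpC1 B by auto
      ultimately have "tgt a \<in> C1" using X M B by simp
      then have "tgt a \<in> E" using aD E(3) C1' by blast
      moreover have "src b \<in> E" using b E(4) by blast
      ultimately show "X \<in> E" using E(2) t M unfolding extension_closed_iff[OF E(1)] by blast
    qed
  qed

  \<comment> \<open>Idempotent completeness\<close>
  moreover have karT: "karoubian T" by (rule karoubianI[OF prods])
  moreover have karK: "karoubian K" unfolding Kdef by (rule karoubian_full_sub[OF karT D_ret D_sub])
  moreover have "karoubian (full_sub T C1)" "karoubian (full_sub T C1')" "karoubian (full_sub T C2)"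
    using karoubian_full_sub[OF karT] C1_ret C1_sub C1'_ret C1'_sub D_sub C2_ret C2_sub by blast+

  \<comment> \<open>The heart as a Karoubization\<close>
  moreover have "equivalent_categories (full_sub K (C1' \<inter> C2))
      (karoubization (full_sub K (products_of_objects U K {cx c n | c n. c \<in> C'})))"
    if wc: "\<forall>c\<in>C'. is_weight_complex K C1' C2 c (cx c) (dx c)" for cx dx
  proof (rule K.equivalent_karoubization)
    have sh1K: "X \<in> C1' \<Longrightarrow> ShO K (- 1) X \<in> C1'" "X \<in> C2 \<Longrightarrow> ShO K 1 X \<in> C2" for X
      using C1'_sh C2_sh unfolding Ks by blast+
    show "C1' \<inter> C2 \<subseteq> Ob K" using subK by blast
    have cx: "cx c n \<in> C1' \<inter> C2" if c: "c \<in> C'" for c n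
    proof -
      obtain t where t: "weight_Postnikov_tower K C1' C2 c t" "cx c n = ShO K n (gr t (- n))"
        using wc c unfolding is_weight_complex_def by blast
      from K.tower_gr_heart[OF subK(1) extK(1) sh1K(1) subK(2) extK(2) sh1K(2) t(1), of "- n"] t(2)
      show ?thesis by simp
    qed
    show "products_of_objects U K {cx c n | c n. c \<in> C'} \<subseteq> C1' \<inter> C2"
    proof
      fix P assume "P \<in> products_of_objects U K {cx c n | c n. c \<in> C'}"
      then obtain I X p where I: "I \<in> U" "X ` I \<subseteq> {cx c n | c n. c \<in> C'}" "is_product K I X P p"
        unfolding products_of_objects_def by blast
      have "X i \<in> C1' \<inter> C2" if i: "i \<in> I" for i
      proof -
        have "X i \<in> {cx c n | c n. c \<in> C'}" using I(2) i by blast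
        then show ?thesis using cx by auto
      qed
      then show "P \<in> C1' \<inter> C2" by (rule K.closed_is_product[OF HK I(1) I(3)])
    qed
    have "retract_closed K (C1' \<inter> C2)"
      using retK[OF C1'_ret] retK[OF C2_ret] unfolding retract_closed_def by blast
    then show "karoubian (full_sub K (C1' \<inter> C2))" using K.karoubian_full_sub[OF karK] subK by blast
    fix M assume M: "M \<in> C1' \<inter> C2"
    have orth: "K.noarr X (ShO K 1 Y)" if "X \<in> C1'" "Y \<in> C2" for X Y
      using W1(3)[of X Y] that noarrK[of X "ShO T 1 Y"] C1'_sub C2D D_sh unfolding Ks C1' by blast
    \<comment> \<open>Vanishing of morphisms from \<open>N\<close> to \<open>C'\<close> is, after
      one shift, membership of N[1] in the left orthogonal of C'[1].\<close>
    have detect: "ShO K 1 N \<in> C1'" if N: "N \<in> Ob K" and n: "\<And>c. c \<in> C' \<Longrightarrow> K.noarr N c" for N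
    proof -
      have ND: "N \<in> D" and NO: "N \<in> Ob T" using N D_sub unfolding Ks by blast+
      have "noarr (ShO T 1 N) (ShO T 1 c)" if c: "c \<in> C'" for c
      proof -
        have "c \<in> D" using c coenvelope_sup[of C'] C2D unfolding C2 by blast
        then show ?thesis using n[OF c] noarrK[OF ND] noarr_sh[OF NO, of c 1] CO c by blast
      qed
      then have "ShO T 1 N \<in> C1" using left_orthogonal_iff[OF C1O, of "ShO T 1 N"] NO by (simp add: C1)
      then show ?thesis using D_sh[OF ND] unfolding Ks C1' by blast
    qed
    have CC2: "C' \<subseteq> C2" unfolding C2 by (rule coenvelope_sup)
    have HomK: "is_small U (Hom K M c)" if "c \<in> C'" "M \<in> Ob K" for c M
      using assms(6) that D_sub unfolding Ks by blast
    have wc': "c \<in> C' \<Longrightarrow> is_weight_complex K C1' C2 c (cx c) (dx c)" for c using wc by blast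
    show "\<exists>P\<in>products_of_objects U K {cx c n | c n. c \<in> C'}. is_retract K M P"
      using K.heart_object_retract[OF prodsK subK(1) extK(1) sh1K(1) C1'K subK(2) extK(2) sh1K(2) orth
          CC2 assms(5) HomK detect wc', of M] M by blast
  qed
  ultimately show ?thesis
    using W1(1) triangulated_subcategoryI[OF D_sub D_ext D_sh D_prod] D_prod
      triangulated_subcategoryI[OF Dp_sub Dp_ext Dp_sh Dp_prod] Dp_prod C2D C1'_prod HK
      K.products_of_weight_decompositionsI[OF C1'K C2K subK(2)]
      K.products_of_weight_Postnikov_towersI[OF prodsK C1'K subK(1) C2K subK(2)]
      K.products_of_weight_complexesI[OF prodsK C1'K subK(1) C2K subK(2)]
    by blast
qed

end
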